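(* Under the setting and notation of the context, suppose Assumption $(\mathcal A)$ holds and put $\bar S=\bar A_1+\dots+\bar A_{\bar n}$. Then, as $x\to 0$, $$\mathbb P[X\le x]=\frac{C}{\bar S}\left(\log\tfrac1x\right)^{-\frac{1+\bar n}{2}}x^{\sum_{k=1}^{\bar n}\bar A_k\left(\log\frac{\bar S}{\bar A_k}+\bar\mu_k\right)}\exp\left\{-\tfrac12\bar S\log^2\tfrac1x\right\}\left(1+O\left(\left(\log\tfrac1x\right)^{-1}\right)\right),$$ where $$C=\frac{1}{\sqrt{2\pi}\sqrt{\det\bar{\mathfrak B}}}\frac{\sqrt{\bar S}}{\sqrt{\bar A_1\cdots\bar A_{\bar n}}}\exp\left\{-\tfrac12\sum_{i,j=1}^{\bar n}\bar a_{ij}\left(\log\tfrac{\bar S}{\bar A_i}+\bar\mu_i\right)\left(\log\tfrac{\bar S}{\bar A_j}+\bar\mu_j\right)\right\}.$$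
   Context: Let $Y=(Y_1,\dots,Y_n)$ be a Gaussian vector with mean $\mu\in\mathbb R^n$ and covariance matrix $\mathfrak B=(b_{ij})$ with $\det\mathfrak B>0$. Let $X=\sum_{i=1}^n e^{Y_i}$. Let $\Delta_n=\{w\in\mathbb R^n: w_i\ge0,\ \sum_i w_i=1\}$ and let $\bar w$ be the unique minimizer of $w^\top\mathfrak B w$ over $\Delta_n$. Let $\bar I=\{i:\bar w_i\ne0\}$ and $\bar n=|\bar I|$; since $X$ is symmetric in the components, the coordinates are labeled so that $\bar I=\{1,\dots,\bar n\}$. Set $\bar\mu=(\mu_1,\dots,\mu_{\bar n})$, $\bar{\mathfrak B}=(b_{ij})_{i,j=1}^{\bar n}$, let $\bar a_{ij}$ be the entries of $\bar{\mathfrak B}^{-1}$ and $\bar A_k=\sum_{j=1}^{\bar n}\bar a_{kj}$ (one has $\bar A_k>0$). Let $e^i$ denote the $i$-th standard basis vector of $\mathbb R^n$. Assumption $(\mathcal A)$: for every $i\in\{1,\dots,n\}\setminus\bar I$, $(e^i-\bar w)^\top\mathfrak B\bar w\neq0$. *)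

theory Defs
  imports "HOL-Probability.Probability" "HOL-Library.Landau_Symbols"
begin

text \<open>Vectors in R^n are functions nat => real on the index set {..<n};
matrices are functions nat => nat => real. Submatrices are taken on an
index set I (this avoids relabelling the support of the minimizer).\<close>

definition det_on :: "nat set \<Rightarrow> (nat \<Rightarrow> nat \<Rightarrow> real) \<Rightarrow> real" where
  "det_on I M = (\<Sum>p | p permutes I. of_int (sign p) * (\<Prod>i\<in>I. M i (p i)))"

definition is_inv_on :: "nat set \<Rightarrow> (nat \<Rightarrow> nat \<Rightarrow> real) \<Rightarrow> (nat \<Rightarrow> nat \<Rightarrow> real) \<Rightarrow> bool" where
  "is_inv_on I M A \<longleftrightarrow>
     (\<forall>i\<in>I. \<forall>k\<in>I. (\<Sum>j\<in>I. M i j * A j k) = (if i = k then 1 else 0)) \<and>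
     (\<forall>i\<in>I. \<forall>k\<in>I. (\<Sum>j\<in>I. A i j * M j k) = (if i = k then 1 else 0))"

definition inv_on :: "nat set \<Rightarrow> (nat \<Rightarrow> nat \<Rightarrow> real) \<Rightarrow> (nat \<Rightarrow> nat \<Rightarrow> real)" where
  "inv_on I M = (SOME A. is_inv_on I M A)"

definition quad_form :: "nat set \<Rightarrow> (nat \<Rightarrow> nat \<Rightarrow> real) \<Rightarrow> (nat \<Rightarrow> real) \<Rightarrow> (nat \<Rightarrow> real) \<Rightarrow> real" where
  "quad_form I M v w = (\<Sum>i\<in>I. \<Sum>j\<in>I. v i * M i j * w j)"

definition std_simplex :: "nat \<Rightarrow> (nat \<Rightarrow> real) set" where
  "std_simplex n = {w. (\<forall>i<n. 0 \<le> w i) \<and> (\<Sum>i<n. w i) = 1}"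

abbreviation lebesgue_n :: "nat \<Rightarrow> (nat \<Rightarrow> real) measure" where
  "lebesgue_n n \<equiv> PiM {..<n} (\<lambda>_. lborel)"

definition gaussian_density :: "nat \<Rightarrow> (nat \<Rightarrow> real) \<Rightarrow> (nat \<Rightarrow> nat \<Rightarrow> real) \<Rightarrow> (nat \<Rightarrow> real) \<Rightarrow> real" where
  "gaussian_density n \<mu> B y =
     exp (- quad_form {..<n} (inv_on {..<n} B) (\<lambda>i. y i - \<mu> i) (\<lambda>i. y i - \<mu> i) / 2)
     / sqrt ((2 * pi) ^ n * det_on {..<n} B)"

end

theory Submission
  imports Defs "HOL-Real_Asymp.Real_Asymp"
begin

text \<open>Put \<open>L = log (1 / x)\<close>. On the support \<open>I\<close> of the minimizer the substitution \<open>u k = y k + L + log (S / A k)\<close> turns the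
  Gaussian density into \<open>exp (L \<Sum>k. A k * u k) * g u\<close> with \<open>g\<close> a fixed Gaussian factor. The integral of
  \<open>exp (\<Sum>k. a k * y k)\<close> over \<open>{y. \<Sum>k. exp (y k) \<le> x}\<close> is a Dirichlet integral, hence an explicit quotient of Gamma values, so no
  Laplace method is needed: Stirling's formula gives the mass of the weight, and the Gamma recurrence gives the exact moments of
  \<open>exp (u k)\<close> and \<open>exp (- u k)\<close>, which control the replacement of \<open>g u\<close> by \<open>g 0\<close> up to a relative error \<open>O(1 / L)\<close>.
  The coordinates off the support only matter on an event of relatively negligible probability: the first-order conditions of the
  minimization problem together with the nondegeneracy assumption say that they are typically much smaller than \<open>x\<close>, and a Chernoff
  bound makes this quantitative.\<close>

section \<open>Stirling's formula for the real Gamma function\<close>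

text \<open>Two places dictate the rate \<open>1 / L\<close>. Under the normalised weight the
  \<open>u k\<close> fluctuate up to the scale of the square root of \<open>1 / L\<close>, so a
  Lipschitz bound on \<open>g\<close> would be too weak: the linear term has to be averaged exactly,
  and its mean is of order \<open>1 / L\<close> because the weight is centred at the maximiser of
  the linear form. In the lower bound, part of the budget \<open>x\<close> goes to the coordinates
  off the support. The leading term carries \<open>exp (- S * L^2 / 2)\<close>, so raising
  \<open>L\<close> by \<open>\<delta>\<close> costs a relative amount of order
  \<open>L * \<delta>\<close>; only a share of order \<open>1 / L^2\<close> can be given away. The
  off-support coordinates must then stay below \<open>- L - 2 * ln L\<close> minus a constant, and
  the factor \<open>exp (O(L * ln L))\<close> lost in the Chernoff bound is harmless against the
  gain \<open>exp (- \<kappa> * L^2)\<close>. The minimizer and the weight are linked by duality: on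
  the support the row sums of the inverse are \<open>w k / s\<close>, with \<open>s\<close> the
  minimal value. Hence the Dirichlet parameters \<open>L * A k\<close> are positive and
  \<open>S = 1 / s\<close>, which matches the Chernoff exponent with that of the leading
  term.\<close>

definition stirling_ln :: "real \<Rightarrow> real" where
  "stirling_ln x = (x - 1/2) * ln x - x + ln (2 * pi) / 2"

lemma Gamma_plus1_real: "x > 0 \<Longrightarrow> Gamma (x + 1) = x * Gamma (x :: real)"
  by (intro Gamma_plus1) (auto elim!: nonpos_Ints_cases)

lemma ln_Gamma_plus1_real:
  fixes x :: real assumes "x > 0" shows "ln_Gamma (x + 1) = ln_Gamma x + ln x"
proof -
  have "Gamma (x + 1) = x * Gamma x"
    using assms by (rule Gamma_plus1_real)
  moreover have "Gamma x > 0" using assms by (simp add: Gamma_real_pos)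
  ultimately show ?thesis using assms by (simp add: ln_Gamma_real_pos ln_mult_pos)
qed

text \<open>The increment \<open>r x - r (x + 1)\<close> equals
  \<open>(x + 1/2) * (ln (x + 1) - ln x) - 1\<close>. The midpoint and trapezoid rules for the
  convex function \<open>1 / t\<close> on \<open>[x, x + 1]\<close> enclose the logarithm, and the
  trapezoid excess \<open>1 / (4 * x * (x + 1))\<close> telescopes. So along unit steps
  \<open>r\<close> decreases while \<open>r\<close> minus \<open>1 / (4 * x)\<close>
  increases.\<close>

lemma stirling_remainder_step:
  fixes x :: real assumes x: "x > 0"
  defines "r \<equiv> \<lambda>x. ln_Gamma x - stirling_ln x"
  shows "r (x + 1) \<le> r x" "r x - 1 / (4 * x) \<le> r (x + 1) - 1 / (4 * (x + 1))"
proof -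
  define l where "l = ln (x + 1) - ln x"
  have eq: "r x - r (x + 1) = (x + 1/2) * l - 1"
    unfolding r_def stirling_ln_def ln_Gamma_plus1_real[OF x] l_def by (simp add: algebra_simps)
  have lo: "l \<ge> 2 / (2 * x + 1)"
    using ln_inverse_approx_ge[of x "x + 1"] x by (simp add: l_def algebra_simps)
  have hi: "l \<le> (1 / x + 1 / (x + 1)) / 2"
    using ln_inverse_approx_le[of x 1] x by (simp add: l_def field_simps)
  have "(x + 1/2) * (2 / (2 * x + 1)) \<le> (x + 1/2) * l" using lo x by (intro mult_left_mono) auto
  moreover have "(x + 1/2) * (2 / (2 * x + 1)) = 1" using x by (simp add: divide_simps)
  ultimately show "r (x + 1) \<le> r x" using eq by linarith
  have "(x + 1/2) * l \<le> (x + 1/2) * ((1 / x + 1 / (x + 1)) / 2)" using hi x by (intro mult_left_mono) auto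
  also have "\<dots> = 1 + 1 / (4 * x) - 1 / (4 * (x + 1))"
    using x by (simp add: divide_simps) (simp add: algebra_simps)
  finally show "r x - 1 / (4 * x) \<le> r (x + 1) - 1 / (4 * (x + 1))" using eq by linarith
qed

text \<open>Gauss's product limit for \<open>Gamma x\<close>, read backwards, says that
  \<open>ln_Gamma (x + n) - ln_Gamma n\<close> is \<open>x * ln n + o(1)\<close>. The increments of
  \<open>stirling_ln\<close> have the same behaviour, so the limit of the remainder does not depend
  on the starting point \<open>x\<close>.\<close>

lemma stirling_remainder_diff_tendsto:
  fixes x :: real assumes x: "x > 0"
  shows "(\<lambda>n. (ln_Gamma (x + real n) - stirling_ln (x + real n)) - (ln_Gamma (real n) - stirling_ln (real n)))
    \<longlonglongrightarrow> 0"
proof -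
  have xn: "x \<notin> \<int>\<^sub>\<le>\<^sub>0" using x by (auto elim!: nonpos_Ints_cases)
  have G: "Gamma x > 0" using x by (simp add: Gamma_real_pos)
  have "(\<lambda>n. ln (Gamma_series' x n)) \<longlonglongrightarrow> ln (Gamma x)"
    using G by (intro tendsto_ln Gamma_series'_LIMSEQ) auto
  moreover have "\<forall>\<^sub>F n in sequentially. ln (Gamma_series' x n) =
      ln_Gamma (real n) + x * ln (real n) - (ln_Gamma (x + real n) - ln (Gamma x))"
    using eventually_gt_at_top[of 0]
  proof eventually_elim
    case (elim n)
    have 1: "pochhammer x n = Gamma (x + real n) / Gamma x"
      using pochhammer_Gamma[of x n] xn by simp
    have 2: "Gamma (x + real n) > 0" using x by (simp add: Gamma_real_pos)
    have "ln (Gamma_series' x n) = ln (fact (n - 1)) + x * ln (real n) - ln (pochhammer x n)"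
      unfolding Gamma_series'_def using elim x pochhammer_pos[OF x, of n] by (simp add: ln_divide_pos ln_mult_pos)
    also have "ln (pochhammer x n) = ln_Gamma (x + real n) - ln (Gamma x)"
      using 1 2 G x by (simp add: ln_divide_pos ln_Gamma_real_pos)
    also have "ln (fact (n - 1)) = ln_Gamma (real n)"
      using elim by (simp add: ln_Gamma_real_conv_fact)
    finally show ?case .
  qed
  ultimately have "(\<lambda>n. ln_Gamma (real n) + x * ln (real n) - (ln_Gamma (x + real n) - ln (Gamma x)))
     \<longlonglongrightarrow> ln (Gamma x)" by (rule Lim_transform_eventually)
  hence "(\<lambda>n. ln (Gamma x) - (ln_Gamma (real n) + x * ln (real n) - (ln_Gamma (x + real n) - ln (Gamma x))))
     \<longlonglongrightarrow> ln (Gamma x) - ln (Gamma x)" by (intro tendsto_intros)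
  moreover have "(\<lambda>n. x * ln (real n) - (stirling_ln (x + real n) - stirling_ln (real n))) \<longlonglongrightarrow> 0"
    unfolding stirling_ln_def using x by real_asymp
  ultimately have "(\<lambda>n. ln (Gamma x) - (ln_Gamma (real n) + x * ln (real n) - (ln_Gamma (x + real n) - ln (Gamma x)))
     + (x * ln (real n) - (stirling_ln (x + real n) - stirling_ln (real n)))) \<longlonglongrightarrow> ln (Gamma x) - ln (Gamma x) + 0"
    by (intro tendsto_add)
  thus ?thesis by (simp add: algebra_simps)
qed

lemma Gamma_legendre_duplication_real:
  fixes x :: real assumes "x > 0"
  shows "Gamma x * Gamma (x + 1/2) = 2 powr (1 - 2 * x) * sqrt pi * Gamma (2 * x)"
proof -
  have "complex_of_real (Gamma x * Gamma (x + 1/2)) = Gamma (of_real x) * Gamma (of_real x + 1/2)"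
    using Gamma_complex_of_real[of "x + 1/2"] Gamma_complex_of_real[of x] by simp
  also have "\<dots> = exp ((1 - 2 * of_real x) * of_real (ln 2)) * of_real (sqrt pi) * Gamma (2 * of_real x)"
  proof (rule Gamma_legendre_duplication)
    show "complex_of_real x \<notin> \<int>\<^sub>\<le>\<^sub>0" using assms by (auto elim!: nonpos_Ints_cases simp: complex_eq_iff)
    show "complex_of_real x + 1 / 2 \<notin> \<int>\<^sub>\<le>\<^sub>0" using assms by (auto elim!: nonpos_Ints_cases simp: complex_eq_iff)
  qed
  also have "\<dots> = complex_of_real (2 powr (1 - 2 * x) * sqrt pi * Gamma (2 * x))"
    using Gamma_complex_of_real[of "2 * x"] by (simp add: powr_def exp_of_real[symmetric])
  finally show ?thesis unfolding of_real_eq_iff .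
qed

text \<open>Monotonicity gives some limit \<open>l\<close>; Legendre's duplication formula
  identifies it. The combination \<open>r n + r (n + 1/2) - r (2 * n)\<close> tends to
  \<open>l + l - l\<close>, yet by duplication it is an elementary expression that tends to
  \<open>0\<close>. This is what confirms the constant \<open>ln (2 * pi) / 2\<close>.\<close>

lemma stirling_remainder_nat_tendsto:
  "(\<lambda>n. ln_Gamma (real n) - stirling_ln (real n)) \<longlonglongrightarrow> 0"
proof -
  define r where "r \<equiv> \<lambda>x. ln_Gamma x - stirling_ln (x::real)"
  define rn where "rn \<equiv> \<lambda>n. r (real (Suc n))"
  have step: "r (x+1) \<le> r x" "r x - 1 / (4 * x) \<le> r (x + 1) - 1 / (4 * (x + 1))" if "x > 0" for x
    using stirling_remainder_step[OF that] by (simp_all add: r_def)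
  have dec: "decseq rn"
    unfolding decseq_Suc_iff rn_def using step(1) by (metis add.commute of_nat_0_less_iff of_nat_Suc zero_less_Suc)
  have inc: "incseq (\<lambda>n. rn n - 1 / (4 * real (Suc n)))"
    unfolding incseq_Suc_iff rn_def using step(2)
    by (metis add.commute of_nat_0_less_iff of_nat_Suc zero_less_Suc)
  have lb: "\<forall>n. rn 0 - 1 / (4 * real (Suc 0)) \<le> rn n"
  proof
    fix n
    have "0 \<le> 1 / (4 * real (Suc n))" by simp
    moreover have "rn 0 - 1 / (4 * real (Suc 0)) \<le> rn n - 1 / (4 * real (Suc n))"
      by (rule incseqD[OF inc]) simp
    ultimately show "rn 0 - 1 / (4 * real (Suc 0)) \<le> rn n" by linarith
  qed
  obtain l where "rn \<longlonglongrightarrow> l" using decseq_convergent[OF dec lb] by blast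
  hence l: "(\<lambda>n. r (real n)) \<longlonglongrightarrow> l" unfolding rn_def by (subst (asm) filterlim_sequentially_Suc)
  have l2: "(\<lambda>n. r (1/2 + real n)) \<longlonglongrightarrow> l"
    using tendsto_add[OF stirling_remainder_diff_tendsto[of "1/2"] l] by (simp add: r_def)
  have l3: "(\<lambda>n. r (real (2 * n))) \<longlonglongrightarrow> l"
    by (rule filterlim_compose[OF l]) real_asymp
  have A: "(\<lambda>n. r (real n) + r (1/2 + real n) - r (real (2 * n))) \<longlonglongrightarrow> l + l - l"
    by (intro tendsto_intros l l2 l3)
  have E: "\<forall>\<^sub>F n in sequentially. r (real n) + r (1/2 + real n) - r (real (2 * n)) =
     (1 - 2 * real n) * ln 2 + ln pi / 2 - stirling_ln (real n) - stirling_ln (1/2 + real n) + stirling_ln (2 * real n)"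
    using eventually_gt_at_top[of 0]
  proof eventually_elim
    case (elim n)
    have p: "Gamma (real n) > 0" "Gamma (real n + 1/2) > 0" "Gamma (2 * real n) > 0"
      using elim by (auto simp: Gamma_real_pos)
    have "ln (Gamma (real n) * Gamma (real n + 1/2)) = ln (2 powr (1 - 2 * real n) * sqrt pi * Gamma (2 * real n))"
      using Gamma_legendre_duplication_real[of "real n"] elim by simp
    hence "ln_Gamma (real n) + ln_Gamma (real n + 1/2) = (1 - 2 * real n) * ln 2 + ln pi / 2 + ln_Gamma (2 * real n)"
      using p elim by (simp add: ln_mult ln_Gamma_real_pos ln_sqrt ln_powr)
    thus ?case by (simp add: r_def add.commute)
  qed
  have Z: "(\<lambda>n. (1 - 2 * real n) * ln 2 + ln pi / 2 - stirling_ln (real n) - stirling_ln (1/2 + real n) + stirling_ln (2 * real n)) \<longlonglongrightarrow> 0"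
  proof -
    have "(\<lambda>n. (1 - 2 * real n) * ln 2 - (real n - 1/2) * ln (real n) + real n - real n * ln (1/2 + real n) + (1/2 + real n)
       + (2 * real n - 1/2) * ln (2 * real n) - 2 * real n - ln 2 / 2) \<longlonglongrightarrow> 0" by real_asymp
    moreover have "ln (2 * pi) = ln 2 + ln pi" by (simp add: ln_mult_pos)
    ultimately show ?thesis unfolding stirling_ln_def by (simp add: algebra_simps add_divide_distrib)
  qed
  from LIMSEQ_unique[OF Lim_transform_eventually[OF A E] Z] have "l = 0" by simp
  thus ?thesis using l by (simp add: r_def)
qed

text \<open>Along \<open>x + n\<close> the remainder decreases to \<open>0\<close>, and the
  remainder minus \<open>1 / (4 * (x + n))\<close> increases to \<open>0\<close>; evaluating both at
  \<open>n = 0\<close> gives the two bounds. An explicit bound of order \<open>1 / x\<close> is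
  needed because a relative error \<open>O(1 / L)\<close> is claimed.\<close>

lemma stirling_ln_Gamma_bounds:
  fixes x :: real assumes x: "x > 0"
  shows "ln_Gamma x - stirling_ln x \<in> {0..1 / (4 * x)}"
proof -
  define r where "r \<equiv> \<lambda>x. ln_Gamma x - stirling_ln (x::real)"
  have lim: "(\<lambda>n. r (x + real n)) \<longlonglongrightarrow> 0"
    using tendsto_add[OF stirling_remainder_diff_tendsto[OF x] stirling_remainder_nat_tendsto] by (simp add: r_def)
  have dec: "decseq (\<lambda>n. r (x + real n))"
    unfolding decseq_Suc_iff using stirling_remainder_step(1)[of "x + real n" for n] x
    by (simp add: r_def add.assoc add.commute[of 1])
  have inc: "incseq (\<lambda>n. r (x + real n) - 1 / (4 * (x + real n)))"
    unfolding incseq_Suc_iff using stirling_remainder_step(2)[of "x + real n" for n] x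
    by (simp add: r_def add.assoc add.commute[of 1])
  have "(\<lambda>n. 1 / (4 * (x + real n))) \<longlonglongrightarrow> 0" by real_asymp
  from tendsto_diff[OF lim this] have "(\<lambda>n. r (x + real n) - 1 / (4 * (x + real n))) \<longlonglongrightarrow> 0" by simp
  from incseq_le[OF inc this, of 0] decseq_ge[OF dec lim, of 0] show ?thesis by (simp add: r_def)
qed

section \<open>Determinants, inverses and positive definite matrices on an index set\<close>

definition mat_vec_on :: "nat set \<Rightarrow> (nat \<Rightarrow> nat \<Rightarrow> real) \<Rightarrow> (nat \<Rightarrow> real) \<Rightarrow> nat \<Rightarrow> real" where
  "mat_vec_on I M v i = (\<Sum>j\<in>I. M i j * v j)"

lemma quad_form_mat_vec: "quad_form I M v w = (\<Sum>i\<in>I. v i * mat_vec_on I M w i)"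
  unfolding quad_form_def mat_vec_on_def by (simp add: sum_distrib_left mult.assoc)

text \<open>Isolating the entry of row \<open>k\<close> in each permutation term exhibits the
  determinant as a linear functional of that row, which is the form all later row operations
  use.\<close>

lemma det_on_row_expand:
  assumes I: "finite I" "k \<in> I"
  shows "det_on I (M(k := r)) =
    (\<Sum>p | p permutes I. r (p k) * (of_int (sign p) * (\<Prod>i\<in>I - {k}. M i (p i))))"
  unfolding det_on_def
proof (intro sum.cong refl)
  fix p assume "p \<in> {p. p permutes I}"
  have "(\<Prod>i\<in>I. (M(k := r)) i (p i)) = r (p k) * (\<Prod>i\<in>I - {k}. M i (p i))"
    using I by (subst prod.remove[of _ k]) auto
  thus "of_int (sign p) * (\<Prod>i\<in>I. (M(k := r)) i (p i)) =
      r (p k) * (of_int (sign p) * (\<Prod>i\<in>I - {k}. M i (p i)))" by simp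
qed

lemma det_on_row_linear:
  assumes I: "finite I" "k \<in> I" and r: "\<And>j. j \<in> I \<Longrightarrow> r j = (\<Sum>l\<in>J. c l * R l j)"
  shows "det_on I (M(k := r)) = (\<Sum>l\<in>J. c l * det_on I (M(k := R l)))"
proof -
  have "det_on I (M(k := r)) =
      (\<Sum>p | p permutes I. (\<Sum>l\<in>J. c l * R l (p k)) * (of_int (sign p) * (\<Prod>i\<in>I - {k}. M i (p i))))"
    unfolding det_on_row_expand[OF I] using I r by (intro sum.cong) (auto simp: permutes_in_image)
  also have "\<dots> = (\<Sum>l\<in>J. c l * det_on I (M(k := R l)))"
    unfolding det_on_row_expand[OF I] sum_distrib_right sum_distrib_left
    by (subst sum.swap) (simp add: mult.assoc)
  finally show ?thesis .
qed

text \<open>Composing with the transposition of \<open>k\<close> and \<open>l\<close> permutes the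
  terms of the sum, flips each sign and leaves each product unchanged, so the determinant equals its
  own negative.\<close>

lemma det_on_identical_rows:
  assumes I: "finite I" "k \<in> I" "l \<in> I" "k \<noteq> l" and eq: "\<And>j. j \<in> I \<Longrightarrow> M k j = M l j"
  shows "det_on I M = 0"
proof -
  define t where "t = Transposition.transpose k l"
  have t: "t permutes I" unfolding t_def using I by (intro permutes_swap_id)
  have "det_on I M = (\<Sum>p | p permutes I. of_int (sign (p \<circ> t)) * (\<Prod>i\<in>I. M i ((p \<circ> t) i)))"
    unfolding det_on_def using sum_permutations_compose_right[OF t] by blast
  also have "\<dots> = (\<Sum>p | p permutes I. - (of_int (sign p) * (\<Prod>i\<in>I. M i (p i))))"
  proof (intro sum.cong refl)
    fix p assume p: "p \<in> {p. p permutes I}"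
    have "sign (p \<circ> t) = sign p * sign t"
      using p t I by (intro sign_compose) (auto simp: permutation_permutes)
    also have "sign t = -1" unfolding t_def using I by (simp add: sign_swap_id)
    finally have s: "sign (p \<circ> t) = - sign p" by (simp add: comp_def)
    have "(\<Prod>i\<in>I. M i ((p \<circ> t) i)) = (\<Prod>i\<in>I. M (t i) (p (t i)))"
    proof (intro prod.cong refl)
      fix i assume i: "i \<in> I"
      hence "p (t i) \<in> I" using p t by (simp add: permutes_in_image)
      thus "M i ((p \<circ> t) i) = M (t i) (p (t i))"
        using eq by (cases "i = k \<or> i = l") (auto simp: t_def transpose_def)
    qed
    also have "\<dots> = (\<Prod>i\<in>I. M i (p i))"
      using prod.permute[OF t, of "\<lambda>i. M i (p i)"] by (simp add: comp_def)
    finally show "of_int (sign (p \<circ> t)) * (\<Prod>i\<in>I. M i ((p \<circ> t) i)) = - (of_int (sign p) * (\<Prod>i\<in>I. M i (p i)))"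
      using s by simp
  qed
  also have "\<dots> = - det_on I M" by (simp add: sum_negf det_on_def)
  finally show ?thesis by simp
qed

lemma det_on_replace_row:
  assumes I: "finite I" "k \<in> I" "l \<in> I"
  shows "det_on I (M(k := M l)) = (if k = l then det_on I M else 0)"
proof (cases "k = l")
  case False
  thus ?thesis using det_on_identical_rows[OF I False, of "M(k := M l)"] by simp
qed simp

lemma det_on_row_combination:
  assumes I: "finite I" "k \<in> I" and r: "\<And>j. j \<in> I \<Longrightarrow> r j = (\<Sum>l\<in>I. c l * M l j)"
  shows "det_on I (M(k := r)) = c k * det_on I M"
proof -
  have "det_on I (M(k := r)) = (\<Sum>l\<in>I. c l * det_on I (M(k := M l)))"
    by (rule det_on_row_linear[OF I r])
  also have "\<dots> = (\<Sum>l\<in>I. if l = k then c k * det_on I M else 0)"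
    using I by (intro sum.cong refl) (auto simp: det_on_replace_row)
  also have "\<dots> = c k * det_on I M" using I by simp
  finally show ?thesis .
qed

text \<open>Only the permutations that fix \<open>k\<close> survive, and these are exactly the
  permutations of \<open>I\<close>. This is the cofactor expansion along a unit row, and it links
  the determinants of nested index sets.\<close>

lemma det_on_unit_row:
  assumes "finite I" "k \<notin> I"
  shows "det_on (insert k I) (M(k := (\<lambda>j. if j = k then 1 else 0))) = det_on I M"
proof -
  have "det_on (insert k I) (M(k := (\<lambda>j. if j = k then 1 else 0))) =
      (\<Sum>p | p permutes insert k I. if p k = k then of_int (sign p) * (\<Prod>i\<in>I. M i (p i)) else 0)"
    using assms by (subst det_on_row_expand) (auto intro!: sum.cong)
  also have "\<dots> = (\<Sum>p | p permutes I. of_int (sign p) * (\<Prod>i\<in>I. M i (p i)))"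
  proof (rule sum.mono_neutral_cong_right)
    show "finite {p. p permutes insert k I}" using assms by (simp add: finite_permutations)
    show "{p. p permutes I} \<subseteq> {p. p permutes insert k I}" by (auto intro: permutes_subset)
    show "\<forall>p\<in>{p. p permutes insert k I} - {p. p permutes I}.
        (if p k = k then of_int (sign p) * (\<Prod>i\<in>I. M i (p i)) else 0) = (0::real)"
      using permutes_superset[of _ "insert k I" I] by (auto split: if_splits)
    show "\<And>p. p \<in> {p. p permutes I} \<Longrightarrow>
        (if p k = k then of_int (sign p) * (\<Prod>i\<in>I. M i (p i)) else 0) = (of_int (sign p) * (\<Prod>i\<in>I. M i (p i)) :: real)"
      using assms by (auto simp: permutes_not_in)
  qed
  finally show ?thesis by (simp add: det_on_def)
qed

section \<open>Positive definiteness, inverses of principal submatrices and Schur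
  complements\<close>

text \<open>The determinant is carried along so that Cramer's rule and the normalising constant of
  the density are available on every index set to which the matrix is restricted.\<close>

definition posdef_on :: "nat set \<Rightarrow> (nat \<Rightarrow> nat \<Rightarrow> real) \<Rightarrow> bool" where
  "posdef_on I M \<longleftrightarrow> finite I \<and> (\<forall>i\<in>I. \<forall>j\<in>I. M i j = M j i) \<and>
     (\<forall>v. (\<exists>i\<in>I. v i \<noteq> 0) \<longrightarrow> quad_form I M v v > 0) \<and> det_on I M > 0"

lemma posdef_onD:
  assumes "posdef_on I M"
  shows "finite I" "\<And>i j. i \<in> I \<Longrightarrow> j \<in> I \<Longrightarrow> M i j = M j i" "det_on I M > 0"
    and "\<And>v i. i \<in> I \<Longrightarrow> v i \<noteq> 0 \<Longrightarrow> quad_form I M v v > 0"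
    and "\<And>v. quad_form I M v v \<ge> 0"
proof -
  show "quad_form I M v v \<ge> 0" for v
  proof (cases "\<exists>i\<in>I. v i \<noteq> 0")
    case False
    thus ?thesis by (simp add: quad_form_def)
  next
    case True
    thus ?thesis using assms by (force simp: posdef_on_def)
  qed
qed (use assms in \<open>unfold posdef_on_def, blast+\<close>)

text \<open>Evaluate the product of \<open>A\<close>, \<open>M\<close> and \<open>A'\<close> in both
  orders. Since \<open>inv_on\<close> is a choice among all functions that invert \<open>M\<close>
  on \<open>I\<close>, every identification of its entries goes through this lemma.\<close>

lemma is_inv_on_unique:
  assumes "finite I" "is_inv_on I M A" "is_inv_on I M A'" "i \<in> I" "j \<in> I"
  shows "A i j = A' i j"
proof -
  have "(\<Sum>k\<in>I. A i k * (\<Sum>l\<in>I. M k l * A' l j)) = (\<Sum>k\<in>I. if k = j then A i j else 0)"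
    using assms unfolding is_inv_on_def by (intro sum.cong refl) auto
  hence "A i j = (\<Sum>k\<in>I. A i k * (\<Sum>l\<in>I. M k l * A' l j))"
    using assms by simp
  also have "\<dots> = (\<Sum>l\<in>I. (\<Sum>k\<in>I. A i k * M k l) * A' l j)"
    unfolding sum_distrib_left sum_distrib_right by (subst sum.swap) (simp add: mult.assoc)
  also have "\<dots> = (\<Sum>l\<in>I. if l = i then A' i j else 0)"
    using assms unfolding is_inv_on_def by (intro sum.cong refl) auto
  also have "\<dots> = A' i j" using assms by simp
  finally show ?thesis .
qed

lemma is_inv_on_transpose:
  assumes "is_inv_on I M A" "\<And>i j. i \<in> I \<Longrightarrow> j \<in> I \<Longrightarrow> M i j = M j i"
  shows "is_inv_on I M (\<lambda>i j. A j i)"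
  unfolding is_inv_on_def
proof (intro conjI ballI)
  fix i k assume ik: "i \<in> I" "k \<in> I"
  have "(\<Sum>j\<in>I. M i j * A k j) = (\<Sum>j\<in>I. A k j * M j i)"
    using assms(2) ik by (intro sum.cong) auto
  thus "(\<Sum>j\<in>I. M i j * A k j) = (if i = k then 1 else 0)" using assms(1) ik by (auto simp: is_inv_on_def)
  have "(\<Sum>j\<in>I. A j i * M j k) = (\<Sum>j\<in>I. M k j * A j i)"
    using assms(2) ik by (intro sum.cong) auto
  thus "(\<Sum>j\<in>I. A j i * M j k) = (if i = k then 1 else 0)" using assms(1) ik by (auto simp: is_inv_on_def)
qed

text \<open>Cramer's rule: the inverse is read off the determinants with one row replaced by a unit row.\<close>

lemma is_inv_on_inv_on:
  assumes I: "finite I" and sym: "\<And>i j. i \<in> I \<Longrightarrow> j \<in> I \<Longrightarrow> M i j = M j i" and D: "det_on I M \<noteq> 0"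
  shows "is_inv_on I M (inv_on I M)"
proof -
  define A where "A i k = det_on I (M(k := (\<lambda>j. if j = i then 1 else 0))) / det_on I M" for i k
  have R: "(\<Sum>j\<in>I. M i j * A j k) = (if i = k then 1 else 0)" if "i \<in> I" "k \<in> I" for i k
  proof -
    have "det_on I (M(k := M i)) = (\<Sum>j\<in>I. M i j * det_on I (M(k := (\<lambda>l. if l = j then 1 else 0))))"
      using I that by (intro det_on_row_linear) (simp_all add: if_distrib cong: if_cong)
    thus ?thesis using det_on_replace_row[OF I that(2,1), of M] D
      by (auto simp: A_def sum_divide_distrib[symmetric])
  qed
  have L: "(\<Sum>j\<in>I. A j i * M j k) = (if i = k then 1 else 0)" if "i \<in> I" "k \<in> I" for i k
  proof -
    have "(\<Sum>j\<in>I. A j i * M j k) = (\<Sum>j\<in>I. M k j * A j i)" using sym that by (intro sum.cong) auto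
    thus ?thesis using R[of k i] that by auto
  qed
  \<comment> \<open>Write \<open>A^T\<close> for the transpose. \<open>L\<close> says that
    \<open>A^T M\<close> is the identity and \<open>R\<close> that \<open>M A\<close> is; evaluating
    \<open>A^T M A\<close> both ways gives \<open>A = A^T\<close>, which turns \<open>L\<close> into
    the left inverse property.\<close>
  have S: "A i k = A k i" if "i \<in> I" "k \<in> I" for i k
  proof -
    have "(\<Sum>l\<in>I. (\<Sum>j\<in>I. A j i * M j l) * A l k) = (\<Sum>l\<in>I. if l = i then A i k else 0)"
      using L[OF that(1)] by (intro sum.cong refl) auto
    hence "A i k = (\<Sum>l\<in>I. (\<Sum>j\<in>I. A j i * M j l) * A l k)"
      using I that by simp
    also have "\<dots> = (\<Sum>j\<in>I. A j i * (\<Sum>l\<in>I. M j l * A l k))"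
      unfolding sum_distrib_left sum_distrib_right by (subst sum.swap) (simp add: mult.assoc)
    also have "\<dots> = (\<Sum>j\<in>I. if j = k then A k i else 0)"
      using R[OF _ that(2)] by (intro sum.cong refl) auto
    also have "\<dots> = A k i" using I that by simp
    finally show ?thesis .
  qed
  have "(\<Sum>j\<in>I. A i j * M j k) = (if i = k then 1 else 0)" if "i \<in> I" "k \<in> I" for i k
  proof -
    have "(\<Sum>j\<in>I. A i j * M j k) = (\<Sum>j\<in>I. A j i * M j k)" using S that by (intro sum.cong) auto
    thus ?thesis using L that by simp
  qed
  with R have "is_inv_on I M A" unfolding is_inv_on_def by blast
  thus ?thesis unfolding inv_on_def by (rule someI[of "is_inv_on I M"])
qed

lemma posdef_on_inv:
  assumes "posdef_on I M"
  shows "is_inv_on I M (inv_on I M)"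
    and "\<And>i j. i \<in> I \<Longrightarrow> j \<in> I \<Longrightarrow> inv_on I M i j = inv_on I M j i"
    and "\<And>i k. i \<in> I \<Longrightarrow> k \<in> I \<Longrightarrow> (\<Sum>j\<in>I. M i j * inv_on I M j k) = (if i = k then 1 else 0)"
    and "\<And>i k. i \<in> I \<Longrightarrow> k \<in> I \<Longrightarrow> (\<Sum>j\<in>I. inv_on I M i j * M j k) = (if i = k then 1 else 0)"
proof -
  note d = posdef_onD[OF assms]
  show inv: "is_inv_on I M (inv_on I M)" using d by (intro is_inv_on_inv_on) auto
  show "inv_on I M i j = inv_on I M j i" if "i \<in> I" "j \<in> I" for i j
    using is_inv_on_unique[OF d(1) inv is_inv_on_transpose[OF inv d(2)]] that by simp
  show "\<And>i k. i \<in> I \<Longrightarrow> k \<in> I \<Longrightarrow> (\<Sum>j\<in>I. M i j * inv_on I M j k) = (if i = k then 1 else 0)"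
    "\<And>i k. i \<in> I \<Longrightarrow> k \<in> I \<Longrightarrow> (\<Sum>j\<in>I. inv_on I M i j * M j k) = (if i = k then 1 else 0)"
    using inv by (auto simp: is_inv_on_def)
qed

lemma mat_vec_on_cancel:
  assumes I: "finite I" "i \<in> I"
    and AB: "\<And>k. k \<in> I \<Longrightarrow> (\<Sum>j\<in>I. A i j * B j k) = (if i = k then 1 else 0)"
  shows "mat_vec_on I A (mat_vec_on I B v) i = v i"
proof -
  have "mat_vec_on I A (mat_vec_on I B v) i = (\<Sum>k\<in>I. (\<Sum>j\<in>I. A i j * B j k) * v k)"
    unfolding mat_vec_on_def sum_distrib_left sum_distrib_right by (subst sum.swap) (simp add: mult.assoc)
  also have "\<dots> = (\<Sum>k\<in>I. if k = i then v i else 0)" using AB by (intro sum.cong refl) auto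
  also have "\<dots> = v i" using I by simp
  finally show ?thesis .
qed

text \<open>Substituting \<open>v = M u\<close> with \<open>u\<close> the image of \<open>v\<close>
  under the inverse. It transfers nonnegativity and positivity from \<open>M\<close> to its
  inverse.\<close>

lemma quad_form_inv_on:
  assumes "posdef_on I M"
  shows "quad_form I (inv_on I M) v v = quad_form I M (mat_vec_on I (inv_on I M) v) (mat_vec_on I (inv_on I M) v)"
proof -
  note d = posdef_onD[OF assms] note i = posdef_on_inv[OF assms]
  show ?thesis
    unfolding quad_form_mat_vec[of I "inv_on I M"] quad_form_mat_vec[of I M]
    using d(1) i(3) by (intro sum.cong refl) (simp add: mat_vec_on_cancel mult.commute)
qed

lemma quad_form_inv_on_nonneg: "posdef_on I M \<Longrightarrow> quad_form I (inv_on I M) v v \<ge> 0"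
  by (metis quad_form_inv_on posdef_onD(5))

lemma quad_form_inv_on_pos:
  assumes "posdef_on I M" "i \<in> I" "v i \<noteq> 0"
  shows "quad_form I (inv_on I M) v v > 0"
proof -
  note d = posdef_onD[OF assms(1)] note inv = posdef_on_inv[OF assms(1)]
  have "\<exists>j\<in>I. mat_vec_on I (inv_on I M) v j \<noteq> 0"
  proof (rule ccontr)
    assume "\<not> ?thesis"
    hence "mat_vec_on I M (mat_vec_on I (inv_on I M) v) i = 0" by (simp add: mat_vec_on_def[of I M])
    thus False using mat_vec_on_cancel[OF d(1) assms(2), of M "inv_on I M" v] inv(3) assms by simp
  qed
  thus ?thesis unfolding quad_form_inv_on[OF assms(1)] using d(4) by blast
qed

lemma quad_form_unit:
  assumes "finite I" "i \<in> I"
  shows "quad_form I M (\<lambda>j. if j = i then 1 else 0) (\<lambda>j. if j = i then 1 else 0) = M i i"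
proof -
  have "quad_form I M (\<lambda>j. if j = i then 1 else 0) (\<lambda>j. if j = i then 1 else 0) =
      (\<Sum>k\<in>I. if k = i then (\<Sum>j\<in>I. if j = i then M i i else 0) else 0)"
    unfolding quad_form_def by (intro sum.cong refl) (auto intro!: sum.cong)
  thus ?thesis using assms by simp
qed

lemma inv_on_diag_pos: "posdef_on I M \<Longrightarrow> i \<in> I \<Longrightarrow> inv_on I M i i > 0"
  using quad_form_inv_on_pos[of I M i "\<lambda>j. if j = i then 1 else 0"] quad_form_unit[of I i "inv_on I M"]
  by (simp add: posdef_onD(1))

text \<open>Row \<open>i\<close> of the inverse combines the rows of \<open>M\<close> into the unit
  row at \<open>i\<close>. Replacing row \<open>i\<close> of \<open>M\<close> by that combination
  multiplies the determinant by the diagonal entry of the inverse, and by the unit row lemma the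
  result is the determinant on \<open>I\<close>.\<close>

lemma det_on_insert:
  assumes "posdef_on (insert i I) M" "i \<notin> I"
  shows "det_on I M = inv_on (insert i I) M i i * det_on (insert i I) M"
proof -
  note d = posdef_onD[OF assms(1)] note inv = posdef_on_inv[OF assms(1)]
  have "det_on (insert i I) (M(i := (\<lambda>j. if j = i then 1 else 0))) = inv_on (insert i I) M i i * det_on (insert i I) M"
    using inv(4)[of i] by (intro det_on_row_combination d(1)) auto
  thus ?thesis using det_on_unit_row[of I i M] d(1) assms(2) by simp
qed

text \<open>Vectors on \<open>I\<close> extend by zero at \<open>i\<close> without changing the
  form, and the determinant stays positive because the diagonal entry of the inverse in
  \<open>det_on_insert\<close> is positive.\<close>

lemma posdef_on_remove:
  assumes "posdef_on (insert i I) M" "i \<notin> I"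
  shows "posdef_on I M"
  unfolding posdef_on_def
proof (intro conjI allI impI)
  note d = posdef_onD[OF assms(1)]
  show "finite I" using d(1) by simp
  show "\<forall>i\<in>I. \<forall>j\<in>I. M i j = M j i" using d(2) by auto
  show "det_on I M > 0" using det_on_insert[OF assms] d(3) inv_on_diag_pos[OF assms(1)] by simp
  fix v :: "nat \<Rightarrow> real" assume "\<exists>j\<in>I. v j \<noteq> 0"
  then obtain j where j: "j \<in> I" "v j \<noteq> 0" by blast
  define w where "w = v(i := 0)"
  have "quad_form (insert i I) M w w > 0" using j assms(2) by (intro d(4)[of j]) (auto simp: w_def)
  also have "quad_form (insert i I) M w w = quad_form I M w w"
    unfolding quad_form_def using d(1) assms(2) by (simp add: w_def)
  also have "\<dots> = quad_form I M v v"
    unfolding quad_form_def using assms(2) by (intro sum.cong refl) (auto simp: w_def)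
  finally show "quad_form I M v v > 0" .
qed

lemma posdef_on_subset:
  assumes "posdef_on J M" "I \<subseteq> J"
  shows "posdef_on I M"
proof -
  have "finite (J - I)" using posdef_onD(1)[OF assms(1)] by simp
  thus ?thesis using assms
  proof (induction "J - I" arbitrary: J rule: finite_induct)
    case empty
    thus ?case by (metis Diff_eq_empty_iff subset_antisym)
  next
    case (insert x F)
    have x: "x \<in> J" "x \<notin> I" using insert.hyps(4) by blast+
    have J: "insert x (J - {x}) = J" using x by auto
    have "posdef_on (insert x (J - {x})) M" unfolding J by (rule insert.prems(1))
    hence "posdef_on (J - {x}) M" by (rule posdef_on_remove) simp
    moreover have "F = (J - {x}) - I" using insert.hyps(2,4) by auto
    moreover have "I \<subseteq> J - {x}" using insert.prems(2) x by auto
    ultimately show ?case using insert.hyps(3) by blast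
  qed
qed

text \<open>The inverse of a principal submatrix is the Schur complement of \<open>Q i i\<close> in
  the full inverse. In Gaussian terms, this is the precision matrix of the marginal obtained by
  dropping coordinate \<open>i\<close>.\<close>

lemma inv_on_schur:
  assumes "posdef_on (insert i I) M" "i \<notin> I" "j \<in> I" "k \<in> I"
  defines "Q \<equiv> inv_on (insert i I) M"
  shows "inv_on I M j k = Q j k - Q j i * Q i k / Q i i"
proof -
  note d = posdef_onD[OF assms(1)] note inv = posdef_on_inv[OF assms(1), folded Q_def]
  have I: "finite I" using d(1) by simp
  have q: "Q i i > 0" unfolding Q_def using inv_on_diag_pos[OF assms(1)] by simp
  define R where "R j k = Q j k - Q j i * Q i k / Q i i" for j k
  have 1: "(\<Sum>j\<in>I. M a j * R j b) = (if a = b then 1 else 0)" if "a \<in> I" "b \<in> I" for a b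
  proof -
    have e1: "(\<Sum>j\<in>I. M a j * Q j b) = (if a = b then 1 else 0) - M a i * Q i b"
      using inv(3)[of a b] that I assms(2) by simp
    have e2: "(\<Sum>j\<in>I. M a j * Q j i) = - M a i * Q i i"
      using inv(3)[of a i] that I assms(2) by (auto simp: eq_neg_iff_add_eq_0 split: if_splits)
    have "(\<Sum>j\<in>I. M a j * R j b) = (\<Sum>j\<in>I. M a j * Q j b) - (\<Sum>j\<in>I. M a j * Q j i) * (Q i b / Q i i)"
      unfolding R_def sum_distrib_right by (simp add: algebra_simps sum_subtractf)
    thus ?thesis unfolding e1 e2 using q by simp
  qed
  have 2: "(\<Sum>j\<in>I. R a j * M j b) = (if a = b then 1 else 0)" if "a \<in> I" "b \<in> I" for a b
  proof -
    have "R a j * M j b = M b j * R j a" if "j \<in> I" for j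
      using d(2)[of j b] inv(2)[of a j] inv(2)[of a i] inv(2)[of i j] that \<open>a \<in> I\<close> \<open>b \<in> I\<close> by (simp add: R_def mult.commute)
    hence "(\<Sum>j\<in>I. R a j * M j b) = (\<Sum>j\<in>I. M b j * R j a)" by (intro sum.cong) auto
    thus ?thesis using 1[of b a] that by auto
  qed
  have "is_inv_on I M R" using 1 2 unfolding is_inv_on_def by blast
  from is_inv_on_unique[OF I posdef_on_inv(1)[OF posdef_on_remove[OF assms(1,2)]] this assms(3,4)]
  show ?thesis by (simp add: R_def)
qed

text \<open>Completing the square in the coordinate \<open>i\<close>: the remainder is the Schur
  complement, hence the form of the inverse on \<open>I\<close>. The two summands become the
  conditional and the marginal exponent of the Gaussian density.\<close>

lemma quad_form_inv_on_insert:
  assumes "posdef_on (insert i I) M" "i \<notin> I"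
  defines "Q \<equiv> inv_on (insert i I) M"
  shows "quad_form (insert i I) Q v v =
    Q i i * (v i + (\<Sum>j\<in>I. Q i j * v j) / Q i i)\<^sup>2 + quad_form I (inv_on I M) v v"
proof -
  note d = posdef_onD[OF assms(1)] note inv = posdef_on_inv[OF assms(1), folded Q_def]
  have I: "finite I" using d(1) by simp
  have q: "Q i i > 0" unfolding Q_def using inv_on_diag_pos[OF assms(1)] by simp
  define s where "s = (\<Sum>j\<in>I. Q i j * v j)"
  have s': "(\<Sum>j\<in>I. v j * Q j i) = s" unfolding s_def using inv(2)[of _ i] by (intro sum.cong) auto
  have "quad_form (insert i I) Q v v =
     v i * Q i i * v i + v i * s + (s * v i + quad_form I Q v v)"
  proof -
    have "quad_form (insert i I) Q v v =
      v i * Q i i * v i + (\<Sum>j\<in>I. v i * Q i j * v j) + ((\<Sum>j\<in>I. v j * Q j i * v i) + quad_form I Q v v)"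
      unfolding quad_form_def using I assms(2) by (simp add: sum.distrib)
    moreover have "(\<Sum>j\<in>I. v i * Q i j * v j) = v i * s" by (simp add: s_def sum_distrib_left mult.assoc)
    moreover have "(\<Sum>j\<in>I. v j * Q j i * v i) = s * v i" unfolding s'[symmetric] by (simp add: sum_distrib_right)
    ultimately show ?thesis by simp
  qed
  moreover have "quad_form I (inv_on I M) v v = quad_form I Q v v - s * s / Q i i"
  proof -
    have "quad_form I (inv_on I M) v v = (\<Sum>j\<in>I. \<Sum>k\<in>I. v j * Q j k * v k - v j * Q j i * (Q i k * v k) / Q i i)"
      unfolding quad_form_def
    proof (intro sum.cong refl)
      fix j k assume "j \<in> I" "k \<in> I"
      thus "v j * inv_on I M j k * v k = v j * Q j k * v k - v j * Q j i * (Q i k * v k) / Q i i"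
        unfolding inv_on_schur[OF assms(1,2) \<open>j \<in> I\<close> \<open>k \<in> I\<close>, folded Q_def] by (simp add: algebra_simps)
    qed
    also have "\<dots> = quad_form I Q v v - (\<Sum>j\<in>I. v j * Q j i) * (\<Sum>k\<in>I. Q i k * v k) / Q i i"
      unfolding sum_product sum_divide_distrib by (simp add: sum_subtractf quad_form_def)
    finally show ?thesis unfolding s' by (simp add: s_def)
  qed
  moreover have "Q i i * (v i + s / Q i i)\<^sup>2 = v i * Q i i * v i + 2 * (v i * s) + s * s / Q i i"
    using q by (simp add: power2_eq_square field_simps)
  ultimately show ?thesis unfolding s_def[symmetric] by (simp add: mult.commute)
qed

lemma quad_form_line:
  assumes "finite I" "\<And>i j. i \<in> I \<Longrightarrow> j \<in> I \<Longrightarrow> M i j = M j i"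
  shows "quad_form I M (\<lambda>i. v i + t * w i) (\<lambda>i. v i + t * w i) =
    quad_form I M v v + 2 * t * quad_form I M w v + t\<^sup>2 * quad_form I M w w"
proof -
  have "quad_form I M v w = quad_form I M w v"
    unfolding quad_form_def using assms(2) by (subst sum.swap) (auto intro!: sum.cong)
  moreover have "quad_form I M (\<lambda>i. v i + t * w i) (\<lambda>i. v i + t * w i) =
    quad_form I M v v + t * quad_form I M v w + t * quad_form I M w v + t\<^sup>2 * quad_form I M w w"
    unfolding quad_form_def sum_distrib_left sum.distrib[symmetric]
    by (intro sum.cong refl) (simp add: algebra_simps power2_eq_square)
  ultimately show ?thesis by simp
qed

text \<open>If a semidefinite form vanishes at \<open>v\<close>, its nonnegativity along all lines
  through \<open>v\<close> forces the image of \<open>v\<close> to be zero. Then the rows of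
  \<open>M\<close> are linearly dependent with coefficients \<open>v\<close>, against the positive
  determinant.\<close>

lemma posdef_on_of_psd:
  assumes I: "finite I" and sym: "\<And>i j. i \<in> I \<Longrightarrow> j \<in> I \<Longrightarrow> M i j = M j i"
    and psd: "\<And>v. quad_form I M v v \<ge> 0" and D: "det_on I M > 0"
  shows "posdef_on I M"
  unfolding posdef_on_def
proof (intro conjI allI impI)
  fix v :: "nat \<Rightarrow> real" assume "\<exists>i\<in>I. v i \<noteq> 0"
  then obtain i where i: "i \<in> I" "v i \<noteq> 0" by blast
  have "quad_form I M v v \<noteq> 0"
  proof
    assume 0: "quad_form I M v v = 0"
    have orth: "quad_form I M w v = 0" for w
    proof -
      define a b where "a = quad_form I M w v" and "b = quad_form I M w w"
      have ge: "0 \<le> 2 * t * a + t\<^sup>2 * b" for t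
        using psd[of "\<lambda>i. v i + t * w i"] quad_form_line[where I = I and M = M and v = v and t = t and w = w] I sym 0
        by (simp add: a_def b_def)
      have b: "b \<ge> 0" using psd by (simp add: b_def)
      \<comment> \<open>The parabola would be minimal at \<open>t = - a / b\<close>; using
        \<open>b + 1\<close> also covers \<open>b = 0\<close> and still yields a negative value
        unless \<open>a = 0\<close>.\<close>
      have "0 \<le> 2 * (- a / (b + 1)) * a + (- a / (b + 1))\<^sup>2 * b" by (rule ge)
      also have "\<dots> = - (a\<^sup>2 * (b + 2)) / (b + 1)\<^sup>2"
        using b by (simp add: power2_eq_square divide_simps add_eq_0_iff) (auto simp: algebra_simps)
      finally have "a\<^sup>2 * (b + 2) \<le> 0" using b by (simp add: divide_le_0_iff)
      moreover have "a\<^sup>2 * (b + 2) \<ge> 0" using b by simp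
      ultimately have "a\<^sup>2 * (b + 2) = 0" by linarith
      hence "a = 0" using b by simp
      thus ?thesis by (simp add: a_def)
    qed
    have "mat_vec_on I M v j = 0" if "j \<in> I" for j
      using orth[of "\<lambda>i. if i = j then 1 else 0"] I that
      by (simp add: quad_form_mat_vec if_distrib[of "\<lambda>x. x * _"] cong: if_cong)
    hence z: "(\<Sum>l\<in>I. v l * M l j) = 0" if "j \<in> I" for j
      using \<open>\<And>j. j \<in> I \<Longrightarrow> mat_vec_on I M v j = 0\<close>[OF that] sym[OF _ that]
      by (simp add: mat_vec_on_def mult.commute cong: sum.cong)
    have "det_on I (M(i := (\<lambda>_. 0))) = v i * det_on I M"
      using z by (intro det_on_row_combination I i) simp
    moreover have "det_on I (M(i := (\<lambda>_. 0))) = 0" by (subst det_on_row_expand[OF I i(1)]) simp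
    ultimately show False using i D by simp
  qed
  thus "quad_form I M v v > 0" using psd[of v] by linarith
qed (use I sym D in \<open>blast+\<close>)

section \<open>Gaussian densities\<close>

lemma borel_measurable_PiM_component:
  "i \<in> J \<Longrightarrow> (\<lambda>y. y i) \<in> borel_measurable (PiM J (\<lambda>_. lborel :: real measure))"
  using measurable_component_singleton[of i J "\<lambda>_. lborel :: real measure"] by simp

lemma borel_measurable_sum_PiM:
  assumes "\<And>i. i \<in> I \<Longrightarrow> f i \<in> borel_measurable borel" "I \<subseteq> J"
  shows "(\<lambda>y. \<Sum>i\<in>I. f i (y i) :: real) \<in> borel_measurable (PiM J (\<lambda>_. lborel :: real measure))"
  using assms by (intro borel_measurable_sum measurable_compose[OF borel_measurable_PiM_component]) auto

lemma borel_measurable_quad_form_PiM: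
  assumes "I \<subseteq> J"
  shows "(\<lambda>y. quad_form I Q (\<lambda>i. y i - m i) (\<lambda>i. y i - m i)) \<in> borel_measurable (PiM J (\<lambda>_. lborel :: real measure))"
  unfolding quad_form_def
  using assms by (intro borel_measurable_sum borel_measurable_times borel_measurable_diff borel_measurable_PiM_component) auto

lemma exp_sum_set_measurable:
  assumes "I \<subseteq> J"
  shows "{y \<in> space (PiM J (\<lambda>_. lborel :: real measure)). (\<Sum>i\<in>I. exp (y i)) \<le> t} \<in> sets (PiM J (\<lambda>_. lborel))"
proof -
  have [measurable]: "(\<lambda>y. \<Sum>i\<in>I. exp (y i)) \<in> borel_measurable (PiM J (\<lambda>_. lborel :: real measure))"
    using assms by (intro borel_measurable_sum_PiM) auto
  show ?thesis by measurable
qed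

text \<open>The density on an arbitrary index set, so that marginals are instances of the same
  formula.\<close>

definition gauss_dens :: "nat set \<Rightarrow> (nat \<Rightarrow> real) \<Rightarrow> (nat \<Rightarrow> nat \<Rightarrow> real) \<Rightarrow> (nat \<Rightarrow> real) \<Rightarrow> real" where
  "gauss_dens I \<mu> B y =
     exp (- quad_form I (inv_on I B) (\<lambda>i. y i - \<mu> i) (\<lambda>i. y i - \<mu> i) / 2)
     / sqrt ((2 * pi) ^ card I * det_on I B)"

lemma gaussian_density_eq: "gaussian_density n \<mu> B = gauss_dens {..<n} \<mu> B"
  by (simp add: fun_eq_iff gaussian_density_def gauss_dens_def)

lemma gauss_dens_measurable:
  "I \<subseteq> J \<Longrightarrow> gauss_dens I \<mu> B \<in> borel_measurable (PiM J (\<lambda>_. lborel))"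
  unfolding gauss_dens_def[abs_def]
  by (intro borel_measurable_divide borel_measurable_const borel_measurable_quad_form_PiM
      measurable_compose[OF _ borel_measurable_exp] borel_measurable_uminus) 

lemma gauss_dens_nonneg: "posdef_on I B \<Longrightarrow> gauss_dens I \<mu> B y \<ge> 0"
  using posdef_onD(3)[of I B] by (simp add: gauss_dens_def)

lemma nn_integral_normal_density: "\<sigma> > 0 \<Longrightarrow> (\<integral>\<^sup>+ t. ennreal (normal_density m \<sigma> t) \<partial>lborel) = 1"
  by (subst nn_integral_eq_integral) auto

text \<open>By the completed square the density splits into a normal density in coordinate
  \<open>i\<close>, with the conditional mean \<open>\<mu> i - c\<close> and variance
  \<open>1 / q\<close>, and the density on \<open>I\<close>. The normalising constants fit because
  deleting \<open>i\<close> multiplies the determinant by \<open>q\<close>.\<close>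

lemma gauss_dens_integrate_out:
  assumes "posdef_on (insert i I) B" "i \<notin> I"
  shows "(\<integral>\<^sup>+ t. ennreal (gauss_dens (insert i I) \<mu> B (x(i := t))) \<partial>lborel) = ennreal (gauss_dens I \<mu> B x)"
proof -
  define Q where "Q = inv_on (insert i I) B"
  define q where "q = Q i i"
  define c where "c = (\<Sum>j\<in>I. Q i j * (x j - \<mu> j)) / q"
  define D where "D = det_on (insert i I) B"
  have I: "finite I" using posdef_onD(1)[OF assms(1)] by simp
  have q: "q > 0" using inv_on_diag_pos[OF assms(1)] by (simp add: q_def Q_def)
  have D: "D > 0" using posdef_onD(3)[OF assms(1)] by (simp add: D_def)
  have pd: "posdef_on I B" by (rule posdef_on_remove[OF assms])
  have det: "det_on I B = q * D" using det_on_insert[OF assms] by (simp add: q_def Q_def D_def)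
  have "gauss_dens (insert i I) \<mu> B (x(i := t)) =
      normal_density (\<mu> i - c) (1 / sqrt q) t * gauss_dens I \<mu> B x" for t
  proof -
    have "quad_form (insert i I) Q (\<lambda>j. (x(i := t)) j - \<mu> j) (\<lambda>j. (x(i := t)) j - \<mu> j)
       = q * (t - (\<mu> i - c))\<^sup>2 + quad_form I (inv_on I B) (\<lambda>j. (x(i := t)) j - \<mu> j) (\<lambda>j. (x(i := t)) j - \<mu> j)"
    proof -
      have "(\<Sum>j\<in>I. Q i j * ((x(i := t)) j - \<mu> j)) = (\<Sum>j\<in>I. Q i j * (x j - \<mu> j))"
        using assms(2) by (intro sum.cong) auto
      thus ?thesis
        unfolding Q_def quad_form_inv_on_insert[OF assms] by (simp add: c_def q_def Q_def algebra_simps)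
    qed
    also have "quad_form I (inv_on I B) (\<lambda>j. (x(i := t)) j - \<mu> j) (\<lambda>j. (x(i := t)) j - \<mu> j) =
        quad_form I (inv_on I B) (\<lambda>j. x j - \<mu> j) (\<lambda>j. x j - \<mu> j)"
      unfolding quad_form_def using assms(2) by (intro sum.cong refl) auto
    finally have e: "quad_form (insert i I) Q (\<lambda>j. (x(i := t)) j - \<mu> j) (\<lambda>j. (x(i := t)) j - \<mu> j)
       = q * (t - (\<mu> i - c))\<^sup>2 + quad_form I (inv_on I B) (\<lambda>j. x j - \<mu> j) (\<lambda>j. x j - \<mu> j)" .
    have s: "sqrt ((2 * pi) ^ card (insert i I) * D) = sqrt (2 * pi * (1 / sqrt q)\<^sup>2) * sqrt ((2 * pi) ^ card I * (q * D))"
      using I assms(2) q D by (simp add: real_sqrt_mult[symmetric] power_divide)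
    have "- (q * (t - (\<mu> i - c))\<^sup>2 + z) / 2 = - (t - (\<mu> i - c))\<^sup>2 / (2 * (1 / sqrt q)\<^sup>2) + - z / 2" for z
      using q by (simp add: power_divide field_simps)
    thus ?thesis
      unfolding gauss_dens_def normal_density_def det e[unfolded Q_def] D_def[symmetric] s
      by (simp add: exp_add[symmetric])
  qed
  hence "(\<integral>\<^sup>+ t. ennreal (gauss_dens (insert i I) \<mu> B (x(i := t))) \<partial>lborel) =
      (\<integral>\<^sup>+ t. ennreal (normal_density (\<mu> i - c) (1 / sqrt q) t) * ennreal (gauss_dens I \<mu> B x) \<partial>lborel)"
    using gauss_dens_nonneg[OF pd] by (simp add: ennreal_mult)
  also have "\<dots> = ennreal (gauss_dens I \<mu> B x)"
    using q by (subst nn_integral_multc) (auto simp: nn_integral_normal_density)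
  finally show ?thesis .
qed

text \<open>The coordinates outside \<open>I\<close> are integrated out one at a time. Measurability
  of \<open>f\<close> is required over every \<open>K\<close> containing \<open>I\<close> because
  the induction passes through all intermediate index sets.\<close>

lemma gauss_dens_marginal:
  fixes f :: "(nat \<Rightarrow> real) \<Rightarrow> ennreal"
  assumes "posdef_on J B" "I \<subseteq> J"
    and f: "\<And>K. I \<subseteq> K \<Longrightarrow> f \<in> borel_measurable (PiM K (\<lambda>_. lborel))"
    and inv: "\<And>x i t. i \<notin> I \<Longrightarrow> f (x(i := t)) = f x"
  shows "(\<integral>\<^sup>+ y. f y * ennreal (gauss_dens J \<mu> B y) \<partial>PiM J (\<lambda>_. lborel)) =
    (\<integral>\<^sup>+ y. f y * ennreal (gauss_dens I \<mu> B y) \<partial>PiM I (\<lambda>_. lborel))"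
proof -
  interpret product_sigma_finite "\<lambda>_::nat. lborel :: real measure" ..
  have "finite (J - I)" using posdef_onD(1)[OF assms(1)] by simp
  thus ?thesis using assms(1,2)
  proof (induction "J - I" arbitrary: J rule: finite_induct)
    case empty
    hence "J = I" by blast
    thus ?case by simp
  next
    case (insert i F)
    define K where "K = J - {i}"
    have i: "i \<in> J" "i \<notin> I" using insert.hyps(4) by blast+
    have J: "J = insert i K" "i \<notin> K" using i by (auto simp: K_def)
    have F: "F = K - I" using insert.hyps(2,4) by (auto simp: K_def)
    have IK: "I \<subseteq> K" using insert.prems(2) i by (auto simp: K_def)
    have pd: "posdef_on (insert i K) B" using insert.prems(1) unfolding J(1) .
    have pdK: "posdef_on K B" by (rule posdef_on_remove[OF pd J(2)])
    have K: "finite K" using posdef_onD(1)[OF pdK] .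
    have "(\<integral>\<^sup>+ y. f y * ennreal (gauss_dens J \<mu> B y) \<partial>PiM J (\<lambda>_. lborel)) =
      (\<integral>\<^sup>+ x. (\<integral>\<^sup>+ t. f (x(i := t)) * ennreal (gauss_dens (insert i K) \<mu> B (x(i := t))) \<partial>lborel) \<partial>PiM K (\<lambda>_. lborel))"
      unfolding J(1)
    proof (rule product_nn_integral_insert[OF K J(2)])
      have [measurable]: "f \<in> borel_measurable (PiM (insert i K) (\<lambda>_. lborel))"
        using IK by (intro f) auto
      have [measurable]: "gauss_dens (insert i K) \<mu> B \<in> borel_measurable (PiM (insert i K) (\<lambda>_. lborel))"
        by (rule gauss_dens_measurable) simp
      show "(\<lambda>y. f y * ennreal (gauss_dens (insert i K) \<mu> B y)) \<in> borel_measurable (PiM (insert i K) (\<lambda>_. lborel))"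
        by measurable
    qed
    also have "\<dots> = (\<integral>\<^sup>+ x. f x * ennreal (gauss_dens K \<mu> B x) \<partial>PiM K (\<lambda>_. lborel))"
    proof (rule nn_integral_cong)
      fix x :: "nat \<Rightarrow> real" assume x: "x \<in> space (PiM K (\<lambda>_. lborel :: real measure))"
      have "(\<lambda>t. gauss_dens (insert i K) \<mu> B (x(i := t))) \<in> borel_measurable lborel"
        by (rule measurable_compose[OF measurable_fun_upd gauss_dens_measurable[OF order_refl]])
           (use x in \<open>auto\<close>)
      hence [measurable]: "(\<lambda>t. gauss_dens (insert i K) \<mu> B (x(i := t))) \<in> borel_measurable borel" by simp
      have "(\<integral>\<^sup>+ t. f x * ennreal (gauss_dens (insert i K) \<mu> B (x(i := t))) \<partial>lborel) =
        f x * (\<integral>\<^sup>+ t. ennreal (gauss_dens (insert i K) \<mu> B (x(i := t))) \<partial>lborel)"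
        by (intro nn_integral_cmult) measurable
      thus "(\<integral>\<^sup>+ t. f (x(i := t)) * ennreal (gauss_dens (insert i K) \<mu> B (x(i := t))) \<partial>lborel) =
        f x * ennreal (gauss_dens K \<mu> B x)"
        unfolding inv[OF i(2)] gauss_dens_integrate_out[OF pd J(2)] .
    qed
    also have "\<dots> = (\<integral>\<^sup>+ y. f y * ennreal (gauss_dens I \<mu> B y) \<partial>PiM I (\<lambda>_. lborel))"
      by (rule insert.hyps(3)[OF F pdK IK])
    finally show ?case .
  qed
qed

lemma gauss_dens_total:
  assumes "posdef_on J B"
  shows "(\<integral>\<^sup>+ y. ennreal (gauss_dens J \<mu> B y) \<partial>PiM J (\<lambda>_. lborel)) = 1"
proof -
  interpret product_sigma_finite "\<lambda>_::nat. lborel :: real measure" ..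
  have "det_on {} B = 1" by (simp add: det_on_def)
  hence "gauss_dens {} \<mu> B = (\<lambda>_. 1)" by (simp add: gauss_dens_def fun_eq_iff quad_form_def)
  thus ?thesis
    using gauss_dens_marginal[OF assms, of "{}" "\<lambda>_. 1" \<mu>] nn_integral_empty[of "\<lambda>_. 1"] by simp
qed

text \<open>Exponential tilting: completing the square shows that the weight with parameter
  \<open>t\<close> only moves the mean by the image of \<open>t\<close> under \<open>B\<close>. The
  moment generating function follows, since the tilted density again has total mass one.\<close>

lemma gauss_dens_tilt:
  assumes "posdef_on J B"
  shows "exp (\<Sum>i\<in>J. t i * y i) * gauss_dens J \<mu> B y =
    exp ((\<Sum>i\<in>J. t i * \<mu> i) + quad_form J B t t / 2) * gauss_dens J (\<lambda>i. \<mu> i + mat_vec_on J B t i) B y"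
proof -
  note d = posdef_onD[OF assms] note inv = posdef_on_inv[OF assms]
  define Q where "Q = inv_on J B"
  define v where "v i = y i - \<mu> i" for i
  define b where "b = mat_vec_on J B t"
  have Qb: "mat_vec_on J Q b i = t i" if "i \<in> J" for i
    unfolding b_def Q_def using d(1) that inv(4)[of i] by (intro mat_vec_on_cancel) auto
  have "quad_form J Q (\<lambda>i. v i + (-1) * b i) (\<lambda>i. v i + (-1) * b i) =
      quad_form J Q v v + 2 * (-1) * quad_form J Q b v + (-1)\<^sup>2 * quad_form J Q b b"
    using d(1) inv(2) unfolding Q_def by (intro quad_form_line) auto
  also have "quad_form J Q b v = quad_form J Q v b"
    unfolding quad_form_def Q_def by (subst sum.swap) (auto intro!: sum.cong simp: inv(2))
  also have "\<dots> = (\<Sum>i\<in>J. t i * v i)"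
    unfolding quad_form_mat_vec using Qb by (intro sum.cong) auto
  also have "quad_form J Q b b = quad_form J B t t"
    unfolding quad_form_mat_vec using Qb by (intro sum.cong) (auto simp: b_def)
  finally have e: "quad_form J Q (\<lambda>i. y i - (\<mu> i + b i)) (\<lambda>i. y i - (\<mu> i + b i)) =
     quad_form J Q v v - 2 * (\<Sum>i\<in>J. t i * v i) + quad_form J B t t"
    by (simp add: v_def[abs_def] algebra_simps)
  have "(\<Sum>i\<in>J. t i * v i) = (\<Sum>i\<in>J. t i * y i) - (\<Sum>i\<in>J. t i * \<mu> i)"
    by (simp add: v_def algebra_simps sum_subtractf)
  thus ?thesis
    unfolding gauss_dens_def Q_def[symmetric] b_def[symmetric] e
    by (simp add: v_def[abs_def] exp_add[symmetric] add_divide_distrib diff_divide_distrib)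
qed

lemma gauss_dens_mgf:
  assumes "posdef_on J B"
  shows "(\<integral>\<^sup>+ y. ennreal (exp (\<Sum>i\<in>J. t i * y i)) * ennreal (gauss_dens J \<mu> B y) \<partial>PiM J (\<lambda>_. lborel)) =
    ennreal (exp ((\<Sum>i\<in>J. t i * \<mu> i) + quad_form J B t t / 2))"
proof -
  have [measurable]: "gauss_dens J m B \<in> borel_measurable (PiM J (\<lambda>_. lborel))" for m
    by (rule gauss_dens_measurable) simp
  have "(\<integral>\<^sup>+ y. ennreal (exp (\<Sum>i\<in>J. t i * y i)) * ennreal (gauss_dens J \<mu> B y) \<partial>PiM J (\<lambda>_. lborel)) =
     (\<integral>\<^sup>+ y. ennreal (exp ((\<Sum>i\<in>J. t i * \<mu> i) + quad_form J B t t / 2)) *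
        ennreal (gauss_dens J (\<lambda>i. \<mu> i + mat_vec_on J B t i) B y) \<partial>PiM J (\<lambda>_. lborel))"
    using gauss_dens_tilt[OF assms, of t _ \<mu>] gauss_dens_nonneg[OF assms]
    by (simp add: ennreal_mult[symmetric])
  also have "\<dots> = ennreal (exp ((\<Sum>i\<in>J. t i * \<mu> i) + quad_form J B t t / 2))"
    by (subst nn_integral_cmult) (auto simp: gauss_dens_total[OF assms])
  finally show ?thesis .
qed

section \<open>Dirichlet integrals in logarithmic coordinates\<close>

text \<open>The substitution \<open>v = exp s / t\<close> maps the half line onto the unit interval
  and produces Euler's Beta integral. The case \<open>b = 0\<close> is included because it is the
  first step of the induction over coordinates, where no other coordinate is left.\<close>

lemma nn_integral_exp_Beta:
  assumes a: "a > 0" and b: "b \<ge> 0" and t: "t > 0"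
  shows "(\<integral>\<^sup>+ s. ennreal (exp (a * s) * (t - exp s) powr b) * indicator {..<ln t} s \<partial>lborel) =
    ennreal (t powr (a + b) * Beta a (b + 1))"
proof -
  define f where "f v = t powr (a + b) * (v powr (a - 1) * (1 - v) powr (b + 1 - 1))" for v :: real
  have "((\<lambda>v. v powr (a - 1) * (1 - v) powr (b + 1 - 1)) has_integral Beta a (b + 1)) {0<..<1}"
    using has_integral_Beta_real[of a "b + 1"] a b by (simp add: has_integral_Icc_iff_Ioo)
  hence I: "(f has_integral t powr (a + b) * Beta a (b + 1)) {0<..<1}"
    unfolding f_def by (rule has_integral_mult_right)
  have ai: "f absolutely_integrable_on {0<..<1}"
    using I by (intro nonnegative_absolutely_integrable_1) (auto simp: f_def)
  have img: "(\<lambda>s. exp s / t) ` {..<ln t} = {0<..<1}"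
  proof safe
    fix v :: real assume "v \<in> {0<..<1}"
    hence "ln (v * t) < ln t" "v = exp (ln (v * t)) / t" using t by auto
    thus "v \<in> (\<lambda>s. exp s / t) ` {..<ln t}" by blast
  qed (use t in \<open>auto simp: exp_less_cancel_iff[of _ "ln t", symmetric] simp del: exp_less_cancel_iff\<close>)
  have "(\<lambda>s. \<bar>exp s / t\<bar> * f (exp s / t)) absolutely_integrable_on {..<ln t} \<and>
      integral {..<ln t} (\<lambda>s. \<bar>exp s / t\<bar> * f (exp s / t)) = t powr (a + b) * Beta a (b + 1)"
    using ai I t
    by (subst has_absolute_integral_change_of_variables_1')
       (auto simp: inj_on_def img integral_unique intro!: derivative_eq_intros)
  hence "((\<lambda>s. \<bar>exp s / t\<bar> * f (exp s / t)) has_integral t powr (a + b) * Beta a (b + 1)) {..<ln t}"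
    using set_lebesgue_integral_eq_integral(1) by (metis (no_types) has_integral_integral)
  hence "(\<integral>\<^sup>+ s. ennreal (\<bar>exp s / t\<bar> * f (exp s / t)) * indicator {..<ln t} s \<partial>lborel) =
    ennreal (t powr (a + b) * Beta a (b + 1))"
    by (intro nn_integral_has_integral_lebesgue') (auto simp: f_def)
  also have "(\<integral>\<^sup>+ s. ennreal (\<bar>exp s / t\<bar> * f (exp s / t)) * indicator {..<ln t} s \<partial>lborel) =
    (\<integral>\<^sup>+ s. ennreal (exp (a * s) * (t - exp s) powr b) * indicator {..<ln t} s \<partial>lborel)"
  proof (intro nn_integral_cong)
    fix s :: real
    show "ennreal (\<bar>exp s / t\<bar> * f (exp s / t)) * indicator {..<ln t} s =
      ennreal (exp (a * s) * (t - exp s) powr b) * indicator {..<ln t} s"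
    proof (cases "s < ln t")
      case True
      hence s: "exp s < t" using t by (metis exp_less_cancel_iff exp_ln)
      have "1 - exp s / t = (t - exp s) / t" using t by (simp add: field_simps)
      hence "\<bar>exp s / t\<bar> * f (exp s / t) = exp (a * s) * (t - exp s) powr b"
        using s t by (simp add: f_def powr_divide powr_def[of "exp s"] powr_add powr_diff divide_simps exp_diff)
      thus ?thesis by simp
    qed simp
  qed
  finally show ?thesis .
qed

text \<open>Fixing one coordinate at \<open>s\<close> leaves the budget \<open>t - exp s\<close> for
  the others. The induction hypothesis contributes a power of that budget, and the resulting Beta
  integral supplies the quotient of Gamma values that telescopes with the previous ones.\<close>

lemma nn_integral_exp_simplex:
  fixes I :: "nat set" and a :: "nat \<Rightarrow> real"
  assumes "finite I" "\<And>k. k \<in> I \<Longrightarrow> a k > 0" "t > 0"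
  shows "(\<integral>\<^sup>+ y. indicator {y. (\<Sum>k\<in>I. exp (y k)) \<le> t} y * ennreal (exp (\<Sum>k\<in>I. a k * y k)) \<partial>PiM I (\<lambda>_. lborel)) =
    ennreal (t powr (\<Sum>k\<in>I. a k) * (\<Prod>k\<in>I. Gamma (a k)) / Gamma (1 + (\<Sum>k\<in>I. a k)))"
  using assms
proof (induction I arbitrary: t rule: finite_induct)
  case empty
  interpret product_sigma_finite "\<lambda>_::nat. lborel :: real measure" ..
  show ?case using empty nn_integral_empty[of "\<lambda>_. 1"] by simp
next
  case (insert i I)
  interpret product_sigma_finite "\<lambda>_::nat. lborel :: real measure" ..
  define A where "A = (\<Sum>k\<in>I. a k)"
  define G where "G = (\<Prod>k\<in>I. Gamma (a k))"
  have ai: "a i > 0" and A: "A \<ge> 0" using insert.prems by (auto simp: A_def intro: sum_nonneg less_imp_le)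
  have G: "G \<ge> 0" unfolding G_def using insert.prems by (intro prod_nonneg less_imp_le[OF Gamma_real_pos]) auto
  define h where "h y = indicator {y. (\<Sum>k\<in>insert i I. exp (y k)) \<le> t} y * ennreal (exp (\<Sum>k\<in>insert i I. a k * y k))"
    for y :: "nat \<Rightarrow> real"
  have hm: "h \<in> borel_measurable (PiM (insert i I) (\<lambda>_. lborel))"
  proof -
    have [measurable]: "(\<lambda>y. \<Sum>k\<in>insert i I. a k * y k) \<in> borel_measurable (PiM (insert i I) (\<lambda>_. lborel :: real measure))"
      by (rule borel_measurable_sum_PiM) auto
    have [measurable]: "(\<lambda>y. \<Sum>k\<in>insert i I. exp (y k)) \<in> borel_measurable (PiM (insert i I) (\<lambda>_. lborel :: real measure))"
      by (rule borel_measurable_sum_PiM) auto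
    show ?thesis unfolding h_def by measurable
  qed
  have upd: "(\<Sum>k\<in>insert i I. g k ((x(i := s)) k)) = g i s + (\<Sum>k\<in>I. g k (x k))"
    for g :: "nat \<Rightarrow> real \<Rightarrow> real" and x s
    using insert.hyps by (auto intro!: sum.cong)
  have hupd: "h (x(i := s)) = ennreal (exp (a i * s)) *
     (indicator {y. (\<Sum>k\<in>I. exp (y k)) \<le> t - exp s} x * ennreal (exp (\<Sum>k\<in>I. a k * x k)))" for x s
    unfolding h_def indicator_def using upd[of "\<lambda>k. exp"] upd[of "\<lambda>k y. a k * y"]
    by (simp add: exp_add ennreal_mult algebra_simps)
  have "Gamma (A + 1) \<noteq> 0" using A Gamma_real_pos[of "A + 1"] by linarith
  have "(\<integral>\<^sup>+ y. h y \<partial>PiM (insert i I) (\<lambda>_. lborel)) =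
     (\<integral>\<^sup>+ s. (\<integral>\<^sup>+ x. h (x(i := s)) \<partial>PiM I (\<lambda>_. lborel)) \<partial>lborel)"
    by (rule product_nn_integral_insert_rev[OF insert.hyps(1,2) hm])
  also have "\<dots> = (\<integral>\<^sup>+ s. ennreal (G / Gamma (1 + A)) * (ennreal (exp (a i * s) * (t - exp s) powr A) * indicator {..<ln t} s) \<partial>lborel)"
  proof (rule nn_integral_cong_AE)
    \<comment> \<open>At \<open>s = ln t\<close> the remaining budget is zero, where the induction
      hypothesis does not apply and, for empty \<open>I\<close>, the two sides differ; this single
      point is negligible.\<close>
    have "AE s in lborel. s \<noteq> ln t" by (rule AE_lborel_singleton)
    thus "AE s in lborel. (\<integral>\<^sup>+ x. h (x(i := s)) \<partial>PiM I (\<lambda>_. lborel)) =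
       ennreal (G / Gamma (1 + A)) * (ennreal (exp (a i * s) * (t - exp s) powr A) * indicator {..<ln t} s)"
    proof eventually_elim
      case (elim s)
      show ?case
      proof (cases "s < ln t")
        case True
        hence s: "t - exp s > 0" using insert.prems(2) by (metis diff_gt_0_iff_gt exp_less_cancel_iff exp_ln)
        have [measurable]: "(\<lambda>y. \<Sum>k\<in>I. a k * y k) \<in> borel_measurable (PiM I (\<lambda>_. lborel :: real measure))"
          by (rule borel_measurable_sum_PiM) auto
        have [measurable]: "(\<lambda>y. \<Sum>k\<in>I. exp (y k)) \<in> borel_measurable (PiM I (\<lambda>_. lborel :: real measure))"
          by (rule borel_measurable_sum_PiM) auto
        have "(\<integral>\<^sup>+ x. h (x(i := s)) \<partial>PiM I (\<lambda>_. lborel)) = ennreal (exp (a i * s)) *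
           (\<integral>\<^sup>+ x. indicator {y. (\<Sum>k\<in>I. exp (y k)) \<le> t - exp s} x * ennreal (exp (\<Sum>k\<in>I. a k * x k)) \<partial>PiM I (\<lambda>_. lborel))"
          unfolding hupd by (rule nn_integral_cmult) measurable
        also have "\<dots> = ennreal (exp (a i * s)) * ennreal ((t - exp s) powr A * G / Gamma (1 + A))"
          unfolding A_def G_def using insert.prems s by (subst insert.IH) auto
        also have "\<dots> = ennreal (G / Gamma (1 + A)) * (ennreal (exp (a i * s) * (t - exp s) powr A))"
          using G A by (simp add: ennreal_mult[symmetric] Gamma_real_nonneg mult_ac)
        finally show ?thesis using True by simp
      next
        case False
        hence "t - exp s < 0" using elim insert.prems(2)
          by (metis diff_less_0_iff_less exp_less_cancel_iff exp_ln linorder_neqE_linordered_idom)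
        hence "indicator {y. (\<Sum>k\<in>I. exp (y k)) \<le> t - exp s} x = (0 :: ennreal)" for x :: "nat \<Rightarrow> real"
          using sum_nonneg[of I "\<lambda>k. exp (x k)"] by (auto simp: indicator_def)
        thus ?thesis using False by (simp add: hupd)
      qed
    qed
  qed
  also have "\<dots> = ennreal (G / Gamma (1 + A)) * ennreal (t powr (a i + A) * Beta (a i) (A + 1))"
    by (subst nn_integral_cmult) (auto simp: nn_integral_exp_Beta[OF ai A insert.prems(2)])
  also have "\<dots> = ennreal (G / Gamma (1 + A) * (t powr (a i + A) * Beta (a i) (A + 1)))"
    using G A ai by (subst ennreal_mult[symmetric]) (auto simp: Gamma_real_nonneg Beta_def)
  also have "G / Gamma (1 + A) * (t powr (a i + A) * Beta (a i) (A + 1)) =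
     t powr (\<Sum>k\<in>insert i I. a k) * (\<Prod>k\<in>insert i I. Gamma (a k)) / Gamma (1 + (\<Sum>k\<in>insert i I. a k))"
    using insert.hyps \<open>Gamma (A + 1) \<noteq> 0\<close> by (simp add: Beta_def A_def[symmetric] G_def[symmetric] add_ac mult_ac)
  finally show ?case unfolding h_def .
qed

section \<open>The probability on the support of the minimizer\<close>

text \<open>The right side is four times the square of \<open>exp (u / 2) - exp (- (u / 2))\<close>,
  and for \<open>u \<ge> 0\<close> that difference is at least \<open>u / 2\<close>. It trades
  quadratic errors for exponential moments, which are known exactly.\<close>

lemma square_le_exp_add_exp_minus:
  fixes u :: real shows "u\<^sup>2 \<le> 4 * (exp u + exp (- u) - 2)"
proof -
  have pos: "v\<^sup>2 \<le> 4 * (exp v + exp (- v) - 2)" if "v \<ge> 0" for v :: real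
  proof -
    have "exp (v / 2) - exp (- (v / 2)) \<ge> v / 2"
      using exp_ge_add_one_self[of "v / 2"] that exp_le_one_iff[of "- (v / 2)"] by linarith
    hence "(v / 2)\<^sup>2 \<le> (exp (v / 2) - exp (- (v / 2)))\<^sup>2" using that by (intro power_mono) auto
    also have "\<dots> = exp v + exp (- v) - 2"
      by (simp add: power2_eq_square algebra_simps exp_add[symmetric] exp_minus_inverse)
    finally show ?thesis by (simp add: power_divide)
  qed
  show ?thesis using pos[of u] pos[of "- u"] by (cases "u \<ge> 0") auto
qed

lemma exp_le_quadratic_add_one:
  fixes z :: real assumes "z \<le> 1" shows "exp z \<le> 1 + z + z\<^sup>2"
proof (cases "z \<ge> 0")
  case True
  thus ?thesis using exp_bound[of z] assms by simp
next
  case False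
  have "0 < 1 - z" using False by simp
  have "exp z * exp (- z) = 1" by (simp add: exp_minus_inverse)
  moreover have "exp (- z) \<ge> 1 - z" using exp_ge_add_one_self[of "- z"] by simp
  hence "exp z * (1 - z) \<le> exp z * exp (- z)" by (intro mult_left_mono) auto
  ultimately have "exp z * (1 - z) \<le> 1" by simp
  also have "1 \<le> (1 + z + z\<^sup>2) * (1 - z)"
  proof -
    have "(1 + z + z\<^sup>2) * (1 - z) = 1 - z\<^sup>2 * z" by (simp add: algebra_simps power2_eq_square)
    moreover have "z\<^sup>2 * z \<le> 0" using False by (intro mult_nonneg_nonpos) auto
    ultimately show ?thesis by linarith
  qed
  finally show ?thesis using \<open>0 < 1 - z\<close> by (simp only: mult_le_cancel_right_pos)
qed

lemma quad_form_le_sum_squares: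
  "\<bar>quad_form I Q u u\<bar> \<le> (\<Sum>i\<in>I. \<Sum>j\<in>I. \<bar>Q i j\<bar>) * (\<Sum>k\<in>I. (u k)\<^sup>2)" if "finite I"
proof -
  have "\<bar>u i * Q i j * u j\<bar> \<le> \<bar>Q i j\<bar> * (\<Sum>k\<in>I. (u k)\<^sup>2)" if ij: "i \<in> I" "j \<in> I" for i j
  proof -
    have le: "(u k)\<^sup>2 \<le> (\<Sum>k\<in>I. (u k)\<^sup>2)" if "k \<in> I" for k
      using \<open>finite I\<close> that by (intro member_le_sum) auto
    have "2 * \<bar>u i * u j\<bar> \<le> (u i)\<^sup>2 + (u j)\<^sup>2"
      using sum_squares_bound[of "\<bar>u i\<bar>" "\<bar>u j\<bar>"] by (simp add: abs_mult)
    hence "\<bar>u i * u j\<bar> \<le> (\<Sum>k\<in>I. (u k)\<^sup>2)" using le[OF ij(1)] le[OF ij(2)] by linarith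
    hence "\<bar>Q i j\<bar> * \<bar>u i * u j\<bar> \<le> \<bar>Q i j\<bar> * (\<Sum>k\<in>I. (u k)\<^sup>2)" by (intro mult_left_mono) auto
    thus ?thesis by (simp add: abs_mult mult_ac)
  qed
  hence "(\<Sum>i\<in>I. \<Sum>j\<in>I. \<bar>u i * Q i j * u j\<bar>) \<le> (\<Sum>i\<in>I. \<Sum>j\<in>I. \<bar>Q i j\<bar> * (\<Sum>k\<in>I. (u k)\<^sup>2))"
    by (intro sum_mono) auto
  moreover have "\<bar>quad_form I Q u u\<bar> \<le> (\<Sum>i\<in>I. \<Sum>j\<in>I. \<bar>u i * Q i j * u j\<bar>)"
    unfolding quad_form_def by (intro order_trans[OF sum_abs] sum_mono order_refl)
  ultimately show ?thesis by (simp add: sum_distrib_right)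
qed

text \<open>The first-order term is written with \<open>exp (u k) - 1\<close> and the error with \<open>exp (u k) + exp (- u k) - 2\<close>
  because the simplex integrals of exponentials are known in closed form.\<close>

lemma gauss_factor_expansion:
  fixes m :: "nat \<Rightarrow> real" and g :: "(nat \<Rightarrow> real) \<Rightarrow> real"
  assumes pd: "posdef_on I B"
    and g_def: "\<And>u. g u = exp (- quad_form I (inv_on I B) (\<lambda>i. u i - m i) (\<lambda>i. u i - m i) / 2)"
  shows "\<exists>l K. \<forall>u. \<bar>g u - g (\<lambda>_. 0) - g (\<lambda>_. 0) * (\<Sum>k\<in>I. l k * (exp (u k) - 1))\<bar> \<le>
      K * (\<Sum>k\<in>I. exp (u k) + exp (- u k) - 2)"
proof -
  define Q where "Q = inv_on I B"
  note g_def = g_def[folded Q_def]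
  have I: "finite I" using posdef_onD(1)[OF pd] .
  \<comment> \<open>The gradient of \<open>ln (g u)\<close> at \<open>u = 0\<close>.\<close>
  define l where "l k = (\<Sum>i\<in>I. m i * Q i k)" for k
  define N where "N = (\<Sum>k\<in>I. \<bar>l k\<bar>)"
  define C2 where "C2 = (\<Sum>k\<in>I. (l k)\<^sup>2)"
  define Cq where "Cq = (\<Sum>i\<in>I. \<Sum>j\<in>I. \<bar>Q i j\<bar>)"
  \<comment> \<open>The three error sources: \<open>N\<close> from replacing \<open>u k\<close> by
    \<open>exp (u k) - 1\<close>, \<open>8 * C2\<close> from \<open>2 * z^2\<close> with
    \<open>z^2 \<le> 4 * C2 * T\<close>, and \<open>2 * Cq\<close> from \<open>q / 2\<close> with
    \<open>q \<le> 4 * Cq * T\<close>.\<close>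
  define K where "K = N + 8 * C2 + 2 * Cq"
  have nn: "N \<ge> 0" "C2 \<ge> 0" "Cq \<ge> 0" by (auto simp: N_def C2_def Cq_def intro!: sum_nonneg)
  show ?thesis
  proof (intro exI allI)
    fix u :: "nat \<Rightarrow> real"
    define s where "s k = exp (u k) + exp (- u k) - 2" for k
    define T where "T = (\<Sum>k\<in>I. s k)"
    define z where "z = (\<Sum>k\<in>I. l k * u k)"
    define zz where "zz = (\<Sum>k\<in>I. l k * (exp (u k) - 1))"
    define q where "q = quad_form I Q u u"
    define g0 where "g0 = g (\<lambda>_. 0)"
    have s: "(u k)\<^sup>2 \<le> 4 * s k" for k using square_le_exp_add_exp_minus by (simp add: s_def)
    have s0: "s k \<ge> 0" for k using s[of k] zero_le_power2[of "u k"] by linarith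
    hence T0: "T \<ge> 0" by (auto simp: T_def intro: sum_nonneg)
    have sq: "(\<Sum>k\<in>I. (u k)\<^sup>2) \<le> 4 * T" unfolding T_def sum_distrib_left by (intro sum_mono s)
    have g0: "g0 = exp (- quad_form I Q m m / 2)"
      by (simp add: g0_def g_def quad_form_def)
    have g01: "0 < g0" "g0 \<le> 1" using quad_form_inv_on_nonneg[OF pd] by (auto simp: g0 Q_def)
    have q0: "q \<ge> 0" unfolding q_def Q_def by (rule quad_form_inv_on_nonneg[OF pd])
    have q1: "q \<le> Cq * (4 * T)"
      using quad_form_le_sum_squares[OF I, of Q u] mult_left_mono[OF sq nn(3)] by (simp add: q_def Cq_def)
    have z2: "z\<^sup>2 \<le> C2 * (4 * T)"
    proof -
      have "z\<^sup>2 \<le> C2 * (\<Sum>k\<in>I. (u k)\<^sup>2)" unfolding z_def C2_def by (rule Cauchy_Schwarz_ineq_sum)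
      also have "\<dots> \<le> C2 * (4 * T)" using sq nn by (intro mult_left_mono)
      finally show ?thesis .
    qed
    have zz: "\<bar>z - zz\<bar> \<le> N * T"
    proof -
      have e: "\<bar>u k - (exp (u k) - 1)\<bar> \<le> s k" for k
        unfolding s_def abs_le_iff using exp_ge_add_one_self[of "u k"] exp_ge_add_one_self[of "- u k"] by linarith
      have "\<bar>z - zz\<bar> = \<bar>\<Sum>k\<in>I. l k * (u k - (exp (u k) - 1))\<bar>"
        unfolding z_def zz_def by (simp add: sum_subtractf[symmetric] algebra_simps)
      also have "\<dots> \<le> (\<Sum>k\<in>I. \<bar>l k\<bar> * s k)"
        by (rule order_trans[OF sum_abs]) (auto intro!: sum_mono mult_left_mono e simp: abs_mult)
      also have "\<dots> \<le> (\<Sum>k\<in>I. \<bar>l k\<bar> * T)"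
        using I s0 by (intro sum_mono mult_left_mono) (auto simp: T_def intro: member_le_sum)
      finally show ?thesis by (simp add: N_def sum_distrib_right)
    qed
    have "quad_form I Q (\<lambda>i. u i + (-1) * m i) (\<lambda>i. u i + (-1) * m i) =
        q + 2 * (-1) * quad_form I Q m u + (-1)\<^sup>2 * quad_form I Q m m"
      unfolding q_def Q_def using I posdef_on_inv(2)[OF pd] by (intro quad_form_line) auto
    also have "quad_form I Q m u = z"
      unfolding quad_form_def z_def l_def by (subst sum.swap) (simp add: sum_distrib_right)
    finally have gu: "g u = g0 * exp (z - q / 2)"
      unfolding g_def g0 exp_add[symmetric] by (simp add: field_simps)
    have g1: "g u \<le> 1" using quad_form_inv_on_nonneg[OF pd] by (simp add: g_def Q_def)
    have lower: "g0 * (1 + z - q / 2) \<le> g u"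
    proof -
      have "1 + z - q / 2 \<le> exp (z - q / 2)" using exp_ge_add_one_self[of "z - q / 2"] by linarith
      thus ?thesis unfolding gu using g01 by (intro mult_left_mono) auto
    qed
    \<comment> \<open>For small \<open>z\<close> the quadratic part \<open>q\<close> is dropped and
      the exponential expanded. For \<open>\<bar>z\<bar> > 1\<close> the bound rests on
      \<open>g u \<le> 1 \<le> z^2\<close> together with \<open>g0 * (1 + z) \<ge> - z^2\<close>,
      which is why the coefficient is two.\<close>
    have upper: "g u \<le> g0 * (1 + z) + 2 * z\<^sup>2"
    proof (cases "\<bar>z\<bar> \<le> 1")
      case True
      have "g u \<le> g0 * exp z" unfolding gu using g01 q0 by (intro mult_left_mono) auto
      also have "\<dots> \<le> g0 * (1 + z + z\<^sup>2)"
        using True g01 by (intro mult_left_mono exp_le_quadratic_add_one) auto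
      also have "\<dots> \<le> g0 * (1 + z) + 2 * z\<^sup>2"
      proof -
        have "g0 * z\<^sup>2 \<le> 1 * z\<^sup>2" "0 \<le> z\<^sup>2" using mult_right_mono[OF g01(2) zero_le_power2] by auto
        thus ?thesis by (simp only: distrib_left)
      qed
      finally show ?thesis .
    next
      case False
      hence "1 \<le> z\<^sup>2" using one_le_power[of "\<bar>z\<bar>" 2] by simp
      moreover have "g0 * (1 + z + z\<^sup>2) \<ge> 0"
      proof -
        have "1 + z + z\<^sup>2 = (z + 1/2)\<^sup>2 + 3/4" by (simp add: power2_eq_square algebra_simps)
        hence "1 + z + z\<^sup>2 \<ge> 0" by simp
        thus ?thesis using g01 by simp
      qed
      moreover have "g0 * z\<^sup>2 \<le> z\<^sup>2" using mult_right_mono[OF g01(2), of "z\<^sup>2"] by simp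
      ultimately show ?thesis using g1 by (simp add: algebra_simps)
    qed
    have gz: "\<bar>g0 * z - g0 * zz\<bar> \<le> N * T"
    proof -
      have "\<bar>g0 * z - g0 * zz\<bar> = g0 * \<bar>z - zz\<bar>" using g01 by (simp add: abs_mult right_diff_distrib[symmetric])
      also have "\<dots> \<le> 1 * \<bar>z - zz\<bar>" using g01 by (intro mult_right_mono) auto
      finally show ?thesis using zz by simp
    qed
    have gq: "g0 * q \<le> Cq * (4 * T)"
      using mult_right_mono[OF g01(2) q0] q1 by simp
    have "\<bar>g u - g0 - g0 * zz\<bar> \<le> K * T"
    proof (rule abs_leI)
      have "g u - g0 - g0 * zz \<le> N * T + 2 * (C2 * (4 * T))" using upper gz z2 by (simp add: algebra_simps)
      also have "\<dots> \<le> K * T" using nn T0 by (simp add: K_def algebra_simps)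
      finally show "g u - g0 - g0 * zz \<le> K * T" .
      have "- (g u - g0 - g0 * zz) \<le> N * T + Cq * (4 * T) / 2" using lower gz gq by (simp add: algebra_simps)
      also have "\<dots> \<le> K * T" using nn T0 by (simp add: K_def algebra_simps)
      finally show "- (g u - g0 - g0 * zz) \<le> K * T" .
    qed
    thus "\<bar>g u - g (\<lambda>_. 0) - g (\<lambda>_. 0) * (\<Sum>k\<in>I. l k * (exp (u k) - 1))\<bar> \<le>
      K * (\<Sum>k\<in>I. exp (u k) + exp (- u k) - 2)"
      by (simp add: g0_def zz_def T_def s_def)
  qed
qed

text \<open>The simplex of size \<open>exp (- L)\<close> contributes \<open>exp (- L)\<close> to the
  power of the total exponent, and the shift of every coordinate by \<open>L\<close> cancels
  precisely this factor.\<close>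

lemma simplex_moment:
  fixes I :: "nat set" and a c :: "nat \<Rightarrow> real"
  assumes "finite I" "\<And>k. k \<in> I \<Longrightarrow> a k > 0"
  shows "has_bochner_integral (PiM I (\<lambda>_. lborel))
     (\<lambda>y. indicator {y. (\<Sum>k\<in>I. exp (y k)) \<le> exp (- L)} y * exp (\<Sum>k\<in>I. a k * (y k + L + c k)))
     (exp (\<Sum>k\<in>I. a k * c k) * (\<Prod>k\<in>I. Gamma (a k)) / Gamma (1 + (\<Sum>k\<in>I. a k)))"
proof -
  define A where "A = (\<Sum>k\<in>I. a k)"
  have A: "A \<ge> 0" unfolding A_def using assms(2) by (intro sum_nonneg less_imp_le)
  have G: "(\<Prod>k\<in>I. Gamma (a k)) \<ge> 0" using assms by (intro prod_nonneg less_imp_le[OF Gamma_real_pos]) auto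
  have [measurable]: "(\<lambda>y. \<Sum>k\<in>I. a k * y k) \<in> borel_measurable (PiM I (\<lambda>_. lborel :: real measure))"
    by (rule borel_measurable_sum_PiM) auto
  have [measurable]: "(\<lambda>y. \<Sum>k\<in>I. exp (y k)) \<in> borel_measurable (PiM I (\<lambda>_. lborel :: real measure))"
    by (rule borel_measurable_sum_PiM) auto
  have "has_bochner_integral (PiM I (\<lambda>_. lborel))
     (\<lambda>y. indicator {y. (\<Sum>k\<in>I. exp (y k)) \<le> exp (- L)} y * exp (\<Sum>k\<in>I. a k * y k))
     (exp (- L) powr A * (\<Prod>k\<in>I. Gamma (a k)) / Gamma (1 + A))"
  proof (rule has_bochner_integral_nn_integral)
    show "(\<integral>\<^sup>+ y. ennreal (indicator {y. (\<Sum>k\<in>I. exp (y k)) \<le> exp (- L)} y * exp (\<Sum>k\<in>I. a k * y k)) \<partial>PiM I (\<lambda>_. lborel)) =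
      ennreal (exp (- L) powr A * (\<Prod>k\<in>I. Gamma (a k)) / Gamma (1 + A))"
      using nn_integral_exp_simplex[OF assms, where t = "exp (- L)"]
      by (simp add: A_def ennreal_mult ennreal_indicator)
  qed (use A G in \<open>auto simp: Gamma_real_nonneg\<close>)
  hence hb: "has_bochner_integral (PiM I (\<lambda>_. lborel))
     (\<lambda>y. exp (A * L + (\<Sum>k\<in>I. a k * c k)) *
       (indicator {y. (\<Sum>k\<in>I. exp (y k)) \<le> exp (- L)} y * exp (\<Sum>k\<in>I. a k * y k)))
     (exp (A * L + (\<Sum>k\<in>I. a k * c k)) * (exp (- L) powr A * (\<Prod>k\<in>I. Gamma (a k)) / Gamma (1 + A)))"
    by (rule has_bochner_integral_mult_right)
  have val: "exp (A * L + (\<Sum>k\<in>I. a k * c k)) * (exp (- L) powr A * (\<Prod>k\<in>I. Gamma (a k)) / Gamma (1 + A)) =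
     exp (\<Sum>k\<in>I. a k * c k) * (\<Prod>k\<in>I. Gamma (a k)) / Gamma (1 + A)"
  proof -
    have "exp (- L) powr A = inverse (exp (A * L))" unfolding powr_def ln_exp by (simp add: exp_minus)
    thus ?thesis by (simp add: exp_add)
  qed
  have ex: "exp (\<Sum>k\<in>I. a k * (y k + L + c k)) = exp (A * L + (\<Sum>k\<in>I. a k * c k)) * exp (\<Sum>k\<in>I. a k * y k)" for y
    unfolding exp_add[symmetric] A_def sum_distrib_right sum.distrib[symmetric]
    by (simp add: algebra_simps sum.distrib)
  show ?thesis unfolding ex A_def[symmetric] using hb[unfolded val] by (simp add: mult_ac)
qed

lemma Gamma_plus1_real': "x > 0 \<Longrightarrow> Gamma (1 + x) = x * Gamma (x :: real)"
  using Gamma_plus1_real[of x] by (simp add: add.commute)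

section \<open>Calculus of relative errors of order \<open>1 / L\<close>\<close>

lemma asymp_one_mult:
  fixes f g :: "real \<Rightarrow> real"
  assumes "(\<lambda>L. f L - 1) \<in> O(\<lambda>L. 1 / L)" "(\<lambda>L. g L - 1) \<in> O(\<lambda>L. 1 / L)"
  shows "(\<lambda>L. f L * g L - 1) \<in> O(\<lambda>L. 1 / L)"
proof -
  have "(\<lambda>L. (f L - 1) * (g L - 1)) \<in> O(\<lambda>L. 1 / L * (1 / L))"
    by (rule landau_o.big.mult[OF assms])
  also have "(\<lambda>L::real. 1 / L * (1 / L)) \<in> O(\<lambda>L. 1 / L)" by real_asymp
  finally have "(\<lambda>L. (f L - 1) * (g L - 1) + ((f L - 1) + (g L - 1))) \<in> O(\<lambda>L. 1 / L)"
    by (intro sum_in_bigo assms)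
  thus ?thesis by (simp add: algebra_simps)
qed

lemma exp_minus_one_in_bigo:
  fixes f :: "real \<Rightarrow> real"
  assumes "\<forall>\<^sub>F L in at_top. \<bar>f L\<bar> \<le> C / L"
  shows "(\<lambda>L. exp (f L) - 1) \<in> O(\<lambda>L. 1 / L)"
proof (rule bigoI)
  show "\<forall>\<^sub>F L in at_top. norm (exp (f L) - 1) \<le> (2 * C) * norm (1 / L)"
    using assms eventually_gt_at_top[of 0] eventually_ge_at_top[of C]
  proof eventually_elim
    case (elim L)
    have "C / L \<le> 1" using elim by simp
    hence "\<bar>f L\<bar> \<le> 1" using elim by linarith
    hence "(f L)\<^sup>2 \<le> \<bar>f L\<bar>" using power_decreasing[of 1 2 "\<bar>f L\<bar>"] by simp
    moreover have "exp (f L) \<le> 1 + f L + (f L)\<^sup>2"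
      using \<open>\<bar>f L\<bar> \<le> 1\<close> by (intro exp_le_quadratic_add_one) simp
    moreover have "1 + f L \<le> exp (f L)" by (rule exp_ge_add_one_self)
    ultimately have "\<bar>exp (f L) - 1\<bar> \<le> 2 * \<bar>f L\<bar>" by linarith
    also have "\<dots> \<le> 2 * (C / L)" using elim by simp
    finally show ?case using elim by simp
  qed
qed

lemma inverse_affine_bigo:
  fixes s x :: real
  assumes "s > 0"
  shows "(\<lambda>L. x * (1 / (1 + L * s))) \<in> O(\<lambda>L. 1 / L)"
  using assms by real_asymp

lemma moment_sum_bigo:
  fixes s a :: real
  assumes "s > 0" "a > 0"
  shows "(\<lambda>L. L * s / (1 + L * s) + L * a / (L * a - 1) - 2) \<in> O(\<lambda>L. 1 / L)"
  using assms by real_asymp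

lemma eventually_scale_gt_one:
  fixes a :: real
  assumes "a > 0"
  shows "\<forall>\<^sub>F L in at_top. L * a > 1"
  using assms by real_asymp

text \<open>This is the quotient of the leading term at \<open>L - ln (1 - 1 / L\<^sup>2)\<close>
  and at \<open>L\<close>. The shift is about \<open>1 / L^2\<close>, so the squares differ by about
  \<open>2 / L\<close>, and the quotient is one up to \<open>O(1 / L)\<close>.\<close>

lemma shifted_main_ratio:
  fixes a b s :: real
  assumes "s > 0"
  shows "(\<lambda>L. ((L - ln (1 - 1 / L\<^sup>2)) / L) powr a *
      exp (b * ln (1 - 1 / L\<^sup>2) - s / 2 * ((L - ln (1 - 1 / L\<^sup>2))\<^sup>2 - L\<^sup>2)) - 1) \<in> O(\<lambda>L. 1 / L)"
  using assms by real_asymp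

text \<open>The Gaussian gain absorbs all corrections of the tail estimate: the linear term, the
  power of \<open>L\<close> in the leading term, and the \<open>L * ln L\<close> coming from the
  logarithm in the threshold.\<close>

lemma quadratic_decay_bigo:
  fixes k a b e :: real
  assumes "k > 0"
  shows "(\<lambda>L. exp (- k * L\<^sup>2 + b * L + a * ln L + e * (L * ln L))) \<in> O(\<lambda>L. 1 / L)"
  using assms by real_asymp

lemma shift_filterlim: "filterlim (\<lambda>L::real. L - ln (1 - 1 / L\<^sup>2)) at_top at_top"
  by real_asymp

lemma shift_inverse_bigo: "(\<lambda>L. 1 / ((L::real) - ln (1 - 1 / L\<^sup>2))) \<in> O(\<lambda>L. 1 / L)"
  by real_asymp

text \<open>To be applied with \<open>P\<close> the support probability, \<open>P'\<close> the same
  at the slightly smaller budget, and \<open>T\<close> the total probability of the off-support tail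
  events.\<close>

lemma asymp_one_sandwich:
  fixes F P P' T m :: "real \<Rightarrow> real"
  assumes "\<forall>\<^sub>F L in at_top. F L \<le> P L" "\<forall>\<^sub>F L in at_top. P' L - T L \<le> F L" "\<forall>\<^sub>F L in at_top. m L > 0"
    and P: "(\<lambda>L. P L / m L - 1) \<in> O(\<lambda>L. 1 / L)" and P': "(\<lambda>L. P' L / m L - 1) \<in> O(\<lambda>L. 1 / L)"
    and T: "(\<lambda>L. T L / m L) \<in> O(\<lambda>L. 1 / L)"
  shows "(\<lambda>L. F L / m L - 1) \<in> O(\<lambda>L. 1 / L)"
proof (rule landau_o.big.trans)
  show "(\<lambda>L. \<bar>P L / m L - 1\<bar> + \<bar>P' L / m L - 1\<bar> + \<bar>T L / m L\<bar>) \<in> O(\<lambda>L. 1 / L)"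
    by (intro sum_in_bigo landau_o.big.abs_in_iff[THEN iffD2] P P' T)
  show "(\<lambda>L. F L / m L - 1) \<in> O(\<lambda>L. \<bar>P L / m L - 1\<bar> + \<bar>P' L / m L - 1\<bar> + \<bar>T L / m L\<bar>)"
  proof (rule bigoI)
    show "\<forall>\<^sub>F L in at_top. norm (F L / m L - 1) \<le>
        1 * norm (\<bar>P L / m L - 1\<bar> + \<bar>P' L / m L - 1\<bar> + \<bar>T L / m L\<bar>)"
      using assms(1-3)
    proof eventually_elim
      case (elim L)
      have "F L / m L \<le> P L / m L" using elim by (intro divide_right_mono) auto
      moreover have "(P' L - T L) / m L \<le> F L / m L" using elim by (intro divide_right_mono) auto
      hence "P' L / m L - T L / m L \<le> F L / m L" by (simp add: diff_divide_distrib)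
      ultimately have "\<bar>F L / m L - 1\<bar> \<le> \<bar>P L / m L - 1\<bar> + \<bar>P' L / m L - 1\<bar> + \<bar>T L / m L\<bar>" by linarith
      thus ?case by simp
    qed
  qed
qed

text \<open>This separates the analysis on the support from the minimization problem. Positive row
  sums make the Dirichlet parameters \<open>L * A k\<close> positive; that the minimizer's support
  has this property is shown separately.\<close>

locale positive_row_sums =
  fixes I :: "nat set" and B :: "nat \<Rightarrow> nat \<Rightarrow> real" and \<mu> :: "nat \<Rightarrow> real"
  assumes posdef: "posdef_on I B"
    and nonempty: "I \<noteq> {}"
    and row_sum_pos: "\<And>k. k \<in> I \<Longrightarrow> (\<Sum>j\<in>I. inv_on I B k j) > 0"
begin

text \<open>With \<open>x = exp (- L)\<close> and \<open>u k = y k + L + c k\<close>, the point \<open>u = 0\<close> maximises the linear form \<open>\<Sum>k. A k * y k\<close>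
  over the simplex event. The Gaussian density factors into constants depending on \<open>L\<close>, the exponential weight collected in \<open>h L\<close>
  (total mass \<open>D L\<close>), and the factor \<open>g u\<close>, which does not depend on \<open>L\<close>.\<close>

definition "Q = inv_on I B"
definition "A k = (\<Sum>j\<in>I. Q k j)"
definition "S = (\<Sum>k\<in>I. A k)"
definition "c k = ln (S / A k)"
definition "m k = c k + \<mu> k"
definition "\<beta> = (\<Sum>k\<in>I. A k * m k)"
definition "g u = exp (- quad_form I Q (\<lambda>i. u i - m i) (\<lambda>i. u i - m i) / 2)"
definition "g0 = g (\<lambda>_. 0)"
definition "norm_const = 1 / sqrt ((2 * pi) ^ card I * det_on I B)"
definition "simplex_ind L y = indicator {y. (\<Sum>k\<in>I. exp (y k)) \<le> exp (- L)} y" for L :: real and y :: "nat \<Rightarrow> real"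
definition "h L y = simplex_ind L y * exp (\<Sum>k\<in>I. L * A k * (y k + L + c k))" for L :: real and y :: "nat \<Rightarrow> real"
definition "D L = exp (\<Sum>k\<in>I. L * A k * c k) * (\<Prod>k\<in>I. Gamma (L * A k)) / Gamma (1 + L * S)" for L :: real
text \<open>The constant that Stirling's formula leaves in \<open>D L\<close> besides the power of
  \<open>L\<close>.\<close>

definition "d = (2 * pi) powr ((real (card I) - 1) / 2) / (sqrt S * sqrt (\<Prod>k\<in>I. A k))"
definition "rest L = (\<integral>y. h L y * g (\<lambda>k. y k + L + c k) \<partial>PiM I (\<lambda>_. lborel))"
definition "prob L = (\<integral>\<^sup>+ y. simplex_ind L y * ennreal (gauss_dens I \<mu> B y) \<partial>PiM I (\<lambda>_. lborel))"
definition "main L = norm_const * d * g0 * L powr (- (1 + real (card I)) / 2) * exp (- L * \<beta>) * exp (- (1/2) * S * L\<^sup>2)"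

lemma finite_I: "finite I" using posdef by (rule posdef_onD)

lemma A_pos: "k \<in> I \<Longrightarrow> A k > 0" using row_sum_pos by (simp add: A_def Q_def)

lemma S_pos: "S > 0" unfolding S_def using A_pos finite_I nonempty by (intro sum_pos) auto

lemma norm_const_pos: "norm_const > 0" using posdef_onD(3)[OF posdef] by (simp add: norm_const_def)

lemma prod_A_pos: "(\<Prod>k\<in>I. A k) > 0" using A_pos by (intro prod_pos) auto

lemma d_pos: "d > 0" using S_pos prod_A_pos by (simp add: d_def)

lemma g0_pos: "g0 > 0" by (simp add: g0_def g_def)

lemma g_bounds: "0 < g u" "g u \<le> 1"
  using quad_form_inv_on_nonneg[OF posdef] by (auto simp: g_def Q_def)

lemma main_pos: "L > 0 \<Longrightarrow> main L > 0"
  using norm_const_pos d_pos g0_pos by (simp add: main_def)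

lemma D_pos: "L > 0 \<Longrightarrow> D L > 0"
  using A_pos S_pos unfolding D_def
  by (intro divide_pos_pos mult_pos_pos prod_pos Gamma_real_pos) (auto intro: add_pos_pos)

text \<open>With \<open>v = u - m\<close> the deviation of \<open>y\<close> from
  \<open>\<mu>\<close> is \<open>v\<close> minus the constant vector \<open>L\<close>. Expanding the
  form, the cross term pairs \<open>v\<close> with the row sums \<open>A k\<close>, which is the
  origin of the weights \<open>L * A k\<close>, and the square of the constant vector gives
  \<open>L\<^sup>2 * S\<close>.\<close>

lemma gauss_dens_factor:
  "gauss_dens I \<mu> B y = norm_const * exp (- (1/2) * S * L\<^sup>2 - L * \<beta>) *
     (exp (\<Sum>k\<in>I. L * A k * (y k + L + c k)) * g (\<lambda>k. y k + L + c k))"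
proof -
  define v where "v k = (y k + L + c k) - m k" for k
  have sym: "quad_form I Q (\<lambda>_. 1) v = (\<Sum>k\<in>I. A k * v k)"
    unfolding quad_form_def A_def Q_def using posdef_on_inv(2)[OF posdef]
    by (subst sum.swap) (auto simp: sum_distrib_right intro!: sum.cong)
  have one: "quad_form I Q (\<lambda>_. 1) (\<lambda>_. 1) = S"
    by (simp add: quad_form_def S_def A_def)
  have "quad_form I Q (\<lambda>i. v i + (- L) * 1) (\<lambda>i. v i + (- L) * 1) =
      quad_form I Q v v + 2 * (- L) * quad_form I Q (\<lambda>_. 1) v + (- L)\<^sup>2 * quad_form I Q (\<lambda>_. 1) (\<lambda>_. 1)"
    unfolding Q_def using finite_I posdef_on_inv(2)[OF posdef] by (intro quad_form_line) auto
  hence e: "quad_form I Q (\<lambda>i. y i - \<mu> i) (\<lambda>i. y i - \<mu> i) =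
      quad_form I Q v v - 2 * L * (\<Sum>k\<in>I. A k * v k) + L\<^sup>2 * S"
    unfolding sym one by (simp add: v_def m_def algebra_simps)
  have s: "(\<Sum>k\<in>I. L * A k * (y k + L + c k)) = L * (\<Sum>k\<in>I. A k * v k) + L * \<beta>"
    unfolding \<beta>_def sum_distrib_left sum.distrib[symmetric] by (intro sum.cong) (auto simp: v_def algebra_simps)
  show ?thesis
    unfolding gauss_dens_def g_def norm_const_def Q_def[symmetric] e s v_def[symmetric]
    by (simp add: exp_add[symmetric] algebra_simps add_divide_distrib diff_divide_distrib)
qed

text \<open>An extra exponential factor only shifts the Dirichlet parameters by \<open>e\<close>, so
  every exponential moment of \<open>u\<close> under the weight is again a quotient of Gamma
  values.\<close>

lemma h_moment:
  assumes "\<And>k. k \<in> I \<Longrightarrow> L * A k + e k > 0"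
  shows "has_bochner_integral (PiM I (\<lambda>_. lborel)) (\<lambda>y. h L y * exp (\<Sum>k\<in>I. e k * (y k + L + c k)))
    (exp (\<Sum>k\<in>I. (L * A k + e k) * c k) * (\<Prod>k\<in>I. Gamma (L * A k + e k)) / Gamma (1 + (\<Sum>k\<in>I. L * A k + e k)))"
proof -
  have "(\<Sum>k\<in>I. (L * A k + e k) * (y k + L + c k)) =
     (\<Sum>k\<in>I. L * A k * (y k + L + c k)) + (\<Sum>k\<in>I. e k * (y k + L + c k))" for y
    by (simp add: sum.distrib[symmetric] algebra_simps)
  thus ?thesis using simplex_moment[OF finite_I, where a = "\<lambda>k. L * A k + e k" and L = L and c = c] assms
    by (simp add: h_def simplex_ind_def exp_add mult.assoc)
qed

lemma sum_unit: "k \<in> I \<Longrightarrow> (\<Sum>j\<in>I. (if j = k then x else 0) * f j) = x * (f k :: real)"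
  using finite_I by (simp add: if_distrib[of "\<lambda>x. x * _"] cong: if_cong)

lemma h_integral: "L > 0 \<Longrightarrow> has_bochner_integral (PiM I (\<lambda>_. lborel)) (h L) (D L)"
  using h_moment[of L "\<lambda>_. 0"] A_pos by (simp add: D_def S_def sum_distrib_left)

text \<open>Raising one parameter by one multiplies the Gamma quotient by
  \<open>L * A k / (1 + L * S)\<close>, and the centring \<open>exp (c k) = S / A k\<close> cancels
  \<open>A k\<close>. The normalised mean of \<open>exp (u k) - 1\<close> is therefore
  \<open>- 1 / (1 + L * S)\<close>: the first-order term averages to order
  \<open>1 / L\<close>.\<close>

lemma h_integral_exp:
  assumes L: "L > 0" and k: "k \<in> I"
  shows "has_bochner_integral (PiM I (\<lambda>_. lborel)) (\<lambda>y. h L y * exp (y k + L + c k)) (D L * (L * S / (1 + L * S)))"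
proof -
  define e where "e j = (if j = k then 1 else 0 :: real)" for j
  have LA: "L * A k > 0" and LS: "L * S > 0" using L A_pos[OF k] S_pos by auto
  have 1: "(\<Sum>j\<in>I. e j * f j) = f k" for f unfolding e_def using sum_unit[OF k, of 1] by simp
  have s1: "(\<Sum>j\<in>I. L * A j + e j) = L * S + 1"
    using 1[of "\<lambda>_. 1"] by (simp add: sum.distrib S_def sum_distrib_left)
  have s2: "(\<Sum>j\<in>I. (L * A j + e j) * c j) = (\<Sum>j\<in>I. L * A j * c j) + c k"
    using 1[of c] by (simp add: sum.distrib algebra_simps)
  have p: "(\<Prod>j\<in>I. Gamma (L * A j + e j)) = (\<Prod>j\<in>I. Gamma (L * A j)) * (L * A k)"
  proof -
    have "(\<Prod>j\<in>I. Gamma (L * A j + e j)) = Gamma (L * A k + 1) * (\<Prod>j\<in>I - {k}. Gamma (L * A j))"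
      using finite_I k by (subst prod.remove[of _ k]) (auto simp: e_def intro!: prod.cong)
    also have "Gamma (L * A k + 1) = L * A k * Gamma (L * A k)"
      using LA by (rule Gamma_plus1_real)
    finally show ?thesis using finite_I k by (subst prod.remove[of _ k "\<lambda>j. Gamma (L * A j)"]) auto
  qed
  have G: "Gamma (1 + (L * S + 1)) = (1 + L * S) * Gamma (1 + L * S)"
    using Gamma_plus1_real[of "1 + L * S"] LS by (simp add: add_ac)
  have "has_bochner_integral (PiM I (\<lambda>_. lborel)) (\<lambda>y. h L y * exp (\<Sum>j\<in>I. e j * (y j + L + c j)))
    (exp (\<Sum>j\<in>I. (L * A j + e j) * c j) * (\<Prod>j\<in>I. Gamma (L * A j + e j)) / Gamma (1 + (\<Sum>j\<in>I. L * A j + e j)))"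
    using L A_pos by (intro h_moment) (auto simp: e_def intro: add_pos_nonneg)
  moreover have "exp (c k) = S / A k" unfolding c_def using S_pos A_pos[OF k] by simp
  moreover have "exp (\<Sum>j\<in>I. L * A j * c j) * (S / A k) * ((\<Prod>j\<in>I. Gamma (L * A j)) * (L * A k)) /
      ((1 + L * S) * Gamma (1 + L * S)) = D L * (L * S / (1 + L * S))"
    using A_pos[OF k] by (simp add: D_def mult_ac)
  ultimately show ?thesis
    unfolding 1 s1 s2 p G exp_add by simp
qed

text \<open>The recurrence is used in the opposite direction; the condition
  \<open>L * A k > 1\<close> keeps the lowered parameter positive.\<close>

lemma h_integral_exp_minus:
  assumes L: "L * A k > 1" and k: "k \<in> I"
  shows "has_bochner_integral (PiM I (\<lambda>_. lborel)) (\<lambda>y. h L y * exp (- (y k + L + c k))) (D L * (L * A k / (L * A k - 1)))"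
proof -
  define e where "e j = (if j = k then -1 else 0 :: real)" for j
  have L0: "L > 0" using L A_pos[OF k] by (smt (verit) mult_nonpos_nonneg)
  have LS: "L * S > 0" using L0 S_pos by auto
  have 1: "(\<Sum>j\<in>I. e j * f j) = - f k" for f unfolding e_def using sum_unit[OF k, of "-1"] by simp
  have s1: "(\<Sum>j\<in>I. L * A j + e j) = L * S - 1"
    using 1[of "\<lambda>_. 1"] by (simp add: sum.distrib S_def sum_distrib_left)
  have s2: "(\<Sum>j\<in>I. (L * A j + e j) * c j) = (\<Sum>j\<in>I. L * A j * c j) + - c k"
    using 1[of c] by (simp add: sum.distrib algebra_simps)
  have p: "(\<Prod>j\<in>I. Gamma (L * A j)) = (\<Prod>j\<in>I. Gamma (L * A j + e j)) * (L * A k - 1)"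
  proof -
    have "(\<Prod>j\<in>I. Gamma (L * A j + e j)) = Gamma (L * A k - 1) * (\<Prod>j\<in>I - {k}. Gamma (L * A j))"
      using finite_I k by (subst prod.remove[of _ k]) (auto simp: e_def intro!: prod.cong)
    moreover have "Gamma (L * A k) = (L * A k - 1) * Gamma (L * A k - 1)"
      using Gamma_plus1_real[of "L * A k - 1"] L by simp
    ultimately show ?thesis using finite_I k by (subst prod.remove[of _ k "\<lambda>j. Gamma (L * A j)"]) auto
  qed
  have G: "Gamma (1 + L * S) = L * S * Gamma (1 + (L * S - 1))"
    using Gamma_plus1_real'[OF LS] by simp
  have "has_bochner_integral (PiM I (\<lambda>_. lborel)) (\<lambda>y. h L y * exp (\<Sum>j\<in>I. e j * (y j + L + c j)))
    (exp (\<Sum>j\<in>I. (L * A j + e j) * c j) * (\<Prod>j\<in>I. Gamma (L * A j + e j)) / Gamma (1 + (\<Sum>j\<in>I. L * A j + e j)))"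
    using L L0 A_pos by (intro h_moment) (auto simp: e_def)
  moreover have "exp (- c k) = A k / S"
    unfolding exp_minus c_def using S_pos A_pos[OF k] by simp
  moreover have "D L * (L * A k / (L * A k - 1)) =
     exp (\<Sum>j\<in>I. L * A j * c j) * (A k / S) * (\<Prod>j\<in>I. Gamma (L * A j + e j)) / Gamma (1 + (L * S - 1))"
  proof -
    define E P Gm where "E = exp (\<Sum>j\<in>I. L * A j * c j)" and "P = (\<Prod>j\<in>I. Gamma (L * A j + e j))"
      and "Gm = Gamma (1 + (L * S - 1))"
    have "D L * (L * A k / (L * A k - 1)) = E * (P * (L * A k - 1)) / (L * S * Gm) * (L * A k / (L * A k - 1))"
      unfolding D_def p G E_def P_def Gm_def ..
    also have "\<dots> = E * P * (L * A k) / (L * S * Gm)" using L by simp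
    also have "\<dots> = E * (A k / S) * P / Gm" using L0 by simp
    finally show ?thesis unfolding E_def P_def Gm_def .
  qed
  ultimately show ?thesis
    unfolding 1 s1 s2 exp_add by simp
qed

lemma g_measurable: "(\<lambda>y. g (\<lambda>k. y k + L + c k)) \<in> borel_measurable (PiM I (\<lambda>_. lborel))"
proof -
  have [measurable]: "(\<lambda>y. quad_form I Q (\<lambda>i. y i - (m i - L - c i)) (\<lambda>i. y i - (m i - L - c i))) \<in>
      borel_measurable (PiM I (\<lambda>_. lborel :: real measure))"
    by (rule borel_measurable_quad_form_PiM) simp
  have "g (\<lambda>k. y k + L + c k) = exp (- quad_form I Q (\<lambda>i. y i - (m i - L - c i)) (\<lambda>i. y i - (m i - L - c i)) / 2)" for y
    unfolding g_def by (simp add: algebra_simps)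
  thus ?thesis by simp
qed

lemma rest_integral:
  assumes "L > 0"
  shows "has_bochner_integral (PiM I (\<lambda>_. lborel)) (\<lambda>y. h L y * g (\<lambda>k. y k + L + c k)) (rest L)"
  unfolding rest_def
proof (rule has_bochner_integral_integrable)
  note hi = h_integral[OF assms]
  have hm [measurable]: "h L \<in> borel_measurable (PiM I (\<lambda>_. lborel))" using hi by (auto simp: has_bochner_integral_iff)
  note g_measurable[of L, measurable]
  show "integrable (PiM I (\<lambda>_. lborel)) (\<lambda>y. h L y * g (\<lambda>k. y k + L + c k))"
  proof (rule Bochner_Integration.integrable_bound)
    show "integrable (PiM I (\<lambda>_. lborel)) (h L)" using hi by (simp add: has_bochner_integral_iff)
  qed (use g_bounds in \<open>auto simp: abs_mult less_imp_le intro!: AE_I2 mult_left_le\<close>)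
qed

lemma prob_eq:
  assumes "L > 0"
  shows "prob L = ennreal (norm_const * exp (- (1/2) * S * L\<^sup>2 - L * \<beta>) * rest L)"
proof -
  note ri = rest_integral[OF assms]
  have nn: "h L y * g (\<lambda>k. y k + L + c k) \<ge> 0" for y
    using g_bounds by (simp add: h_def simplex_ind_def less_imp_le)
  have "prob L = (\<integral>\<^sup>+ y. ennreal (norm_const * exp (- (1/2) * S * L\<^sup>2 - L * \<beta>)) *
      ennreal (h L y * g (\<lambda>k. y k + L + c k)) \<partial>PiM I (\<lambda>_. lborel))"
    unfolding prob_def
  proof (intro nn_integral_cong)
    fix y
    show "simplex_ind L y * ennreal (gauss_dens I \<mu> B y) =
      ennreal (norm_const * exp (- (1/2) * S * L\<^sup>2 - L * \<beta>)) * ennreal (h L y * g (\<lambda>k. y k + L + c k))"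
      unfolding gauss_dens_factor[of y L] using norm_const_pos nn[of y] g_bounds
      by (subst ennreal_mult[symmetric]) (auto simp: simplex_ind_def h_def indicator_def less_imp_le)
  qed
  also have "\<dots> = ennreal (norm_const * exp (- (1/2) * S * L\<^sup>2 - L * \<beta>)) *
      (\<integral>\<^sup>+ y. ennreal (h L y * g (\<lambda>k. y k + L + c k)) \<partial>PiM I (\<lambda>_. lborel))"
    using ri by (intro nn_integral_cmult) (auto simp: has_bochner_integral_iff)
  also have "(\<integral>\<^sup>+ y. ennreal (h L y * g (\<lambda>k. y k + L + c k)) \<partial>PiM I (\<lambda>_. lborel)) = ennreal (rest L)"
    using ri nn unfolding rest_def
    by (intro nn_integral_eq_integral) (auto simp: has_bochner_integral_iff)
  finally show ?thesis using norm_const_pos by (simp add: ennreal_mult')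
qed

text \<open>Integrate the expansion of \<open>g\<close> around \<open>0\<close> against the weight.
  The linear term and the error bound involve only \<open>exp (u k)\<close> and
  \<open>exp (- u k)\<close>, whose means are \<open>1 + O(1 / L)\<close>, so both contributions are
  of order \<open>1 / L\<close>.\<close>

lemma rest_asymp: "(\<lambda>L. rest L / D L - g0) \<in> O(\<lambda>L. 1 / L)"
proof -
  obtain l K where bnd: "\<And>u. \<bar>g u - g0 - g0 * (\<Sum>k\<in>I. l k * (exp (u k) - 1))\<bar> \<le>
      K * (\<Sum>k\<in>I. exp (u k) + exp (- u k) - 2)"
    using gauss_factor_expansion[OF posdef, of g m] unfolding g0_def[symmetric] by (auto simp: g_def Q_def)
  define R where "R L = g0 * (\<Sum>k\<in>I. \<bar>l k\<bar> * (1 / (1 + L * S))) +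
      K * (\<Sum>k\<in>I. L * S / (1 + L * S) + L * A k / (L * A k - 1) - 2)" for L
  have Rt: "(\<lambda>L. x * (1 / (1 + L * S))) \<in> O(\<lambda>L. 1 / L)" for x
    by (rule inverse_affine_bigo[OF S_pos])
  have Rs: "(\<lambda>L. L * S / (1 + L * S) + L * A k / (L * A k - 1) - 2) \<in> O(\<lambda>L. 1 / L)" if "k \<in> I" for k
    by (rule moment_sum_bigo[OF S_pos A_pos[OF that]])
  have "R \<in> O(\<lambda>L. 1 / L)"
    unfolding R_def by (intro sum_in_bigo(1) cmult_in_bigo_iff[THEN iffD2] disjI2 big_sum_in_bigo Rt Rs)
  moreover have "(\<lambda>L. rest L / D L - g0) \<in> O(R)"
  proof (rule bigoI)
    show "\<forall>\<^sub>F L in at_top. norm (rest L / D L - g0) \<le> 1 * norm (R L)"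
  proof -
    have "\<forall>\<^sub>F L in at_top. \<forall>k\<in>I. L * A k > 1"
      unfolding eventually_ball_finite_distrib[OF finite_I]
    proof
      fix k assume "k \<in> I"
      thus "\<forall>\<^sub>F L in at_top. L * A k > 1" by (intro eventually_scale_gt_one A_pos)
    qed
    thus ?thesis using eventually_gt_at_top[of 0]
    proof eventually_elim
      case (elim L)
      note L = \<open>L > 0\<close>
      define u where "u y k = y k + L + c k" for y :: "nat \<Rightarrow> real" and k
      define M where "M = (PiM I (\<lambda>_. lborel) :: (nat \<Rightarrow> real) measure)"
      \<comment> \<open>\<open>X\<close> is the weighted remainder of \<open>g\<close> after its
        first-order expansion and \<open>V\<close> its majorant, both with \<open>h L\<close>
        multiplied out so that every summand is a known moment; \<open>x\<close> and
        \<open>v\<close> are their integrals.\<close>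
      define X where "X y = h L y * g (u y) - (g0 * h L y + g0 * (\<Sum>k\<in>I. l k * (h L y * exp (u y k) - h L y)))" for y
      define V where "V y = K * (\<Sum>k\<in>I. (h L y * exp (u y k) + h L y * exp (- u y k)) - 2 * h L y)" for y
      define x where "x = rest L - (g0 * D L + g0 * (\<Sum>k\<in>I. l k * (D L * (L * S / (1 + L * S)) - D L)))"
      define v where "v = K * (\<Sum>k\<in>I. (D L * (L * S / (1 + L * S)) + D L * (L * A k / (L * A k - 1))) - 2 * D L)"
      note b1 = h_integral[OF L, folded M_def]
      have b2: "has_bochner_integral M (\<lambda>y. h L y * exp (u y k)) (D L * (L * S / (1 + L * S)))" if "k \<in> I" for k
        unfolding u_def M_def by (rule h_integral_exp[OF L that])
      have b3: "has_bochner_integral M (\<lambda>y. h L y * exp (- u y k)) (D L * (L * A k / (L * A k - 1)))" if "k \<in> I" for k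
        unfolding u_def M_def using elim that by (intro h_integral_exp_minus) auto
      have "has_bochner_integral M (\<lambda>y. h L y * g (u y)) (rest L)"
        unfolding u_def M_def by (rule rest_integral[OF L])
      hence X: "has_bochner_integral M X x"
        unfolding X_def x_def
        by (intro has_bochner_integral_diff has_bochner_integral_add has_bochner_integral_mult_right
            has_bochner_integral_sum b1 b2)
      have V: "has_bochner_integral M V v"
        unfolding V_def v_def
        by (intro has_bochner_integral_diff has_bochner_integral_add has_bochner_integral_mult_right
            has_bochner_integral_sum b1 b2 b3)
      have h0: "h L y \<ge> 0" for y by (simp add: h_def simplex_ind_def)
      have XV: "\<bar>X y\<bar> \<le> V y" for y
      proof -
        have "X y = h L y * (g (u y) - g0 - g0 * (\<Sum>k\<in>I. l k * (exp (u y k) - 1)))"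
        proof -
          have "(\<Sum>k\<in>I. l k * (h L y * exp (u y k) - h L y)) = h L y * (\<Sum>k\<in>I. l k * (exp (u y k) - 1))"
            unfolding sum_distrib_left by (intro sum.cong) (auto simp: algebra_simps)
          thus ?thesis unfolding X_def by (simp add: algebra_simps)
        qed
        hence "\<bar>X y\<bar> \<le> h L y * (K * (\<Sum>k\<in>I. exp (u y k) + exp (- u y k) - 2))"
          using h0[of y] bnd[of "u y"] by (simp add: abs_mult mult_left_mono)
        also have "\<dots> = V y" unfolding V_def sum_distrib_left by (intro sum.cong) (auto simp: algebra_simps)
        finally show ?thesis .
      qed
      have "\<bar>x\<bar> \<le> v"
      proof -
        have "\<bar>x\<bar> \<le> (\<integral>y. \<bar>X y\<bar> \<partial>M)"
          using X by (auto simp: has_bochner_integral_iff)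
        also have "\<dots> \<le> (\<integral>y. V y \<partial>M)"
          using X V XV by (intro integral_mono) (auto simp: has_bochner_integral_iff)
        also have "\<dots> = v" using V by (simp add: has_bochner_integral_iff)
        finally show ?thesis .
      qed
      have D: "D L > 0" by (rule D_pos[OF L])
      have LS: "1 + L * S > 0" using L S_pos by (simp add: add_pos_pos)
      define X2 where "X2 = g0 * (\<Sum>k\<in>I. l k * (1 / (1 + L * S)))"
      have "x = D L * (rest L / D L - g0 + X2)"
      proof -
        have e: "D L * (L * S / (1 + L * S)) - D L = - D L * (1 / (1 + L * S))" using LS by (simp add: field_simps)
        hence "(\<Sum>k\<in>I. l k * (D L * (L * S / (1 + L * S)) - D L)) = - D L * (\<Sum>k\<in>I. l k * (1 / (1 + L * S)))"
          unfolding e sum_distrib_left by (simp add: mult_ac)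
        thus ?thesis unfolding x_def X2_def using D by (simp add: algebra_simps)
      qed
      moreover have "v = D L * (K * (\<Sum>k\<in>I. L * S / (1 + L * S) + L * A k / (L * A k - 1) - 2))"
        unfolding v_def sum_distrib_left by (intro sum.cong) (auto simp: algebra_simps)
      ultimately have "\<bar>rest L / D L - g0 + X2\<bar> \<le> K * (\<Sum>k\<in>I. L * S / (1 + L * S) + L * A k / (L * A k - 1) - 2)"
        using \<open>\<bar>x\<bar> \<le> v\<close> D by (simp add: abs_mult)
      moreover have "\<bar>X2\<bar> \<le> g0 * (\<Sum>k\<in>I. \<bar>l k\<bar> * (1 / (1 + L * S)))"
      proof -
        have "\<bar>X2\<bar> = g0 * \<bar>\<Sum>k\<in>I. l k * (1 / (1 + L * S))\<bar>" using g0_pos by (simp add: X2_def abs_mult)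
        also have "\<dots> \<le> g0 * (\<Sum>k\<in>I. \<bar>l k * (1 / (1 + L * S))\<bar>)"
          using g0_pos by (intro mult_left_mono sum_abs) auto
        finally show ?thesis using LS by (simp add: abs_mult)
      qed
      ultimately have "\<bar>rest L / D L - g0\<bar> \<le> R L" unfolding R_def by linarith
      thus ?case by simp
    qed
  qed
  qed
  ultimately show ?thesis by (rule landau_o.big.trans[rotated])
qed

text \<open>Taking logarithms, the terms of order \<open>L * ln L\<close> and \<open>L\<close>
  cancel because the \<open>A k\<close> sum to \<open>S\<close>. Each numerator Gamma leaves
  \<open>- ln L / 2\<close>; the denominator \<open>Gamma (1 + L * S)\<close> leaves
  \<open>+ ln L / 2\<close> from Stirling and \<open>- ln L\<close> from the recurrence. Together
  this is the exponent \<open>- (1 + card I) / 2\<close>.\<close>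

lemma D_asymp: "(\<lambda>L. D L / (d * L powr (- (1 + real (card I)) / 2)) - 1) \<in> O(\<lambda>L. 1 / L)"
proof -
  define n where "n = real (card I)"
  define r where "r x = ln_Gamma x - stirling_ln x" for x :: real
  define \<rho> where "\<rho> L = (\<Sum>k\<in>I. r (L * A k)) - r (L * S)" for L
  define C where "C = (\<Sum>k\<in>I. 1 / (4 * A k)) + 1 / (4 * S)"
  have "\<forall>\<^sub>F L in at_top. \<bar>\<rho> L\<bar> \<le> C / L"
    using eventually_gt_at_top[of 0]
  proof eventually_elim
    case (elim L)
    have r: "0 \<le> r x" "r x \<le> 1 / (4 * x)" if "x > 0" for x
      using stirling_ln_Gamma_bounds[OF that] by (auto simp: r_def)
    have "0 \<le> (\<Sum>k\<in>I. r (L * A k))" using elim A_pos by (intro sum_nonneg r) auto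
    moreover have "(\<Sum>k\<in>I. r (L * A k)) \<le> (\<Sum>k\<in>I. 1 / (4 * (L * A k)))"
      using elim A_pos by (intro sum_mono r) auto
    moreover have "0 \<le> r (L * S)" "r (L * S) \<le> 1 / (4 * (L * S))" using elim S_pos by (auto intro!: r)
    moreover have "C / L = (\<Sum>k\<in>I. 1 / (4 * (L * A k))) + 1 / (4 * (L * S))"
      unfolding C_def by (simp add: add_divide_distrib sum_divide_distrib mult_ac)
    moreover have "0 \<le> (\<Sum>k\<in>I. 1 / (4 * (L * A k)))" using elim A_pos by (intro sum_nonneg) (auto intro: less_imp_le)
    moreover have "0 \<le> 1 / (4 * (L * S))" using elim S_pos by simp
    ultimately show ?case by (simp add: \<rho>_def abs_le_iff)
  qed
  hence "(\<lambda>L. exp (\<rho> L) - 1) \<in> O(\<lambda>L. 1 / L)" by (rule exp_minus_one_in_bigo)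
  moreover have "\<forall>\<^sub>F L in at_top. exp (\<rho> L) - 1 = D L / (d * L powr (- (1 + real (card I)) / 2)) - 1"
    using eventually_gt_at_top[of 0]
  proof eventually_elim
    case (elim L)
    have LS: "L * S > 0" and LA: "\<And>k. k \<in> I \<Longrightarrow> L * A k > 0" using elim S_pos A_pos by auto
    have sA: "(\<Sum>k\<in>I. A k) = S" by (simp add: S_def)
    have "ln (D L) = (\<Sum>k\<in>I. L * A k * c k) + ln (\<Prod>k\<in>I. Gamma (L * A k)) - ln (Gamma (1 + L * S))"
    proof -
      have "(\<Prod>k\<in>I. Gamma (L * A k)) > 0" using LA by (intro prod_pos Gamma_real_pos) auto
      moreover have "Gamma (1 + L * S) > 0" using LS by (intro Gamma_real_pos) simp
      ultimately show ?thesis unfolding D_def by (simp add: ln_divide_pos ln_mult_pos)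
    qed
    also have "ln (\<Prod>k\<in>I. Gamma (L * A k)) = (\<Sum>k\<in>I. stirling_ln (L * A k) + r (L * A k))"
    proof -
      have "Gamma (L * A k) \<noteq> 0" if "k \<in> I" for k using Gamma_real_pos[OF LA[OF that]] by simp
      thus ?thesis using LA finite_I by (subst ln_prod) (auto simp: r_def ln_Gamma_real_pos)
    qed
    also have "ln (Gamma (1 + L * S)) = stirling_ln (L * S) + r (L * S) + ln (L * S)"
      using ln_Gamma_plus1_real[OF LS] LS by (simp add: r_def ln_Gamma_real_pos[of "1 + L * S"] add.commute)
    finally have lnD: "ln (D L) = (\<Sum>k\<in>I. L * A k * c k + stirling_ln (L * A k)) - stirling_ln (L * S) - ln (L * S) + \<rho> L"
      by (simp add: \<rho>_def sum.distrib)
    \<comment> \<open>The choice \<open>c k = ln S - ln (A k)\<close> removes the term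
      \<open>L * A k * ln (A k)\<close>, so what remains at order \<open>L\<close> is proportional
      to \<open>A k\<close> and can be summed to \<open>S\<close>.\<close>
    have "L * A k * c k + stirling_ln (L * A k) =
        A k * (L * ln S + L * ln L - L) - (ln L - ln (2 * pi)) / 2 - ln (A k) / 2" if k: "k \<in> I" for k
    proof -
      have ck: "c k = ln S - ln (A k)" unfolding c_def using S_pos A_pos[OF k] by (simp add: ln_divide_pos)
      have lnLA: "ln (L * A k) = ln L + ln (A k)" using elim A_pos[OF k] by (simp add: ln_mult_pos)
      show ?thesis unfolding stirling_ln_def ck lnLA by (simp add: algebra_simps diff_divide_distrib)
    qed
    hence "(\<Sum>k\<in>I. L * A k * c k + stirling_ln (L * A k)) =
       (\<Sum>k\<in>I. A k * (L * ln S + L * ln L - L) - (ln L - ln (2 * pi)) / 2 - ln (A k) / 2)"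
      by (intro sum.cong) auto
    also have "\<dots> = S * (L * ln S + L * ln L - L) - n * ((ln L - ln (2 * pi)) / 2) - (\<Sum>k\<in>I. ln (A k)) / 2"
      by (simp add: sum_subtractf sum_distrib_right[symmetric] sA n_def sum_divide_distrib)
    finally have e1: "(\<Sum>k\<in>I. L * A k * c k + stirling_ln (L * A k)) =
       S * (L * ln S + L * ln L - L) - n * ((ln L - ln (2 * pi)) / 2) - (\<Sum>k\<in>I. ln (A k)) / 2" .
    have "ln (L * S) = ln L + ln S" using elim S_pos by (simp add: ln_mult_pos)
    hence e2: "ln (D L) = - (1 + n) / 2 * ln L + ((n - 1) / 2 * ln (2 * pi) - ln S / 2 - (\<Sum>k\<in>I. ln (A k)) / 2) + \<rho> L"
      unfolding lnD e1 unfolding stirling_ln_def by (simp add: field_simps)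
    have "ln d = (n - 1) / 2 * ln (2 * pi) - ln (sqrt S * sqrt (\<Prod>k\<in>I. A k))"
      unfolding d_def n_def using S_pos prod_A_pos by (subst ln_divide_pos) (auto simp: ln_powr)
    also have "ln (sqrt S * sqrt (\<Prod>k\<in>I. A k)) = ln S / 2 + ln (\<Prod>k\<in>I. A k) / 2"
      using S_pos prod_A_pos by (subst ln_mult_pos) (auto simp: ln_sqrt)
    also have "ln (\<Prod>k\<in>I. A k) = (\<Sum>k\<in>I. ln (A k))"
      using A_pos[THEN less_imp_neq[THEN not_sym]] A_pos finite_I by (intro ln_prod) auto
    finally have e3: "ln d = (n - 1) / 2 * ln (2 * pi) - (ln S / 2 + (\<Sum>k\<in>I. ln (A k)) / 2)" .
    have "D L = exp (- (1 + n) / 2 * ln L + ln d + \<rho> L)"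
      using D_pos[OF elim] e2 e3 by (metis (no_types, lifting) diff_diff_eq exp_ln)
    also have "\<dots> = d * L powr (- (1 + n) / 2) * exp (\<rho> L)"
      using elim d_pos by (simp add: exp_add powr_def)
    finally show ?case using elim d_pos by (simp add: n_def)
  qed
  ultimately show ?thesis by (rule landau_o.big.in_cong[THEN iffD1, rotated])
qed

lemma prob_asymp: "(\<lambda>L. enn2real (prob L) / main L - 1) \<in> O(\<lambda>L. 1 / L)"
proof -
  have "(\<lambda>L. 1 / g0 * (rest L / D L - g0)) \<in> O(\<lambda>L. 1 / L)"
    using rest_asymp g0_pos by (subst landau_o.big.cmult_in_iff) auto
  hence "(\<lambda>L. rest L / D L / g0 - 1) \<in> O(\<lambda>L. 1 / L)"
    using g0_pos by (simp add: right_diff_distrib mult.commute)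
  from asymp_one_mult[OF D_asymp this]
  have "(\<lambda>L. D L / (d * L powr (- (1 + real (card I)) / 2)) * (rest L / D L / g0) - 1) \<in> O(\<lambda>L. 1 / L)" .
  moreover have "\<forall>\<^sub>F L in at_top. D L / (d * L powr (- (1 + real (card I)) / 2)) * (rest L / D L / g0) - 1 =
      enn2real (prob L) / main L - 1"
    using eventually_gt_at_top[of 0]
  proof eventually_elim
    case (elim L)
    have "rest L \<ge> 0" unfolding rest_def using g_bounds
      by (auto intro!: integral_nonneg mult_nonneg_nonneg simp: h_def simplex_ind_def less_imp_le)
    hence "enn2real (prob L) = norm_const * exp (- (1/2) * S * L\<^sup>2 - L * \<beta>) * rest L"
      using norm_const_pos by (simp add: prob_eq[OF elim])
    also have "exp (- (1/2) * S * L\<^sup>2 - L * \<beta>) = exp (- L * \<beta>) * exp (- (1/2) * S * L\<^sup>2)"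
      by (simp add: exp_add[symmetric])
    finally show ?case
      unfolding main_def using norm_const_pos d_pos g0_pos D_pos[OF elim] by (simp add: divide_simps)
  qed
  ultimately show ?thesis by (rule landau_o.big.in_cong[THEN iffD1, rotated])
qed

text \<open>The shifted argument corresponds to the budget \<open>x * (1 - 1 / L\<^sup>2)\<close>.
  Giving up that share of the budget changes the probability only by a relative
  \<open>O(1 / L)\<close>.\<close>

lemma prob_shift_asymp:
  "(\<lambda>L. enn2real (prob (L - ln (1 - 1 / L\<^sup>2))) / main L - 1) \<in> O(\<lambda>L. 1 / L)"
proof -
  define L' where "L' L = L - ln (1 - 1 / L\<^sup>2)" for L :: real
  have "(\<lambda>L. enn2real (prob (L' L)) / main (L' L) - 1) \<in> O(\<lambda>L. 1 / L' L)"
    using landau_o.big.compose[OF prob_asymp shift_filterlim] by (simp add: L'_def)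
  also have "(\<lambda>L. 1 / L' L) \<in> O(\<lambda>L. 1 / L)" using shift_inverse_bigo by (simp add: L'_def)
  finally have 1: "(\<lambda>L. enn2real (prob (L' L)) / main (L' L) - 1) \<in> O(\<lambda>L. 1 / L)" .
  define a where "a = - (1 + real (card I)) / 2"
  have 2: "(\<lambda>L. (L' L / L) powr a * exp (\<beta> * ln (1 - 1 / L\<^sup>2) - S / 2 * ((L' L)\<^sup>2 - L\<^sup>2)) - 1) \<in> O(\<lambda>L. 1 / L)"
    using shifted_main_ratio[OF S_pos, of a \<beta>] by (simp add: L'_def)
  have ev: "\<forall>\<^sub>F L in at_top. L' L > 0"
    using shift_filterlim unfolding L'_def filterlim_at_top_dense by blast
  have "\<forall>\<^sub>F L in at_top. enn2real (prob (L' L)) / main (L' L) *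
      ((L' L / L) powr a * exp (\<beta> * ln (1 - 1 / L\<^sup>2) - S / 2 * ((L' L)\<^sup>2 - L\<^sup>2))) - 1 =
      enn2real (prob (L' L)) / main L - 1"
    using ev eventually_gt_at_top[of 0]
  proof eventually_elim
    case (elim L)
    have l: "ln (1 - 1 / L\<^sup>2) = L - L' L" by (simp add: L'_def)
    have "exp (- L' L * \<beta>) * exp (- (1/2) * S * (L' L)\<^sup>2) =
       exp (- L * \<beta>) * exp (- (1/2) * S * L\<^sup>2) * exp (\<beta> * ln (1 - 1 / L\<^sup>2) - S / 2 * ((L' L)\<^sup>2 - L\<^sup>2))"
      unfolding exp_add[symmetric] l by (simp add: algebra_simps)
    moreover have "L' L powr a = L powr a * (L' L / L) powr a"
      using elim by (simp add: powr_divide)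
    ultimately have e: "main (L' L) = main L * ((L' L / L) powr a * exp (\<beta> * ln (1 - 1 / L\<^sup>2) - S / 2 * ((L' L)\<^sup>2 - L\<^sup>2)))"
      unfolding main_def a_def[symmetric] by (simp add: mult_ac)
    define X where "X = (L' L / L) powr a * exp (\<beta> * ln (1 - 1 / L\<^sup>2) - S / 2 * ((L' L)\<^sup>2 - L\<^sup>2))"
    have "X > 0" using elim by (simp add: X_def)
    thus ?case unfolding e X_def[symmetric] by simp
  qed
  with asymp_one_mult[OF 1 2] show ?thesis
    unfolding L'_def by (rule landau_o.big.in_cong[THEN iffD1, rotated])
qed

text \<open>The leading term is \<open>exp (- S * L\<^sup>2 / 2)\<close> up to factors
  \<open>exp (O(L))\<close>, so any surplus \<open>\<kappa>\<close> in the quadratic exponent makes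
  the quotient negligible.\<close>

lemma decay_over_main:
  assumes "\<kappa> > 0"
  shows "(\<lambda>L. exp (- (S / 2 + \<kappa>) * L\<^sup>2 + b * L + e * (L * ln L)) / main L) \<in> O(\<lambda>L. 1 / L)"
proof -
  define N where "N = norm_const * d * g0"
  have N: "N > 0" using norm_const_pos d_pos g0_pos by (simp add: N_def)
  define a where "a = (1 + real (card I)) / 2"
  have "(\<lambda>L. 1 / N * exp (- \<kappa> * L\<^sup>2 + (b + \<beta>) * L + a * ln L + e * (L * ln L))) \<in> O(\<lambda>L. 1 / L)"
    using quadratic_decay_bigo[OF assms, of "b + \<beta>" a e] N by (subst landau_o.big.cmult_in_iff) auto
  moreover have "\<forall>\<^sub>F L in at_top. 1 / N * exp (- \<kappa> * L\<^sup>2 + (b + \<beta>) * L + a * ln L + e * (L * ln L)) =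
      exp (- (S / 2 + \<kappa>) * L\<^sup>2 + b * L + e * (L * ln L)) / main L"
    using eventually_gt_at_top[of 0]
  proof eventually_elim
    case (elim L)
    have "- (1 + real (card I)) / 2 = - a" unfolding a_def by linarith
    moreover have "exp (- a * ln L - L * \<beta> - (1/2) * S * L\<^sup>2) = L powr (- a) * exp (- L * \<beta>) * exp (- (1/2) * S * L\<^sup>2)"
      using elim by (simp add: powr_def exp_add[symmetric])
    ultimately have "main L = N * exp (- a * ln L - L * \<beta> - (1/2) * S * L\<^sup>2)"
      unfolding main_def N_def by (simp add: mult.assoc)
    moreover have "exp (- (S / 2 + \<kappa>) * L\<^sup>2 + b * L + e * (L * ln L)) =
       exp (- \<kappa> * L\<^sup>2 + (b + \<beta>) * L + a * ln L + e * (L * ln L)) * exp (- a * ln L - L * \<beta> - (1/2) * S * L\<^sup>2)"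
      unfolding exp_add[symmetric] by (simp add: algebra_simps)
    ultimately show ?case using N by simp
  qed
  ultimately show ?thesis by (rule landau_o.big.in_cong[THEN iffD1, rotated])
qed

end

section \<open>Coordinates off the support\<close>

text \<open>Moving from \<open>w\<close> towards a vertex stays in the simplex, so the directional
  derivative there is nonnegative, which is \<open>mat_vec_on {..<n} B w i \<ge> s\<close>. The
  \<open>w\<close>-weighted average of these nonnegative gaps is zero, so each gap vanishes where
  \<open>w i \<noteq> 0\<close>.\<close>

lemma simplex_minimizer_kkt:
  fixes n :: nat and w :: "nat \<Rightarrow> real" and B :: "nat \<Rightarrow> nat \<Rightarrow> real"
  assumes pd: "posdef_on {..<n} B" and w: "w \<in> std_simplex n"
    and min: "\<forall>v\<in>std_simplex n. quad_form {..<n} B w w \<le> quad_form {..<n} B v v"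
  defines "s \<equiv> quad_form {..<n} B w w"
  shows "s > 0"
    and "\<And>i. i < n \<Longrightarrow> quad_form {..<n} B (\<lambda>k. (if k = i then 1 else 0) - w k) w = mat_vec_on {..<n} B w i - s"
    and "\<And>i. i < n \<Longrightarrow> mat_vec_on {..<n} B w i \<ge> s"
    and "\<And>i. i < n \<Longrightarrow> w i \<noteq> 0 \<Longrightarrow> mat_vec_on {..<n} B w i = s"
proof -
  have w0: "\<And>i. i < n \<Longrightarrow> w i \<ge> 0" and w1: "(\<Sum>i<n. w i) = 1" using w by (auto simp: std_simplex_def)
  have "\<exists>i<n. w i \<noteq> 0"
  proof (rule ccontr)
    assume "\<not> (\<exists>i<n. w i \<noteq> 0)"
    hence "(\<Sum>i<n. w i) = 0" by simp
    thus False using w1 by simp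
  qed
  thus "s > 0" using posdef_onD(4)[OF pd, of _ w] unfolding s_def by auto
  show eq: "quad_form {..<n} B (\<lambda>k. (if k = i then 1 else 0) - w k) w = mat_vec_on {..<n} B w i - s" if "i < n" for i
  proof -
    have "(\<Sum>k<n. ((if k = i then 1 else 0) - w k) * mat_vec_on {..<n} B w k) =
       (\<Sum>k<n. if k = i then mat_vec_on {..<n} B w i else 0) - (\<Sum>k<n. w k * mat_vec_on {..<n} B w k)"
      unfolding sum_subtractf[symmetric] by (intro sum.cong) (auto simp: left_diff_distrib)
    thus ?thesis unfolding s_def quad_form_mat_vec using that by simp
  qed
  show ge: "mat_vec_on {..<n} B w i \<ge> s" if i: "i < n" for i
  proof -
    define e where "e k = (if k = i then 1 else 0) - w k" for k
    define a where "a = quad_form {..<n} B e w"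
    define b where "b = quad_form {..<n} B e e"
    have b0: "b \<ge> 0" unfolding b_def by (rule posdef_onD(5)[OF pd])
    have line: "0 \<le> 2 * t * a + t\<^sup>2 * b" if t: "0 \<le> t" "t \<le> 1" for t
    proof -
      have "(\<lambda>k. w k + t * e k) \<in> std_simplex n"
        unfolding std_simplex_def
      proof safe
        fix k assume "k < n"
        have "w k + t * e k = (1 - t) * w k + t * (if k = i then 1 else 0)" by (simp add: e_def algebra_simps)
        thus "0 \<le> w k + t * e k" using t w0[OF \<open>k < n\<close>] by simp
      next
        have "(\<Sum>k<n. e k) = 0" unfolding e_def using w1 i by (simp add: sum_subtractf)
        thus "(\<Sum>k<n. w k + t * e k) = 1" using w1 by (simp add: sum.distrib sum_distrib_left[symmetric])
      qed
      from bspec[OF min this] have "s \<le> s + 2 * t * a + t\<^sup>2 * b"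
        using quad_form_line[of "{..<n}" B w t e] posdef_onD(2)[OF pd] by (simp add: s_def a_def b_def)
      thus ?thesis by simp
    qed
    have "a \<ge> 0"
    proof (rule ccontr)
      assume "\<not> a \<ge> 0"
      hence a: "a < 0" by simp
      \<comment> \<open>The cap at one keeps the point in the simplex, \<open>b + 1\<close> avoids a
        division by zero, and \<open>t * b \<le> - a\<close> makes \<open>2 * a + t * b\<close>
        negative.\<close>
      define t where "t = min 1 (- a / (b + 1))"
      have t: "0 < t" "t \<le> 1" "t \<le> - a / (b + 1)" using divide_pos_pos[of "- a" "b + 1"] a b0 by (auto simp: t_def)
      have "t * b \<le> t * (b + 1)" using t by simp
      also have "\<dots> \<le> - a" using mult_right_mono[OF t(3), of "b + 1"] b0 by simp
      finally have "2 * a + t * b < 0" using a by linarith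
      hence "t * (2 * a + t * b) < 0" using t by (simp add: mult_pos_neg)
      thus False using line[of t] t by (simp add: algebra_simps power2_eq_square)
    qed
    thus ?thesis using eq[OF i] by (simp add: a_def e_def[abs_def])
  qed
  show "mat_vec_on {..<n} B w i = s" if i: "i < n" "w i \<noteq> 0" for i
  proof -
    have "(\<Sum>k<n. w k * (mat_vec_on {..<n} B w k - s)) = 0"
      using w1 by (simp add: right_diff_distrib sum_subtractf sum_distrib_right[symmetric] s_def quad_form_mat_vec)
    moreover have "w k * (mat_vec_on {..<n} B w k - s) \<ge> 0" if "k < n" for k
      using w0[OF that] ge[OF that] by simp
    ultimately have "w i * (mat_vec_on {..<n} B w i - s) = 0"
      using i(1) by (subst (asm) sum_nonneg_eq_0_iff) auto
    thus ?thesis using i by simp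
  qed
qed

text \<open>On the support the image of \<open>w\<close> under \<open>B\<close> is the constant
  \<open>s\<close>, and \<open>w\<close> vanishes off the support; inverting on \<open>I\<close>
  shows that \<open>w / s\<close> is the vector of row sums of the inverse.\<close>

lemma simplex_minimizer_row_sums:
  fixes n :: nat and w :: "nat \<Rightarrow> real" and B :: "nat \<Rightarrow> nat \<Rightarrow> real"
  assumes pd: "posdef_on {..<n} B" and w: "w \<in> std_simplex n"
    and min: "\<forall>v\<in>std_simplex n. quad_form {..<n} B w w \<le> quad_form {..<n} B v v"
  defines "s \<equiv> quad_form {..<n} B w w" and "I \<equiv> {i. i < n \<and> w i \<noteq> 0}"
  shows "\<And>k. k \<in> I \<Longrightarrow> (\<Sum>j\<in>I. inv_on I B k j) = w k / s"
    and "(\<Sum>k\<in>I. \<Sum>j\<in>I. inv_on I B k j) = 1 / s"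
proof -
  note kkt = simplex_minimizer_kkt[OF pd w min, folded s_def]
  have I: "I \<subseteq> {..<n}" by (auto simp: I_def)
  have pdI: "posdef_on I B" by (rule posdef_on_subset[OF pd I])
  have BI: "mat_vec_on I B w k = s" if "k \<in> I" for k
  proof -
    have "mat_vec_on I B w k = mat_vec_on {..<n} B w k"
      unfolding mat_vec_on_def using I by (intro sum.mono_neutral_left) (auto simp: I_def)
    thus ?thesis using kkt(4)[of k] that by (simp add: I_def)
  qed
  show row: "(\<Sum>j\<in>I. inv_on I B k j) = w k / s" if k: "k \<in> I" for k
  proof -
    have "w k = mat_vec_on I (inv_on I B) (mat_vec_on I B w) k"
      using posdef_onD(1)[OF pdI] k posdef_on_inv(4)[OF pdI k] by (intro mat_vec_on_cancel[symmetric]) auto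
    also have "\<dots> = (\<Sum>j\<in>I. inv_on I B k j) * s"
      unfolding mat_vec_on_def[of I "inv_on I B"] sum_distrib_right using BI by (intro sum.cong) auto
    finally show ?thesis using kkt(1) by (simp add: field_simps)
  qed
  have "(\<Sum>k\<in>I. w k) = (\<Sum>k<n. w k)"
    using I by (intro sum.mono_neutral_left) (auto simp: I_def)
  also have "\<dots> = 1" using w by (simp add: std_simplex_def)
  finally show "(\<Sum>k\<in>I. \<Sum>j\<in>I. inv_on I B k j) = 1 / s"
    using row by (simp add: sum_divide_distrib[symmetric])
qed

text \<open>Chernoff bound with the tilt \<open>-(L / s) w + \<eta> L e\<^sub>i\<close>. The first summand alone already gives the factor
  \<open>exp (-L\<^sup>2 / (2 s))\<close>; since coordinate \<open>i\<close> is typically below \<open>-L (Bw)\<^sub>i / s\<close> on the simplex event and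
  \<open>(Bw)\<^sub>i > s\<close>, a small second summand yields an additional Gaussian gain.\<close>

lemma gauss_dens_tail_bound:
  fixes n :: nat and w :: "nat \<Rightarrow> real" and B :: "nat \<Rightarrow> nat \<Rightarrow> real"
  assumes pd: "posdef_on {..<n} B" and w: "w \<in> std_simplex n" and i: "i < n"
    and I: "I = {i. i < n \<and> w i \<noteq> 0}"
  defines "s \<equiv> quad_form {..<n} B w w"
  assumes gap: "mat_vec_on {..<n} B w i > s" and s: "s > 0"
  shows "\<exists>\<kappa>>0. \<exists>b e. \<forall>L>0. \<forall>q.
    (\<integral>\<^sup>+ y. indicator {y. (\<Sum>k\<in>I. exp (y k)) \<le> exp (- L) \<and> y i > - L - 2 * ln L - q} y *
       ennreal (gauss_dens {..<n} \<mu> B y) \<partial>PiM {..<n} (\<lambda>_. lborel))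
     \<le> ennreal (exp (- (1 / 2 / s + \<kappa>) * L\<^sup>2 + (b + e * q) * L + 2 * e * (L * ln L)))"
proof -
  define r where "r = mat_vec_on {..<n} B w i / s - 1"
  define \<beta> where "\<beta> = B i i"
  \<comment> \<open>As a function of \<open>\<eta>\<close> the coefficient of \<open>L^2\<close> in
    the Chernoff exponent is \<open>- 1 / (2 * s) - \<eta> * r + \<eta>^2 * \<beta> / 2\<close>.
    This \<open>\<eta>\<close> minimizes it, and the gain is
    \<open>\<kappa> = r^2 / (2 * \<beta>)\<close>.\<close>
  define \<eta> where "\<eta> = r / \<beta>"
  define \<kappa> where "\<kappa> = r\<^sup>2 / (2 * \<beta>)"
  define u where "u k = (if k = i then 1 else 0 :: real)" for k
  define b where "b = - (\<Sum>k<n. w k * \<mu> k) / s + \<eta> * \<mu> i"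
  have r: "r > 0" using gap s by (simp add: r_def)
  have \<beta>: "\<beta> > 0"
    using posdef_onD(4)[OF pd, of i u] i quad_form_unit[of "{..<n}" i B] by (simp add: u_def[abs_def] \<beta>_def)
  have \<eta>: "\<eta> > 0" using r \<beta> by (simp add: \<eta>_def)
  have \<kappa>: "\<kappa> > 0" using r \<beta> by (simp add: \<kappa>_def)
  have w0: "\<And>i. i < n \<Longrightarrow> w i \<ge> 0" and w1: "(\<Sum>i<n. w i) = 1" using w by (auto simp: std_simplex_def)
  have bound: "(\<integral>\<^sup>+ y. indicator {y. (\<Sum>k\<in>I. exp (y k)) \<le> exp (- L) \<and> y i > - L - 2 * ln L - q} y *
       ennreal (gauss_dens {..<n} \<mu> B y) \<partial>PiM {..<n} (\<lambda>_. lborel))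
     \<le> ennreal (exp (- (1 / 2 / s + \<kappa>) * L\<^sup>2 + (b + \<eta> * q) * L + 2 * \<eta> * (L * ln L)))"
    (is "?lhs \<le> _") if L: "L > 0" for L q
  proof -
    \<comment> \<open>On the event, \<open>\<Sum>k<n. w k * y k\<close> is at most
      \<open>- L\<close> and \<open>y i\<close> exceeds its threshold, so with this constant
      \<open>c + (\<Sum>k<n. t k * y k)\<close> is nonnegative and the indicator lies below the
      exponential.\<close>
    define c where "c = - (L / s) * L + \<eta> * L * (L + 2 * ln L + q)"
    define t where "t k = - (L / s) * w k + \<eta> * L * u k" for k
    have lin: "(\<Sum>k<n. t k * f k) = - (L / s) * (\<Sum>k<n. w k * f k) + \<eta> * L * f i" for f
    proof -
      have "(\<Sum>k<n. u k * f k) = f i" unfolding u_def using i by (simp add: if_distrib[of "\<lambda>x. x * _"] cong: if_cong)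
      moreover have "(\<Sum>k<n. t k * f k) = - (L / s) * (\<Sum>k<n. w k * f k) + \<eta> * L * (\<Sum>k<n. u k * f k)"
        unfolding sum_distrib_left sum.distrib[symmetric] by (intro sum.cong) (auto simp: t_def algebra_simps)
      ultimately show ?thesis by simp
    qed
    have [measurable]: "gauss_dens {..<n} \<mu> B \<in> borel_measurable (PiM {..<n} (\<lambda>_. lborel))"
      by (rule gauss_dens_measurable) simp
    have [measurable]: "(\<lambda>y. \<Sum>k<n. t k * y k) \<in> borel_measurable (PiM {..<n} (\<lambda>_. lborel :: real measure))"
      by (rule borel_measurable_sum_PiM) auto
    have "?lhs \<le> (\<integral>\<^sup>+ y. ennreal (exp c) * (ennreal (exp (\<Sum>k<n. t k * y k)) * ennreal (gauss_dens {..<n} \<mu> B y)) \<partial>PiM {..<n} (\<lambda>_. lborel))"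
    proof (intro nn_integral_mono)
      fix y :: "nat \<Rightarrow> real"
      show "indicator {y. (\<Sum>k\<in>I. exp (y k)) \<le> exp (- L) \<and> y i > - L - 2 * ln L - q} y * ennreal (gauss_dens {..<n} \<mu> B y)
        \<le> ennreal (exp c) * (ennreal (exp (\<Sum>k<n. t k * y k)) * ennreal (gauss_dens {..<n} \<mu> B y))"
      proof (cases "(\<Sum>k\<in>I. exp (y k)) \<le> exp (- L) \<and> y i > - L - 2 * ln L - q")
        case True
        have yk: "y k \<le> - L" if "k \<in> I" for k
        proof -
          have "exp (y k) \<le> (\<Sum>k\<in>I. exp (y k))" using that by (intro member_le_sum) (auto simp: I)
          thus ?thesis using True by (metis exp_le_cancel_iff order_trans)
        qed
        have "(\<Sum>k<n. w k * y k) \<le> (\<Sum>k<n. w k * (- L))"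
        proof (intro sum_mono)
          fix k assume "k \<in> {..<n}"
          thus "w k * y k \<le> w k * (- L)"
            using mult_left_mono[OF yk[of k] w0[of k]] by (cases "w k = 0") (auto simp: I)
        qed
        also have "\<dots> = - L" using w1 by (simp add: sum_distrib_right[symmetric] sum_negf)
        finally have "- (L / s) * (\<Sum>k<n. w k * y k) \<ge> (L / s) * L"
          using mult_left_mono[of "\<Sum>k<n. w k * y k" "- L" "L / s"] L s by simp
        moreover have "\<eta> * L * y i \<ge> \<eta> * L * (- L - 2 * ln L - q)"
          using True \<eta> L by (intro mult_left_mono) auto
        ultimately have "c + (\<Sum>k<n. t k * y k) \<ge> 0" unfolding lin c_def by (simp add: algebra_simps)
        hence "1 \<le> exp c * exp (\<Sum>k<n. t k * y k)" unfolding exp_add[symmetric] by simp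
        hence "ennreal 1 * ennreal (gauss_dens {..<n} \<mu> B y) \<le>
           ennreal (exp c * exp (\<Sum>k<n. t k * y k)) * ennreal (gauss_dens {..<n} \<mu> B y)"
          by (intro mult_right_mono ennreal_leI) auto
        thus ?thesis using True by (simp add: ennreal_mult mult.assoc)
      qed simp
    qed
    also have "\<dots> = ennreal (exp c) * ennreal (exp ((\<Sum>k<n. t k * \<mu> k) + quad_form {..<n} B t t / 2))"
      by (subst nn_integral_cmult) (auto simp: gauss_dens_mgf[OF pd, of t \<mu>])
    also have "\<dots> = ennreal (exp (c + ((\<Sum>k<n. t k * \<mu> k) + quad_form {..<n} B t t / 2)))"
      by (simp add: ennreal_mult[symmetric] exp_add)
    also have "c + ((\<Sum>k<n. t k * \<mu> k) + quad_form {..<n} B t t / 2) =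
        - (1 / 2 / s + \<kappa>) * L\<^sup>2 + (b + \<eta> * q) * L + 2 * \<eta> * (L * ln L)"
    proof -
      have ww: "quad_form {..<n} B (\<lambda>k. - (L / s) * w k) (\<lambda>k. - (L / s) * w k) = (L / s)\<^sup>2 * s"
        unfolding s_def quad_form_def sum_distrib_left by (intro sum.cong refl) (simp add: power2_eq_square)
      have uw: "quad_form {..<n} B u (\<lambda>k. - (L / s) * w k) = - (L / s) * (s * (r + 1))"
      proof -
        have "quad_form {..<n} B u (\<lambda>k. - (L / s) * w k) = mat_vec_on {..<n} B (\<lambda>k. - (L / s) * w k) i"
          unfolding quad_form_mat_vec u_def using i by (simp add: if_distrib[of "\<lambda>x. x * _"] cong: if_cong)
        also have "\<dots> = - (L / s) * mat_vec_on {..<n} B w i"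
          unfolding mat_vec_on_def sum_distrib_left by (intro sum.cong) auto
        also have "mat_vec_on {..<n} B w i = s * (r + 1)" using s by (simp add: r_def)
        finally show ?thesis .
      qed
      have uu: "quad_form {..<n} B u u = \<beta>"
        unfolding u_def[abs_def] \<beta>_def using i by (intro quad_form_unit) auto
      have "quad_form {..<n} B t t = (L / s)\<^sup>2 * s + 2 * (\<eta> * L) * (- (L / s) * (s * (r + 1))) + (\<eta> * L)\<^sup>2 * \<beta>"
        unfolding t_def[abs_def] using quad_form_line[of "{..<n}" B "\<lambda>k. - (L / s) * w k" "\<eta> * L" u] posdef_onD(2)[OF pd]
        by (simp only: ww uw uu) simp
      also have "\<dots> = L\<^sup>2 / s - 2 * \<eta> * L\<^sup>2 * (r + 1) + \<eta>\<^sup>2 * \<beta> * L\<^sup>2"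
        using s by (simp add: power2_eq_square)
      also have "\<eta>\<^sup>2 * \<beta> = \<eta> * r" using \<beta> by (simp add: \<eta>_def power2_eq_square)
      finally have q: "quad_form {..<n} B t t = L\<^sup>2 / s - 2 * \<eta> * L\<^sup>2 * (r + 1) + \<eta> * r * L\<^sup>2" .
      have k: "\<kappa> = \<eta> * r / 2" by (simp add: \<kappa>_def \<eta>_def power2_eq_square)
      show ?thesis
        unfolding q lin c_def b_def k by (simp add: algebra_simps power2_eq_square add_divide_distrib diff_divide_distrib)
    qed
    finally show ?thesis .
  qed
  thus ?thesis using \<kappa> by blast
qed

lemma distributed_emeasure_Collect:
  assumes "distributed M N Y f" "{y \<in> space N. P y} \<in> sets N"
  shows "emeasure M {\<omega> \<in> space M. P (Y \<omega>)} = (\<integral>\<^sup>+ y. indicator {y. P y} y * f y \<partial>N)"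
proof -
  have "Y \<in> measurable M N" using assms(1) by (rule distributed_measurable)
  hence "{\<omega> \<in> space M. P (Y \<omega>)} = Y -` {y \<in> space N. P y} \<inter> space M"
    by (auto dest: measurable_space)
  also have "emeasure M \<dots> = (\<integral>\<^sup>+ y. f y * indicator {y \<in> space N. P y} y \<partial>N)"
    by (rule distributed_emeasure[OF assms])
  also have "\<dots> = (\<integral>\<^sup>+ y. indicator {y. P y} y * f y \<partial>N)"
    by (intro nn_integral_cong) (auto simp: indicator_def)
  finally show ?thesis .
qed

text \<open>Splitting the simplex budget: the support coordinates receive the share \<open>1 - 1 / L\<^sup>2\<close>, the others \<open>1 / (n L\<^sup>2)\<close> each.\<close>

lemma exp_sum_split:
  fixes y :: "nat \<Rightarrow> real" and L :: real
  assumes L: "L > 1" and n: "n > 0" and I: "I \<subseteq> {..<n}"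
    and le: "(\<Sum>k\<in>I. exp (y k)) \<le> exp (- (L - ln (1 - 1 / L\<^sup>2)))"
    and small: "\<And>i. i < n \<Longrightarrow> i \<notin> I \<Longrightarrow> y i \<le> - L - 2 * ln L - ln (real n)"
  shows "(\<Sum>k<n. exp (y k)) \<le> exp (- L)"
proof -
  have L2: "1 / L\<^sup>2 < 1" using L by (simp add: power_strict_mono[of 1 L 2, simplified])
  have "exp (y i) \<le> exp (- L) / (L\<^sup>2 * real n)" if "i \<in> {..<n} - I" for i
  proof -
    have "exp (y i) \<le> exp (- L - 2 * ln L - ln (real n))" using small[of i] that by simp
    also have "\<dots> = exp (- L) / (exp (ln L) * exp (ln L) * exp (ln (real n)))"
      by (simp add: exp_diff exp_add[symmetric])
    also have "\<dots> = exp (- L) / (L\<^sup>2 * real n)" using L n by (simp add: power2_eq_square)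
    finally show ?thesis .
  qed
  hence "(\<Sum>k\<in>{..<n} - I. exp (y k)) \<le> real (card ({..<n} - I)) * (exp (- L) / (L\<^sup>2 * real n))"
    by (rule sum_bounded_above)
  also have "\<dots> \<le> real n * (exp (- L) / (L\<^sup>2 * real n))"
    using card_mono[of "{..<n}" "{..<n} - I"] n by (intro mult_right_mono) auto
  also have "\<dots> = exp (- L) * (1 / L\<^sup>2)" using n by simp
  finally have 1: "(\<Sum>k\<in>{..<n} - I. exp (y k)) \<le> exp (- L) * (1 / L\<^sup>2)" .
  have "exp (- (L - ln (1 - 1 / L\<^sup>2))) = exp (- L) * exp (ln (1 - 1 / L\<^sup>2))"
    by (simp add: exp_add[symmetric])
  also have "exp (ln (1 - 1 / L\<^sup>2)) = 1 - 1 / L\<^sup>2" using L2 by (intro exp_ln) linarith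
  finally have 2: "(\<Sum>k\<in>I. exp (y k)) \<le> exp (- L) * (1 - 1 / L\<^sup>2)" using le by simp
  have "(\<Sum>k<n. exp (y k)) = (\<Sum>k\<in>I. exp (y k)) + (\<Sum>k\<in>{..<n} - I. exp (y k))"
    using I by (subst sum.subset_diff[of I]) auto
  also have "\<dots> \<le> exp (- L) * (1 - 1 / L\<^sup>2) + exp (- L) * (1 / L\<^sup>2)" using 1 2 by (rule add_mono[rotated])
  also have "\<dots> = exp (- L)" by (simp add: algebra_simps)
  finally show ?thesis .
qed

section \<open>Probability estimates for the full sum and the explicit leading constant\<close>

context positive_row_sums
begin

text \<open>The event depends only on the coordinates in \<open>I\<close>, so the remaining ones
  integrate out and the marginal density is that of the submatrix of \<open>B\<close>.\<close>

lemma prob_eq_measure: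
  assumes "prob_space M" and pd: "posdef_on {..<n} B" and I: "I \<subseteq> {..<n}"
    and Y: "distributed M (lebesgue_n n) Y (\<lambda>y. ennreal (gaussian_density n \<mu> B y))"
  shows "measure M {\<omega> \<in> space M. (\<Sum>k\<in>I. exp (Y \<omega> k)) \<le> exp (- L)} = enn2real (prob L)"
proof -
  have "emeasure M {\<omega> \<in> space M. (\<Sum>k\<in>I. exp (Y \<omega> k)) \<le> exp (- L)} =
     (\<integral>\<^sup>+ y. indicator {y. (\<Sum>k\<in>I. exp (y k)) \<le> exp (- L)} y * ennreal (gauss_dens {..<n} \<mu> B y) \<partial>lebesgue_n n)"
    using distributed_emeasure_Collect[OF Y exp_sum_set_measurable[OF I]] by (simp add: gaussian_density_eq)
  also have "\<dots> = prob L"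
    unfolding prob_def
  proof (subst gauss_dens_marginal[OF pd I])
    fix K assume "I \<subseteq> K"
    hence [measurable]: "(\<lambda>y. \<Sum>i\<in>I. exp (y i)) \<in> borel_measurable (PiM K (\<lambda>_. lborel :: real measure))"
      by (intro borel_measurable_sum_PiM) auto
    show "(\<lambda>y. indicator {y. (\<Sum>k\<in>I. exp (y k)) \<le> exp (- L)} y :: ennreal) \<in> borel_measurable (PiM K (\<lambda>_. lborel))"
      by measurable
  next
    fix x :: "nat \<Rightarrow> real" and i t assume "i \<notin> I"
    hence "(\<Sum>k\<in>I. exp ((x(i := t)) k)) = (\<Sum>k\<in>I. exp (x k))" by (intro sum.cong) auto
    thus "indicator {y. (\<Sum>k\<in>I. exp (y k)) \<le> exp (- L)} (x(i := t)) =
      (indicator {y. (\<Sum>k\<in>I. exp (y k)) \<le> exp (- L)} x :: ennreal)" by (simp add: indicator_def)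
  qed (auto intro!: nn_integral_cong simp: simplex_ind_def indicator_def)
  finally show ?thesis by (simp add: measure_def)
qed

text \<open>Dropping the off-support summands gives the upper bound. For the lower bound, the
  support event with the reduced budget forces the full event unless some off-support coordinate
  exceeds its threshold, and each such tail event is negligible by the strict gap.\<close>

lemma sum_prob_asymp:
  fixes M :: "'a measure"
  assumes prob: "prob_space M" and n: "n > 0" and pd: "posdef_on {..<n} B"
    and Y: "distributed M (lebesgue_n n) Y (\<lambda>y. ennreal (gaussian_density n \<mu> B y))"
    and w: "w \<in> std_simplex n" and I: "I = {i. i < n \<and> w i \<noteq> 0}"
    and S: "S = 1 / quad_form {..<n} B w w" and pos: "quad_form {..<n} B w w > 0"
    and gap: "\<And>i. i < n \<Longrightarrow> i \<notin> I \<Longrightarrow> mat_vec_on {..<n} B w i > quad_form {..<n} B w w"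
  shows "(\<lambda>L. measure M {\<omega> \<in> space M. (\<Sum>i<n. exp (Y \<omega> i)) \<le> exp (- L)} / main L - 1) \<in> O(\<lambda>L. 1 / L)"
proof -
  interpret M: prob_space M by fact
  have In: "I \<subseteq> {..<n}" by (auto simp: I)
  define F where "F L = measure M {\<omega> \<in> space M. (\<Sum>i<n. exp (Y \<omega> i)) \<le> exp (- L)}" for L
  define G where "G L = measure M {\<omega> \<in> space M. (\<Sum>k\<in>I. exp (Y \<omega> k)) \<le> exp (- L)}" for L
  define tail where "tail i L = measure M {\<omega> \<in> space M. (\<Sum>k\<in>I. exp (Y \<omega> k)) \<le> exp (- L) \<and> Y \<omega> i > - L - 2 * ln L - ln (real n)}" for i L
  define L' where "L' L = L - ln (1 - 1 / L\<^sup>2)" for L :: real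
  have G: "G L = enn2real (prob L)" for L
    unfolding G_def by (rule prob_eq_measure[OF assms(1) pd In Y])
  have Ym: "Y \<in> measurable M (lebesgue_n n)" using Y by (rule distributed_measurable)
  have comp [measurable]: "(\<lambda>\<omega>. Y \<omega> i) \<in> borel_measurable M" if "i < n" for i
    using measurable_compose[OF Ym borel_measurable_PiM_component[of i "{..<n}"]] that by simp
  have sumI [measurable]: "(\<lambda>\<omega>. \<Sum>k\<in>I. exp (Y \<omega> k)) \<in> borel_measurable M"
    using In by (intro borel_measurable_sum measurable_compose[OF comp borel_measurable_exp]) auto
  have sumn [measurable]: "(\<lambda>\<omega>. \<Sum>k<n. exp (Y \<omega> k)) \<in> borel_measurable M"
    by (intro borel_measurable_sum measurable_compose[OF comp borel_measurable_exp]) auto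
  have upper: "F L \<le> G L" for L
    unfolding F_def G_def
  proof (intro M.finite_measure_mono)
    show "{\<omega> \<in> space M. (\<Sum>i<n. exp (Y \<omega> i)) \<le> exp (- L)} \<subseteq> {\<omega> \<in> space M. (\<Sum>k\<in>I. exp (Y \<omega> k)) \<le> exp (- L)}"
    proof safe
      fix \<omega> assume "(\<Sum>i<n. exp (Y \<omega> i)) \<le> exp (- L)"
      moreover have "(\<Sum>k\<in>I. exp (Y \<omega> k)) \<le> (\<Sum>i<n. exp (Y \<omega> i))" using In by (intro sum_mono2) auto
      ultimately show "(\<Sum>k\<in>I. exp (Y \<omega> k)) \<le> exp (- L)" by linarith
    qed
  qed measurable
  have lower: "G (L' L) - (\<Sum>i\<in>{..<n} - I. tail i L) \<le> F L" if L: "L > 1" for L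
  proof -
    define T where "T i = {\<omega> \<in> space M. (\<Sum>k\<in>I. exp (Y \<omega> k)) \<le> exp (- L) \<and> Y \<omega> i > - L - 2 * ln L - ln (real n)}" for i
    have Tm: "T i \<in> sets M" if "i < n" for i
    proof -
      note comp[OF that, measurable]
      show ?thesis unfolding T_def by measurable
    qed
    have Fm: "{\<omega> \<in> space M. (\<Sum>i<n. exp (Y \<omega> i)) \<le> exp (- L)} \<in> sets M" by measurable
    \<comment> \<open>The tail events \<open>T i\<close> are formulated with the full budget, so
      that the Chernoff bound applies at \<open>L\<close> itself; the reduced event has to imply
      that condition.\<close>
    have "exp (- (L' L)) \<le> exp (- L)"
    proof -
      have "0 < 1 - 1 / L\<^sup>2" using L by (simp add: power_strict_mono[of 1 L 2, simplified])
      hence "ln (1 - 1 / L\<^sup>2) \<le> (1 - 1 / L\<^sup>2) - 1" by (rule ln_le_minus_one)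
      also have "\<dots> \<le> 0" by simp
      finally have "ln (1 - 1 / L\<^sup>2) \<le> 0" .
      thus ?thesis by (simp add: L'_def)
    qed
    note le = this
    have "{\<omega> \<in> space M. (\<Sum>k\<in>I. exp (Y \<omega> k)) \<le> exp (- (L' L))} \<subseteq>
       {\<omega> \<in> space M. (\<Sum>i<n. exp (Y \<omega> i)) \<le> exp (- L)} \<union> (\<Union>i\<in>{..<n} - I. T i)"
    proof
      fix \<omega> assume \<omega>: "\<omega> \<in> {\<omega> \<in> space M. (\<Sum>k\<in>I. exp (Y \<omega> k)) \<le> exp (- (L' L))}"
      show "\<omega> \<in> {\<omega> \<in> space M. (\<Sum>i<n. exp (Y \<omega> i)) \<le> exp (- L)} \<union> (\<Union>i\<in>{..<n} - I. T i)"
      proof (cases "\<exists>i\<in>{..<n} - I. Y \<omega> i > - L - 2 * ln L - ln (real n)")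
        case True
        moreover have "(\<Sum>k\<in>I. exp (Y \<omega> k)) \<le> exp (- L)" using \<omega> order_trans[OF _ le] by blast
        ultimately show ?thesis using \<omega> unfolding T_def by blast
      next
        case False
        have "(\<Sum>i<n. exp (Y \<omega> i)) \<le> exp (- L)"
        proof (rule exp_sum_split[OF L n In])
          show "(\<Sum>k\<in>I. exp (Y \<omega> k)) \<le> exp (- (L - ln (1 - 1 / L\<^sup>2)))" using \<omega> by (simp add: L'_def)
          show "\<And>i. i < n \<Longrightarrow> i \<notin> I \<Longrightarrow> Y \<omega> i \<le> - L - 2 * ln L - ln (real n)"
            using False by (meson DiffI lessThan_iff not_less)
        qed
        thus ?thesis using \<omega> by simp
      qed
    qed
    hence "G (L' L) \<le> measure M ({\<omega> \<in> space M. (\<Sum>i<n. exp (Y \<omega> i)) \<le> exp (- L)} \<union> (\<Union>i\<in>{..<n} - I. T i))"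
      unfolding G_def using Tm Fm by (intro M.finite_measure_mono) auto
    also have "\<dots> \<le> F L + measure M (\<Union>i\<in>{..<n} - I. T i)"
      unfolding F_def using Tm Fm by (intro measure_Un_le) auto
    also have "measure M (\<Union>i\<in>{..<n} - I. T i) \<le> (\<Sum>i\<in>{..<n} - I. measure M (T i))"
      using Tm by (intro M.finite_measure_subadditive_finite) auto
    finally show ?thesis unfolding tail_def T_def by simp
  qed
  have tail: "(\<lambda>L. tail i L / main L) \<in> O(\<lambda>L. 1 / L)" if i: "i \<in> {..<n} - I" for i
  proof -
    obtain \<kappa> b e where \<kappa>: "\<kappa> > 0" and bound: "\<And>L q. L > 0 \<Longrightarrow>
      (\<integral>\<^sup>+ y. indicator {y. (\<Sum>k\<in>I. exp (y k)) \<le> exp (- L) \<and> y i > - L - 2 * ln L - q} y *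
         ennreal (gauss_dens {..<n} \<mu> B y) \<partial>PiM {..<n} (\<lambda>_. lborel))
       \<le> ennreal (exp (- (1 / 2 / quad_form {..<n} B w w + \<kappa>) * L\<^sup>2 + (b + e * q) * L + 2 * e * (L * ln L)))"
      using gauss_dens_tail_bound[OF pd w _ I, of i \<mu>] gap[of i] pos i by blast
    \<comment> \<open>The baseline exponent of the Chernoff bound is that of the leading term, so
      \<open>\<kappa>\<close> is a genuine surplus.\<close>
    have half: "1 / 2 / quad_form {..<n} B w w = S / 2" unfolding S by simp
    define X where "X L = exp (- (S / 2 + \<kappa>) * L\<^sup>2 + (b + e * ln (real n)) * L + 2 * e * (L * ln L))" for L
    have "(\<lambda>L. tail i L / main L) \<in> O(\<lambda>L. X L / main L)"
    proof (rule bigoI)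
      show "\<forall>\<^sub>F L in at_top. norm (tail i L / main L) \<le> 1 * norm (X L / main L)"
        using eventually_gt_at_top[of 0]
      proof eventually_elim
        case (elim L)
        have m: "{y \<in> space (lebesgue_n n). (\<Sum>k\<in>I. exp (y k)) \<le> exp (- L) \<and> y i > - L - 2 * ln L - ln (real n)} \<in> sets (lebesgue_n n)"
        proof -
          have [measurable]: "(\<lambda>y. \<Sum>k\<in>I. exp (y k)) \<in> borel_measurable (lebesgue_n n)"
            using In by (intro borel_measurable_sum_PiM) auto
          have [measurable]: "(\<lambda>y. y i) \<in> borel_measurable (lebesgue_n n)"
            using i by (intro borel_measurable_PiM_component) auto
          show ?thesis by measurable
        qed
        have "ennreal (tail i L) \<le> ennreal (X L)"
          unfolding tail_def M.emeasure_eq_measure[symmetric] distributed_emeasure_Collect[OF Y m] gaussian_density_eq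
          using bound[OF elim, of "ln (real n)"] unfolding X_def half .
        hence "tail i L \<le> X L" by (simp add: X_def)
        thus ?case using main_pos[OF elim] by (simp add: tail_def X_def divide_right_mono)
      qed
    qed
    also have "(\<lambda>L. X L / main L) \<in> O(\<lambda>L. 1 / L)"
      unfolding X_def by (rule decay_over_main[OF \<kappa>])
    finally show ?thesis .
  qed
  have "(\<lambda>L. F L / main L - 1) \<in> O(\<lambda>L. 1 / L)"
  proof (rule asymp_one_sandwich)
    show "\<forall>\<^sub>F L in at_top. F L \<le> G L" using upper by simp
    show "\<forall>\<^sub>F L in at_top. G (L' L) - (\<Sum>i\<in>{..<n} - I. tail i L) \<le> F L"
      using eventually_gt_at_top[of 1] by eventually_elim (rule lower)
    show "\<forall>\<^sub>F L in at_top. main L > 0"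
      using eventually_gt_at_top[of 0] by eventually_elim (rule main_pos)
    show "(\<lambda>L. G L / main L - 1) \<in> O(\<lambda>L. 1 / L)" unfolding G by (rule prob_asymp)
    show "(\<lambda>L. G (L' L) / main L - 1) \<in> O(\<lambda>L. 1 / L)" unfolding G L'_def by (rule prob_shift_asymp)
    show "(\<lambda>L. (\<Sum>i\<in>{..<n} - I. tail i L) / main L) \<in> O(\<lambda>L. 1 / L)"
      unfolding sum_divide_distrib by (intro big_sum_in_bigo tail)
  qed
  thus ?thesis by (simp add: F_def)
qed

text \<open>The power \<open>(card I - 1) / 2\<close> of \<open>2 * pi\<close> from Stirling's
  formula meets the power \<open>card I / 2\<close> in the Gaussian normalisation and leaves
  \<open>1 / sqrt (2 * pi)\<close>; writing \<open>1 / sqrt S\<close> as \<open>sqrt S / S\<close>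
  produces the shape \<open>C / S\<close>.\<close>

lemma main_eq:
  assumes "x > 0"
  shows "main (ln (1 / x)) =
    1 / (sqrt (2 * pi) * sqrt (det_on I B)) * sqrt S / sqrt (\<Prod>k\<in>I. A k)
      * exp (- (1/2) * (\<Sum>i\<in>I. \<Sum>j\<in>I. inv_on I B i j * (ln (S / A i) + \<mu> i) * (ln (S / A j) + \<mu> j))) / S
    * ln (1/x) powr (- (1 + real (card I)) / 2)
    * x powr (\<Sum>k\<in>I. A k * (ln (S / A k) + \<mu> k)) * exp (- (1/2) * S * (ln (1/x))\<^sup>2)"
proof -
  have g0: "g0 = exp (- (1/2) * (\<Sum>i\<in>I. \<Sum>j\<in>I. inv_on I B i j * (ln (S / A i) + \<mu> i) * (ln (S / A j) + \<mu> j)))"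
  proof -
    have "(\<Sum>i\<in>I. \<Sum>j\<in>I. (0 - m i) * Q i j * (0 - m j)) = (\<Sum>i\<in>I. \<Sum>j\<in>I. Q i j * m i * m j)"
      by (intro sum.cong refl) simp
    thus ?thesis unfolding g0_def g_def quad_form_def by (simp add: Q_def m_def c_def)
  qed
  have "norm_const * d = 1 / (sqrt (2 * pi) * sqrt (det_on I B)) * sqrt S / sqrt (\<Prod>k\<in>I. A k) / S"
  proof -
    have pw: "(2 * pi) powr ((real (card I) - 1) / 2) = sqrt ((2 * pi) ^ card I) / sqrt (2 * pi)"
    proof -
      have "(2 * pi) powr ((real (card I) - 1) / 2) = (2 * pi) powr (real (card I) / 2) / (2 * pi) powr (1 / 2)"
        unfolding powr_diff[symmetric] by (simp add: diff_divide_distrib)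
      also have "(2 * pi) powr (real (card I) / 2) = sqrt ((2 * pi) ^ card I)"
      proof -
        have "((2 * pi) powr real (card I)) powr (1 / 2) = (2 * pi) powr (real (card I) / 2)"
          unfolding powr_powr by simp
        moreover have "sqrt ((2 * pi) ^ card I) = ((2 * pi) ^ card I) powr (1 / 2)"
          by (rule powr_half_sqrt[symmetric]) simp
        moreover have "(2 * pi) ^ card I = (2 * pi) powr real (card I)" by (rule powr_realpow[symmetric]) simp
        ultimately show ?thesis by (simp only:)
      qed
      also have "(2 * pi) powr (1 / 2) = sqrt (2 * pi)" by (rule powr_half_sqrt) simp
      finally show ?thesis .
    qed
    define P where "P = sqrt ((2 * pi) ^ card I)"
    have "P > 0" by (simp add: P_def)
    hence cancel: "1 / (P * u) * (P / v / (q * R)) = 1 / (v * u) / R * (1 / q)" for u v q R :: real by simp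
    have "norm_const * d = 1 / (sqrt (2 * pi) * sqrt (det_on I B)) / sqrt (\<Prod>k\<in>I. A k) * (1 / sqrt S)"
      unfolding norm_const_def d_def pw real_sqrt_mult[of _ "det_on I B"] P_def[symmetric] by (rule cancel)
    also have "1 / sqrt S = sqrt S / S" using S_pos by (simp add: field_simps)
    finally show ?thesis by simp
  qed
  moreover have "exp (- ln (1 / x) * \<beta>) = x powr (\<Sum>k\<in>I. A k * (ln (S / A k) + \<mu> k))"
    using assms by (simp add: powr_def \<beta>_def m_def c_def ln_div mult.commute)
  ultimately show ?thesis
    unfolding main_def g0 by simp
qed

end

text \<open>The Gaussian vector enters through its density, which exists because the covariance is
  nonsingular. The factor \<open>1 + O(1 / log (1 / x))\<close> is rendered additively, which is
  equivalent since the leading term is positive for \<open>0 < x < 1\<close>.\<close>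

theorem theorem1:
  fixes M :: "'a measure" and Y :: "'a \<Rightarrow> nat \<Rightarrow> real"
    and n :: nat and \<mu> :: "nat \<Rightarrow> real" and B :: "nat \<Rightarrow> nat \<Rightarrow> real"
    and wbar :: "nat \<Rightarrow> real"
  defines "Ibar \<equiv> {i. i < n \<and> wbar i \<noteq> 0}"
  defines "nbar \<equiv> card Ibar"
  defines "abar \<equiv> inv_on Ibar B"
  defines "Abar \<equiv> (\<lambda>k. \<Sum>j\<in>Ibar. abar k j)"
  defines "S \<equiv> (\<Sum>k\<in>Ibar. Abar k)"
  defines "C \<equiv> 1 / (sqrt (2 * pi) * sqrt (det_on Ibar B)) * sqrt S / sqrt (\<Prod>k\<in>Ibar. Abar k)
      * exp (- (1/2) * (\<Sum>i\<in>Ibar. \<Sum>j\<in>Ibar.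
            abar i j * (ln (S / Abar i) + \<mu> i) * (ln (S / Abar j) + \<mu> j)))"
  assumes prob: "prob_space M"
    and sym: "\<forall>i<n. \<forall>j<n. B i j = B j i"
    and psd: "\<forall>v. quad_form {..<n} B v v \<ge> 0"
    and det_pos: "det_on {..<n} B > 0"
    and gauss: "distributed M (lebesgue_n n) Y (\<lambda>y. ennreal (gaussian_density n \<mu> B y))"
    and wbar_in: "wbar \<in> std_simplex n"
    and wbar_min: "\<forall>w\<in>std_simplex n. quad_form {..<n} B wbar wbar \<le> quad_form {..<n} B w w"
    and assmA: "\<forall>i<n. i \<notin> Ibar \<longrightarrow>
                 quad_form {..<n} B (\<lambda>k. (if k = i then 1 else 0) - wbar k) wbar \<noteq> 0"
  shows "(\<lambda>x. measure M {\<omega> \<in> space M. (\<Sum>i<n. exp (Y \<omega> i)) \<le> x}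
            - C / S * ln (1/x) powr (- (1 + real nbar) / 2)
              * x powr (\<Sum>k\<in>Ibar. Abar k * (ln (S / Abar k) + \<mu> k))
              * exp (- (1/2) * S * (ln (1/x))\<^sup>2))
       \<in> O[at_right 0](\<lambda>x. C / S * ln (1/x) powr (- (1 + real nbar) / 2)
              * x powr (\<Sum>k\<in>Ibar. Abar k * (ln (S / Abar k) + \<mu> k))
              * exp (- (1/2) * S * (ln (1/x))\<^sup>2) / ln (1/x))"
proof -
  have pd: "posdef_on {..<n} B" using sym psd det_pos by (intro posdef_on_of_psd) auto
  define s where "s = quad_form {..<n} B wbar wbar"
  note kkt = simplex_minimizer_kkt[OF pd wbar_in wbar_min, folded s_def]
  note rows = simplex_minimizer_row_sums[OF pd wbar_in wbar_min, folded s_def Ibar_def]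
  have In: "Ibar \<subseteq> {..<n}" by (auto simp: Ibar_def)
  have w1: "(\<Sum>i<n. wbar i) = 1" using wbar_in by (simp add: std_simplex_def)
  have n: "n > 0" using w1 by (cases n) auto
  interpret X: positive_row_sums Ibar B \<mu>
  proof
    show "posdef_on Ibar B" by (rule posdef_on_subset[OF pd In])
    show "Ibar \<noteq> {}"
    proof
      assume "Ibar = {}"
      hence "(\<Sum>i<n. wbar i) = 0" by (intro sum.neutral) (auto simp: Ibar_def)
      thus False using w1 by simp
    qed
    fix k assume k: "k \<in> Ibar"
    hence "wbar k > 0" using wbar_in by (auto simp: Ibar_def std_simplex_def order_less_le)
    thus "(\<Sum>j\<in>Ibar. inv_on Ibar B k j) > 0" using rows(1)[OF k] kkt(1) by simp
  qed
  have A: "X.A = Abar" by (simp add: fun_eq_iff X.A_def X.Q_def Abar_def abar_def)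
  have S: "X.S = S" by (simp add: X.S_def S_def A)
  \<comment> \<open>The first-order conditions give the weak inequality; the nondegeneracy
    assumption excludes equality.\<close>
  have gap: "mat_vec_on {..<n} B wbar i > s" if "i < n" "i \<notin> Ibar" for i
    using kkt(2,3)[OF that(1)] assmA that by fastforce
  define F where "F x = measure M {\<omega> \<in> space M. (\<Sum>i<n. exp (Y \<omega> i)) \<le> x}" for x
  define G where "G x = C / S * ln (1/x) powr (- (1 + real nbar) / 2)
              * x powr (\<Sum>k\<in>Ibar. Abar k * (ln (S / Abar k) + \<mu> k))
              * exp (- (1/2) * S * (ln (1/x))\<^sup>2)" for x
  have G: "G x = X.main (ln (1 / x))" if "x > 0" for x
    unfolding X.main_eq[OF that] A S by (simp add: G_def C_def abar_def nbar_def)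
  have "(\<lambda>L. F (exp (- L)) / X.main L - 1) \<in> O(\<lambda>L. 1 / L)"
    unfolding F_def
  proof (rule X.sum_prob_asymp[OF prob n pd gauss wbar_in])
    show "Ibar = {i. i < n \<and> wbar i \<noteq> 0}" by (simp add: Ibar_def)
    show "X.S = 1 / quad_form {..<n} B wbar wbar"
      using rows(2) by (simp add: X.S_def X.A_def X.Q_def s_def)
  qed (use kkt(1) gap in \<open>auto simp: s_def\<close>)
  moreover have "filterlim (\<lambda>x::real. ln (1 / x)) at_top (at_right 0)" by real_asymp
  ultimately have "(\<lambda>x. F (exp (- ln (1 / x))) / X.main (ln (1 / x)) - 1) \<in> O[at_right 0](\<lambda>x. 1 / ln (1 / x))"
    by (rule landau_o.big.compose)
  \<comment> \<open>Multiplying the relative error by the leading term turns it into the additive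
    form of the claim.\<close>
  hence m: "(\<lambda>x. X.main (ln (1 / x)) * (F (exp (- ln (1 / x))) / X.main (ln (1 / x)) - 1)) \<in>
      O[at_right 0](\<lambda>x. X.main (ln (1 / x)) * (1 / ln (1 / x)))"
    by (intro landau_o.big.mult landau_o.big_refl)
  have small: "\<forall>\<^sub>F x::real in at_right 0. 0 < x \<and> x < 1"
    using eventually_at_right_real[of 0 1] by simp
  have e1: "\<forall>\<^sub>F x in at_right 0. X.main (ln (1 / x)) * (F (exp (- ln (1 / x))) / X.main (ln (1 / x)) - 1) = F x - G x"
    using small
  proof eventually_elim
    case (elim x)
    have "X.main (ln (1 / x)) > 0" using elim by (intro X.main_pos) simp
    moreover have "exp (- ln (1 / x)) = x" using elim by (simp add: ln_div)
    ultimately show ?case using G[of x] elim by (simp add: right_diff_distrib)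
  qed
  have e2: "\<forall>\<^sub>F x in at_right 0. X.main (ln (1 / x)) * (1 / ln (1 / x)) = G x / ln (1 / x)"
    using small by eventually_elim (simp add: G)
  from landau_o.big.cong_ex[OF e1 e2, THEN iffD1, OF m]
  show ?thesis unfolding F_def G_def .
qed

end
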